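(* Let $K$ be a field, let $E$ be a directed graph, and let $M$ be a graded simple $L_K(E)$-module. Then the annihilator of $M$ is equal to the annihilator of a module of exactly one of the following four types. (1) (Strictly-decreasing-infinite-path type) $\mathbf V_{[\alpha]}$ where $\alpha$ is a strictly decreasing infinite path such that $R(v)\subsetneq R(\alpha^0)$ for every $v\in R(\alpha^0)$. (2) (Relative-sink types) $\mathbf N_v$ where $v$ is a sink, or $\mathbf N_{v\emptyset}$ where $v$ is an infinite emitter which emits no edge with range in $R(v)$. (3) (Extreme-cycle types) $\mathbf V_{[\alpha]}$ where $\alpha$ is an irrational infinite path such that the vertices of $\alpha^0$ are on cycles extreme in $R(\alpha^0)$; or $\mathbf N_{v\infty}$ where $v$ is an infinite emitter which emits infinitely many edges with range in $R(v)$; or $\mathbf N_{v\in B_H}$ where $v$ is an infinite emitter such that the number of edges emitted by $v$ with range in $R(v)$ is finite and larger than $1$. (4) (Exclusive-cycle types) $\mathbf N_c$ where $c$ is an exclusive cycle, or $\mathbf N_{v\in B_H}$ where $v$ is an infinite emitter which emits exactly one edge with range in $R(v)$.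
   Context: Graphs. A directed graph $E$ has vertex set $E^0$, edge set $E^1$ and source and range maps $\mathbf s,\mathbf r:E^1\to E^0$ (arbitrary cardinalities). A sink emits no edges; an infinite emitter emits infinitely many edges; a vertex is regular if it is neither. A path is a vertex (length $0$) or a finite sequence $e_1\cdots e_n$ of edges with $\mathbf r(e_i)=\mathbf s(e_{i+1})$; $|p|$ is the length of $p$; $\mathbf s,\mathbf r$ extend to paths; $p^0$ is the set of vertices on $p$. A path is closed if its source equals its range. A cycle is a closed path (of positive length) such that different edges in it have different sources; cycles differing only by the choice of the starting vertex are identified. An exit of a cycle is an edge outside of the cycle emitted by a vertex of the cycle. A cycle $c$ is exclusive if no vertex of $c$ is on a cycle distinct from $c$. For $V\subseteq E^0$, a cycle $c$ is extreme in $V$ if $c^0\subseteq V$, $c$ has an exit with range in $V$, and for every path $p$ with $\mathbf s(p)\in c^0$ and $p^0\subseteq V$ there is a path $q$ with $q^0\subseteq V$, $\mathbf s(q)=\mathbf r(p)$ and $\mathbf r(q)\in c^0$. Write $u\ge v$ if there is a path from $u$ to $v$, and $u\gneq v$ if $u\geq v$ but not $v\geq u$. For $V\subseteq E^0$, $R(V)=\{u\in E^0\mid u\ge v\text{ for some }v\in V\}$ and $R(v)=R(\{v\})$. An infinite path is a sequence $\alpha=e_1e_2\cdots$ of edges with $\mathbf r(e_n)=\mathbf s(e_{n+1})$ for all $n$; $\alpha^0$ is its set of vertices. Two infinite paths are tail equivalent if they become equal after removing finite prefixes (possibly of different lengths). An infinite path is rational if it is tail equivalent to $ccc\cdots$ for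 a cycle $c$, and irrational otherwise. It is strictly decreasing if $\alpha=p_1p_2\cdots$ for paths $p_n$ with $\mathbf s(p_1)\gneq\mathbf s(p_2)\gneq\cdots$. Leavitt path algebra. $L_K(E)$ is the $K$-algebra generated by $E^0\cup E^1\cup\{e^*\mid e\in E^1\}$ with relations: $vw=\delta_{v,w}v$; $\mathbf s(e)e=e\mathbf r(e)=e$; $\mathbf r(e)e^*=e^*\mathbf s(e)=e^*$; $e^*f=\delta_{e,f}\mathbf r(e)$; and $v=\sum_{e\in\mathbf s^{-1}(v)}ee^*$ for each regular vertex $v$. It is $\mathbb Z$-graded, the $n$-component being the span of elements $pq^*$ for paths $p,q$ with $|p|-|q|=n$, where $(e_1\cdots e_n)^*=e_n^*\cdots e_1^*$ and $v^*=v$. Modules are left modules. A $\mathbb Z$-graded module $M$ over $R=L_K(E)$ is graded simple if $RM\neq 0$ and $M$ has no proper nontrivial graded submodules. $\operatorname{ann}(M)=\{r\in R\mid rM=0\}$. Branching systems. A branching system of $E$ is a set $X$ with subsets $X_v$ ($v\in E^0$), $X_e$ ($e\in E^1$) and bijections $\sigma_e:X_{\mathbf r(e)}\to X_e$ such that the $X_v$ are mutually disjoint, the $X_e$ are mutually disjoint, $X_e\subseteq X_{\mathbf s(e)}$, and $X_v=\bigcup_{e\in\mathbf s^{-1}(v)}X_e$ for each regular $v$. Then $M(X)$ is the $K$-vector space with basis $X$ and the $L_K(E)$-module structure: for $x\in X$, $v\cdot x=x$ if $x\in X_v$ and $0$ otherwise; $e\cdot x=\sigma_e(x)$ if $x\in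 X_{\mathbf r(e)}$ and $0$ otherwise; $e^*\cdot x=\sigma_e^{-1}(x)$ if $x\in X_e$ and $0$ otherwise. The modules. - For an infinite path $\alpha$, $\mathbf V_{[\alpha]}=M(X)$ where $X$ is the set of infinite paths tail equivalent to $\alpha$, $X_v$ consists of those with source $v$, $X_e$ of those with first edge $e$, and $\sigma_e(\beta)=e\beta$. - For a vertex $v$ which is a sink or an infinite emitter, $\mathbf N_v=M(X)$ where $X$ is the set of all paths ending at $v$ (including $v$), $X_w$ consists of those with source $w$, $X_e$ of those with first edge $e$, and $\sigma_e(p)=ep$. For an infinite emitter $v$, $\mathbf N_v$ is denoted $\mathbf N_{v\emptyset}$, $\mathbf N_{v\in B_H}$ or $\mathbf N_{v\infty}$ when the set of edges emitted by $v$ with range in $R(v)$ is empty, nonempty and finite, or infinite, respectively. - For an exclusive cycle $c$ and $v\in c^0$, let $Y$ be the set of formal words $pq^*$ (paths in the extended graph, obtained from $E$ by adding reversed edges $e^*$) where $p,q$ are paths of $E$ with $\mathbf r(p)=\mathbf r(q)\in c^0$ and $\mathbf s(q)=v$. A word $pq^*\in Y$ is not reduced if $p$ and $q$ have positive length and end with the same edge, and is reduced otherwise; $\operatorname{red}(pq^* )$ is the reduced word obtained by repeatedly replacing $(p'e)(q'e)^*$ by $p'q'^*$. Let $X$ be the set of reduced elements of $Y$, $X_w=\{pq^*\in X\mid\mathbf s(p)=w\}$, $X_e=\{\operatorname{red}(ers^* )\mid ers^*\in Y\}$ and $\sigma_e(pq^* )=\operatorname{red}(epq^* )$. This is a branching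 system and $\mathbf N_c=\mathbf N_c^v=M(X)$. *)

theory Defs
  imports "HOL-Library.Poly_Mapping" "Graph_Theory.Arc_Walk" "HOL-Algebra.QuotRing" "HOL-Algebra.Module"
begin

section \<open>Directed graphs\<close>

text \<open>
  A graph is a \<^locale>\<open>wf_digraph\<close>: vertices \<^term>\<open>verts E\<close>, edges \<^term>\<open>arcs E\<close>, source map
  \<^term>\<open>tail E\<close> and range map \<^term>\<open>head E\<close>, of arbitrary cardinalities.  A path is a pair of its
  source and the list of its edges, so that the pair \<open>(v, [])\<close> is the vertex \<open>v\<close>.  The relation
  \<open>u \<ge> v\<close> is \<^term>\<open>reachable E u v\<close>.
\<close>

definition sink :: "('v, 'e) pre_digraph \<Rightarrow> 'v \<Rightarrow> bool" where
  "sink E v \<longleftrightarrow> v \<in> verts E \<and> out_arcs E v = {}"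

definition infinite_emitter :: "('v, 'e) pre_digraph \<Rightarrow> 'v \<Rightarrow> bool" where
  "infinite_emitter E v \<longleftrightarrow> v \<in> verts E \<and> infinite (out_arcs E v)"

definition regular_vertex :: "('v, 'e) pre_digraph \<Rightarrow> 'v \<Rightarrow> bool" where
  "regular_vertex E v \<longleftrightarrow> v \<in> verts E \<and> \<not> sink E v \<and> \<not> infinite_emitter E v"

type_synonym ('v, 'e) path = "'v \<times> 'e list"

definition is_path :: "('v, 'e) pre_digraph \<Rightarrow> ('v, 'e) path \<Rightarrow> bool" where
  "is_path E p \<longleftrightarrow> (\<exists>v. pre_digraph.awalk E (fst p) (snd p) v)"

definition path_verts :: "('v, 'e) pre_digraph \<Rightarrow> ('v, 'e) path \<Rightarrow> 'v set" where
  "path_verts E p = set (pre_digraph.awalk_verts E (fst p) (snd p))"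

definition path_range :: "('v, 'e) pre_digraph \<Rightarrow> ('v, 'e) path \<Rightarrow> 'v" where
  "path_range E p = last (pre_digraph.awalk_verts E (fst p) (snd p))"

definition strictly_above :: "('v, 'e) pre_digraph \<Rightarrow> 'v \<Rightarrow> 'v \<Rightarrow> bool" where
  "strictly_above E u v \<longleftrightarrow> reachable E u v \<and> \<not> reachable E v u"

text \<open>The set \<open>R(V)\<close>.\<close>

definition root_set :: "('v, 'e) pre_digraph \<Rightarrow> 'v set \<Rightarrow> 'v set" where
  "root_set E V = {u \<in> verts E. \<exists>v\<in>V. reachable E u v}"

text \<open>
  Cycles are those of \<^const>\<open>pre_digraph.cycle\<close>: the nonempty closed edge lists whose entries
  have pairwise different sources, see \<open>cycle_iff_distinct_sources\<close> below.  Two such lists represent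
  the same cycle iff one is a rotation of the other.
\<close>

definition same_cycle :: "'e list \<Rightarrow> 'e list \<Rightarrow> bool" where
  "same_cycle c d \<longleftrightarrow> (\<exists>n. d = rotate n c)"

definition cycle_verts :: "('v, 'e) pre_digraph \<Rightarrow> 'e list \<Rightarrow> 'v set" where
  "cycle_verts E c = tail E ` set c"

definition is_exit :: "('v, 'e) pre_digraph \<Rightarrow> 'e list \<Rightarrow> 'e \<Rightarrow> bool" where
  "is_exit E c e \<longleftrightarrow> e \<in> arcs E \<and> e \<notin> set c \<and> tail E e \<in> cycle_verts E c"

definition exclusive_cycle :: "('v, 'e) pre_digraph \<Rightarrow> 'e list \<Rightarrow> bool" where
  "exclusive_cycle E c \<longleftrightarrow> pre_digraph.cycle E c \<and>
     (\<forall>d. pre_digraph.cycle E d \<and> \<not> same_cycle c d \<longrightarrow> cycle_verts E c \<inter> cycle_verts E d = {})"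

definition extreme_cycle :: "('v, 'e) pre_digraph \<Rightarrow> 'v set \<Rightarrow> 'e list \<Rightarrow> bool" where
  "extreme_cycle E V c \<longleftrightarrow> pre_digraph.cycle E c \<and> cycle_verts E c \<subseteq> V \<and>
     (\<exists>e. is_exit E c e \<and> head E e \<in> V) \<and>
     (\<forall>p. is_path E p \<and> fst p \<in> cycle_verts E c \<and> path_verts E p \<subseteq> V \<longrightarrow>
        (\<exists>q. is_path E q \<and> path_verts E q \<subseteq> V \<and> fst q = path_range E p \<and>
           path_range E q \<in> cycle_verts E c))"

definition infinite_path :: "('v, 'e) pre_digraph \<Rightarrow> (nat \<Rightarrow> 'e) \<Rightarrow> bool" where
  "infinite_path E \<alpha> \<longleftrightarrow> (\<forall>n. \<alpha> n \<in> arcs E \<and> head E (\<alpha> n) = tail E (\<alpha> (Suc n)))"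

definition infinite_path_verts :: "('v, 'e) pre_digraph \<Rightarrow> (nat \<Rightarrow> 'e) \<Rightarrow> 'v set" where
  "infinite_path_verts E \<alpha> = range (\<lambda>n. tail E (\<alpha> n))"

definition tail_equivalent :: "(nat \<Rightarrow> 'e) \<Rightarrow> (nat \<Rightarrow> 'e) \<Rightarrow> bool" where
  "tail_equivalent \<alpha> \<beta> \<longleftrightarrow> (\<exists>m n. \<forall>k. \<alpha> (m + k) = \<beta> (n + k))"

definition rational_path :: "('v, 'e) pre_digraph \<Rightarrow> (nat \<Rightarrow> 'e) \<Rightarrow> bool" where
  "rational_path E \<alpha> \<longleftrightarrow> infinite_path E \<alpha> \<and>
     (\<exists>c. pre_digraph.cycle E c \<and> tail_equivalent \<alpha> (\<lambda>n. c ! (n mod length c)))"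

definition irrational_path :: "('v, 'e) pre_digraph \<Rightarrow> (nat \<Rightarrow> 'e) \<Rightarrow> bool" where
  "irrational_path E \<alpha> \<longleftrightarrow> infinite_path E \<alpha> \<and> \<not> rational_path E \<alpha>"

text \<open>
  A factorization \<open>\<alpha> = p\<^sub>1 p\<^sub>2 \<dots>\<close> is given by the positions \<open>k 0 = 0 < k 1 < \<dots>\<close> at which the factors
  start; factors of length \<open>0\<close> cannot occur, as their sources would not decrease strictly.
\<close>

definition strictly_decreasing_path :: "('v, 'e) pre_digraph \<Rightarrow> (nat \<Rightarrow> 'e) \<Rightarrow> bool" where
  "strictly_decreasing_path E \<alpha> \<longleftrightarrow> infinite_path E \<alpha> \<and>
     (\<exists>k::nat \<Rightarrow> nat. k 0 = 0 \<and> strict_mono k \<and>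
        (\<forall>n. strictly_above E (tail E (\<alpha> (k n))) (tail E (\<alpha> (k (Suc n))))))"


section \<open>Modules over rings without identity, annihilators, gradings\<close>

text \<open>
  \<^locale>\<open>module\<close> is about unital modules over commutative rings.  Only the carrier, the addition and
  the multiplication of \<open>R\<close> matter below.
\<close>

locale left_module = abelian_group M for R :: "('r, 's) ring_scheme" (structure)
    and M :: "('r, 'm, 't) module_scheme" (structure) +
  assumes smult_closed: "\<lbrakk>r \<in> carrier R; x \<in> carrier M\<rbrakk> \<Longrightarrow> r \<odot>\<^bsub>M\<^esub> x \<in> carrier M"
    and smult_l_distr: "\<lbrakk>r \<in> carrier R; s \<in> carrier R; x \<in> carrier M\<rbrakk> \<Longrightarrow>
      (r \<oplus>\<^bsub>R\<^esub> s) \<odot>\<^bsub>M\<^esub> x = r \<odot>\<^bsub>M\<^esub> x \<oplus>\<^bsub>M\<^esub> s \<odot>\<^bsub>M\<^esub> x"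
    and smult_r_distr: "\<lbrakk>r \<in> carrier R; x \<in> carrier M; y \<in> carrier M\<rbrakk> \<Longrightarrow>
      r \<odot>\<^bsub>M\<^esub> (x \<oplus>\<^bsub>M\<^esub> y) = r \<odot>\<^bsub>M\<^esub> x \<oplus>\<^bsub>M\<^esub> r \<odot>\<^bsub>M\<^esub> y"
    and smult_assoc: "\<lbrakk>r \<in> carrier R; s \<in> carrier R; x \<in> carrier M\<rbrakk> \<Longrightarrow>
      (r \<otimes>\<^bsub>R\<^esub> s) \<odot>\<^bsub>M\<^esub> x = r \<odot>\<^bsub>M\<^esub> (s \<odot>\<^bsub>M\<^esub> x)"

definition annihilator :: "('r, 's) ring_scheme \<Rightarrow> ('r, 'm, 't) module_scheme \<Rightarrow> 'r set" where
  "annihilator R M = {r \<in> carrier R. \<forall>x\<in>carrier M. r \<odot>\<^bsub>M\<^esub> x = \<zero>\<^bsub>M\<^esub>}"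

definition homogeneous_decomposition ::
  "('r, 'm, 't) module_scheme \<Rightarrow> (int \<Rightarrow> 'm set) \<Rightarrow> 'm \<Rightarrow> (int \<Rightarrow> 'm) \<Rightarrow> bool" where
  "homogeneous_decomposition M Mg x f \<longleftrightarrow> (\<forall>n. f n \<in> Mg n) \<and> finite {n. f n \<noteq> \<zero>\<^bsub>M\<^esub>} \<and>
     x = finsum M f {n. f n \<noteq> \<zero>\<^bsub>M\<^esub>}"

locale graded_left_module = left_module R M for R :: "('r, 's) ring_scheme" (structure)
    and Rg :: "int \<Rightarrow> 'r set" and M :: "('r, 'm, 't) module_scheme" (structure)
    and Mg :: "int \<Rightarrow> 'm set" +
  assumes component_subgroup: "additive_subgroup (Mg n) M"
    and direct_sum: "x \<in> carrier M \<Longrightarrow> \<exists>!f. homogeneous_decomposition M Mg x f"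
    and smult_component: "\<lbrakk>r \<in> Rg i; x \<in> Mg j\<rbrakk> \<Longrightarrow> r \<odot>\<^bsub>M\<^esub> x \<in> Mg (i + j)"

definition graded_submodule ::
  "('r, 's) ring_scheme \<Rightarrow> ('r, 'm, 't) module_scheme \<Rightarrow> (int \<Rightarrow> 'm set) \<Rightarrow> 'm set \<Rightarrow> bool" where
  "graded_submodule R M Mg N \<longleftrightarrow> submodule N R M \<and>
     (\<forall>x\<in>N. \<exists>f. homogeneous_decomposition M (\<lambda>n. N \<inter> Mg n) x f)"

definition graded_simple ::
  "('r, 's) ring_scheme \<Rightarrow> (int \<Rightarrow> 'r set) \<Rightarrow> ('r, 'm, 't) module_scheme \<Rightarrow> (int \<Rightarrow> 'm set) \<Rightarrow> bool" where
  "graded_simple R Rg M Mg \<longleftrightarrow> graded_left_module R Rg M Mg \<and>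
     (\<exists>r\<in>carrier R. \<exists>x\<in>carrier M. r \<odot>\<^bsub>M\<^esub> x \<noteq> \<zero>\<^bsub>M\<^esub>) \<and>
     (\<forall>N. graded_submodule R M Mg N \<longrightarrow> N = {\<zero>\<^bsub>M\<^esub>} \<or> N = carrier M)"


section \<open>Leavitt path algebras\<close>

text \<open>
  Lists form the free monoid, so finitely supported functions on lists of generators form the free
  associative unital algebra, with the convolution product of \<^theory>\<open>HOL-Library.Poly_Mapping\<close>.
\<close>

instantiation list :: (type) monoid_add
begin
definition zero_list :: "'a list" where "zero_list = []"
definition plus_list :: "'a list \<Rightarrow> 'a list \<Rightarrow> 'a list" where "plus_list = (@)"
instance by standard (simp_all add: zero_list_def plus_list_def)
end

datatype ('v, 'e) generator = Vertex 'v | Edge 'e | Ghost 'e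

definition generators :: "('v, 'e) pre_digraph \<Rightarrow> ('v, 'e) generator set" where
  "generators E = Vertex ` verts E \<union> Edge ` arcs E \<union> Ghost ` arcs E"

type_synonym ('v, 'e, 'k) free_elem = "('v, 'e) generator list \<Rightarrow>\<^sub>0 'k"

definition free_algebra :: "('v, 'e) pre_digraph \<Rightarrow> ('v, 'e, 'k::field) free_elem ring" where
  "free_algebra E = \<lparr>carrier = {a. Poly_Mapping.keys a \<subseteq> lists (generators E)},
     mult = (*), one = 1, zero = 0, add = (+)\<rparr>"

abbreviation word :: "('v, 'e) generator list \<Rightarrow> ('v, 'e, 'k::field) free_elem" where
  "word w \<equiv> Poly_Mapping.single w 1"

text \<open>The differences of the two sides of the defining relations.\<close>

inductive_set leavitt_relators :: "('v, 'e) pre_digraph \<Rightarrow> ('v, 'e, 'k::field) free_elem set"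
  for E where
  vertex_vertex: "\<lbrakk>v \<in> verts E; w \<in> verts E\<rbrakk> \<Longrightarrow>
    word [Vertex v, Vertex w] - (if v = w then word [Vertex v] else 0) \<in> leavitt_relators E"
| source_edge: "e \<in> arcs E \<Longrightarrow> word [Vertex (tail E e), Edge e] - word [Edge e] \<in> leavitt_relators E"
| edge_range: "e \<in> arcs E \<Longrightarrow> word [Edge e, Vertex (head E e)] - word [Edge e] \<in> leavitt_relators E"
| range_ghost: "e \<in> arcs E \<Longrightarrow> word [Vertex (head E e), Ghost e] - word [Ghost e] \<in> leavitt_relators E"
| ghost_source: "e \<in> arcs E \<Longrightarrow> word [Ghost e, Vertex (tail E e)] - word [Ghost e] \<in> leavitt_relators E"
| ghost_edge: "\<lbrakk>e \<in> arcs E; f \<in> arcs E\<rbrakk> \<Longrightarrow>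
    word [Ghost e, Edge f] - (if e = f then word [Vertex (head E e)] else 0) \<in> leavitt_relators E"
| regular: "regular_vertex E v \<Longrightarrow>
    word [Vertex v] - (\<Sum>e\<in>out_arcs E v. word [Edge e, Ghost e]) \<in> leavitt_relators E"

definition leavitt_ideal :: "('v, 'e) pre_digraph \<Rightarrow> ('v, 'e, 'k::field) free_elem set" where
  "leavitt_ideal E = Idl\<^bsub>free_algebra E\<^esub> (leavitt_relators E)"

definition leavitt_class :: "('v, 'e) pre_digraph \<Rightarrow> ('v, 'e, 'k::field) free_elem \<Rightarrow>
    ('v, 'e, 'k) free_elem set" where
  "leavitt_class E a = leavitt_ideal E +>\<^bsub>free_algebra E\<^esub> a"

text \<open>
  \<open>L\<^sub>K(E)\<close> has no identity if \<open>E\<close> has infinitely many vertices; it is the subring of the quotient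
  of the unital free algebra that consists of the classes of elements without constant term.  The
  field \<^const>\<open>one\<close> of the record need not lie in the carrier and is not used.  The
  coefficient field \<open>K\<close> is the type \<open>'k\<close>.
\<close>

definition leavitt_algebra :: "('v, 'e) pre_digraph \<Rightarrow> ('v, 'e, 'k::field) free_elem set ring" where
  "leavitt_algebra E = (free_algebra E Quot leavitt_ideal E)
     \<lparr>carrier := leavitt_class E ` {a \<in> carrier (free_algebra E). [] \<notin> Poly_Mapping.keys a}\<rparr>"

definition path_word :: "('v, 'e) path \<Rightarrow> ('v, 'e) generator list" where
  "path_word p = (if snd p = [] then [Vertex (fst p)] else map Edge (snd p))"

definition ghost_word :: "('v, 'e) path \<Rightarrow> ('v, 'e) generator list" where
  "ghost_word p = (if snd p = [] then [Vertex (fst p)] else rev (map Ghost (snd p)))"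

text \<open>The classes of the linear combinations of the words \<open>p q\<^sup>*\<close> with \<open>|p| - |q| = n\<close>.\<close>

definition leavitt_component :: "('v, 'e) pre_digraph \<Rightarrow> int \<Rightarrow> ('v, 'e, 'k::field) free_elem set set" where
  "leavitt_component E n = leavitt_class E ` {a. Poly_Mapping.keys a \<subseteq>
     {path_word p @ ghost_word q | p q. is_path E p \<and> is_path E q \<and>
        int (length (snd p)) - int (length (snd q)) = n}}"


section \<open>Branching systems\<close>

record ('v, 'e, 'x) branching =
  points :: "'x set"
  vertex_set :: "'v \<Rightarrow> 'x set"
  edge_set :: "'e \<Rightarrow> 'x set"
  edge_map :: "'e \<Rightarrow> 'x \<Rightarrow> 'x"

locale branching_system = wf_digraph E for E :: "('v, 'e) pre_digraph" +
  fixes X :: "('v, 'e, 'x) branching"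
  assumes vertex_set_subset: "v \<in> verts E \<Longrightarrow> vertex_set X v \<subseteq> points X"
    and edge_set_subset: "e \<in> arcs E \<Longrightarrow> edge_set X e \<subseteq> vertex_set X (tail E e)"
    and edge_map_bij: "e \<in> arcs E \<Longrightarrow>
      bij_betw (edge_map X e) (vertex_set X (head E e)) (edge_set X e)"
    and vertex_sets_disjoint: "\<lbrakk>v \<in> verts E; w \<in> verts E; v \<noteq> w\<rbrakk> \<Longrightarrow>
      vertex_set X v \<inter> vertex_set X w = {}"
    and edge_sets_disjoint: "\<lbrakk>e \<in> arcs E; f \<in> arcs E; e \<noteq> f\<rbrakk> \<Longrightarrow>
      edge_set X e \<inter> edge_set X f = {}"
    and vertex_set_regular: "regular_vertex E v \<Longrightarrow>
      vertex_set X v = (\<Union>e\<in>out_arcs E v. edge_set X e)"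

text \<open>On basis elements, generators and words act as partial maps; \<^const>\<open>None\<close> stands for \<open>0\<close>.\<close>

fun generator_act :: "('v, 'e) pre_digraph \<Rightarrow> ('v, 'e, 'x) branching \<Rightarrow>
    ('v, 'e) generator \<Rightarrow> 'x \<Rightarrow> 'x option" where
  "generator_act E X (Vertex v) x = (if x \<in> vertex_set X v then Some x else None)"
| "generator_act E X (Edge e) x =
     (if x \<in> vertex_set X (head E e) then Some (edge_map X e x) else None)"
| "generator_act E X (Ghost e) x =
     (if x \<in> edge_set X e then Some (inv_into (vertex_set X (head E e)) (edge_map X e) x) else None)"

primrec word_act :: "('v, 'e) pre_digraph \<Rightarrow> ('v, 'e, 'x) branching \<Rightarrow>
    ('v, 'e) generator list \<Rightarrow> 'x \<Rightarrow> 'x option" where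
  "word_act E X [] x = Some x"
| "word_act E X (g # w) x = Option.bind (word_act E X w x) (generator_act E X g)"

definition basis_act :: "('v, 'e) pre_digraph \<Rightarrow> ('v, 'e, 'x) branching \<Rightarrow>
    ('v, 'e) generator list \<Rightarrow> 'x \<Rightarrow> 'k::field \<Rightarrow> 'x \<Rightarrow>\<^sub>0 'k" where
  "basis_act E X w x c =
     (case word_act E X w x of None \<Rightarrow> 0 | Some y \<Rightarrow> Poly_Mapping.single y c)"

definition free_act :: "('v, 'e) pre_digraph \<Rightarrow> ('v, 'e, 'x) branching \<Rightarrow>
    ('v, 'e, 'k::field) free_elem \<Rightarrow> ('x \<Rightarrow>\<^sub>0 'k) \<Rightarrow> 'x \<Rightarrow>\<^sub>0 'k" where
  "free_act E X a m = (\<Sum>w\<in>Poly_Mapping.keys a. \<Sum>x\<in>Poly_Mapping.keys m.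
     basis_act E X w x (Poly_Mapping.lookup a w * Poly_Mapping.lookup m x))"

text \<open>
  The module \<open>M(X)\<close>.  A class acts through any of its representatives, see \<open>free_act_class\<close> below.
  The fields \<^const>\<open>mult\<close> and \<^const>\<open>one\<close> play no role in a module.
\<close>

definition branching_module :: "('v, 'e) pre_digraph \<Rightarrow> ('v, 'e, 'x) branching \<Rightarrow>
    (('v, 'e, 'k::field) free_elem set, 'x \<Rightarrow>\<^sub>0 'k) module" where
  "branching_module E X = \<lparr>carrier = {m. Poly_Mapping.keys m \<subseteq> points X},
     mult = undefined, one = undefined, zero = 0, add = (+),
     smult = (\<lambda>C m. the_elem ((\<lambda>a. free_act E X a m) ` C))\<rparr>"

section \<open>The modules\<close>

definition infinite_path_branching :: "('v, 'e) pre_digraph \<Rightarrow> (nat \<Rightarrow> 'e) \<Rightarrow>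
    ('v, 'e, nat \<Rightarrow> 'e) branching" where
  "infinite_path_branching E \<alpha> =
     (let X = {\<beta>. infinite_path E \<beta> \<and> tail_equivalent \<alpha> \<beta>} in
      \<lparr>points = X,
       vertex_set = (\<lambda>v. {\<beta> \<in> X. tail E (\<beta> 0) = v}),
       edge_set = (\<lambda>e. {\<beta> \<in> X. \<beta> 0 = e}),
       edge_map = (\<lambda>e \<beta>. case_nat e \<beta>)\<rparr>)"

definition path_branching :: "('v, 'e) pre_digraph \<Rightarrow> 'v \<Rightarrow>
    ('v, 'e, ('v, 'e) path) branching" where
  "path_branching E v =
     (let X = {p. is_path E p \<and> path_range E p = v} in
      \<lparr>points = X,
       vertex_set = (\<lambda>w. {p \<in> X. fst p = w}),
       edge_set = (\<lambda>e. {p \<in> X. snd p \<noteq> [] \<and> hd (snd p) = e}),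
       edge_map = (\<lambda>e p. (tail E e, e # snd p))\<rparr>)"

text \<open>The word \<open>p q\<^sup>*\<close> of the extended graph is represented by the pair \<open>(p, q)\<close>, which it determines.\<close>

definition cycle_words :: "('v, 'e) pre_digraph \<Rightarrow> 'e list \<Rightarrow> 'v \<Rightarrow>
    (('v, 'e) path \<times> ('v, 'e) path) set" where
  "cycle_words E c v = {(p, q). is_path E p \<and> is_path E q \<and> path_range E p = path_range E q \<and>
     path_range E p \<in> cycle_verts E c \<and> fst q = v}"

definition reduced :: "('v, 'e) path \<times> ('v, 'e) path \<Rightarrow> bool" where
  "reduced = (\<lambda>(p, q). \<not> (snd p \<noteq> [] \<and> snd q \<noteq> [] \<and> last (snd p) = last (snd q)))"

function red :: "('v, 'e) path \<times> ('v, 'e) path \<Rightarrow> ('v, 'e) path \<times> ('v, 'e) path" where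
  "red (p, q) = (if reduced (p, q) then (p, q)
     else red ((fst p, butlast (snd p)), (fst q, butlast (snd q))))"
  by pat_completeness auto
termination
  by (relation "Wellfounded.measure (\<lambda>(p, q). length (snd p))") (auto simp: reduced_def)

declare red.simps [simp del]

definition cycle_branching :: "('v, 'e) pre_digraph \<Rightarrow> 'e list \<Rightarrow> 'v \<Rightarrow>
    ('v, 'e, ('v, 'e) path \<times> ('v, 'e) path) branching" where
  "cycle_branching E c v =
     (let X = {x \<in> cycle_words E c v. reduced x} in
      \<lparr>points = X,
       vertex_set = (\<lambda>w. {(p, q) \<in> X. fst p = w}),
       edge_set = (\<lambda>e. {red ((tail E e, e # r), s) | r s. ((tail E e, e # r), s) \<in> cycle_words E c v}),
       edge_map = (\<lambda>e (p, q). red ((tail E e, e # snd p), q))\<rparr>)"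

definition V_module :: "('v, 'e) pre_digraph \<Rightarrow> (nat \<Rightarrow> 'e) \<Rightarrow>
    (('v, 'e, 'k::field) free_elem set, (nat \<Rightarrow> 'e) \<Rightarrow>\<^sub>0 'k) module" where
  "V_module E \<alpha> = branching_module E (infinite_path_branching E \<alpha>)"

definition N_module :: "('v, 'e) pre_digraph \<Rightarrow> 'v \<Rightarrow>
    (('v, 'e, 'k::field) free_elem set, ('v, 'e) path \<Rightarrow>\<^sub>0 'k) module" where
  "N_module E v = branching_module E (path_branching E v)"

definition N_cycle_module :: "('v, 'e) pre_digraph \<Rightarrow> 'e list \<Rightarrow> 'v \<Rightarrow>
    (('v, 'e, 'k::field) free_elem set, ('v, 'e) path \<times> ('v, 'e) path \<Rightarrow>\<^sub>0 'k) module" where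
  "N_cycle_module E c v = branching_module E (cycle_branching E c v)"

text \<open>The edges that \<open>v\<close> emits into \<open>R(v)\<close>.\<close>

definition returning_edges :: "('v, 'e) pre_digraph \<Rightarrow> 'v \<Rightarrow> 'e set" where
  "returning_edges E v = {e \<in> out_arcs E v. head E e \<in> root_set E {v}}"

datatype module_type = Decreasing_path_type | Relative_sink_type | Extreme_cycle_type
  | Exclusive_cycle_type

fun annihilator_of_type :: "('v, 'e) pre_digraph \<Rightarrow> module_type \<Rightarrow>
    ('v, 'e, 'k::field) free_elem set set \<Rightarrow> bool" where
  "annihilator_of_type E Decreasing_path_type I \<longleftrightarrow>
     (\<exists>\<alpha>. strictly_decreasing_path E \<alpha> \<and>
        (\<forall>v\<in>root_set E (infinite_path_verts E \<alpha>).
           root_set E {v} \<subset> root_set E (infinite_path_verts E \<alpha>)) \<and>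
        I = annihilator (leavitt_algebra E) (V_module E \<alpha>))"
| "annihilator_of_type E Relative_sink_type I \<longleftrightarrow>
     (\<exists>v. (sink E v \<or> infinite_emitter E v \<and> returning_edges E v = {}) \<and>
        I = annihilator (leavitt_algebra E) (N_module E v))"
| "annihilator_of_type E Extreme_cycle_type I \<longleftrightarrow>
     (\<exists>\<alpha>. irrational_path E \<alpha> \<and>
        (\<forall>u\<in>infinite_path_verts E \<alpha>. \<exists>c. u \<in> cycle_verts E c \<and>
           extreme_cycle E (root_set E (infinite_path_verts E \<alpha>)) c) \<and>
        I = annihilator (leavitt_algebra E) (V_module E \<alpha>)) \<or>
     (\<exists>v. infinite_emitter E v \<and>
        (infinite (returning_edges E v) \<or>
         finite (returning_edges E v) \<and> card (returning_edges E v) > 1) \<and>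
        I = annihilator (leavitt_algebra E) (N_module E v))"
| "annihilator_of_type E Exclusive_cycle_type I \<longleftrightarrow>
     (\<exists>c v. exclusive_cycle E c \<and> v \<in> cycle_verts E c \<and>
        I = annihilator (leavitt_algebra E) (N_cycle_module E c v)) \<or>
     (\<exists>v. infinite_emitter E v \<and> card (returning_edges E v) = 1 \<and>
        I = annihilator (leavitt_algebra E) (N_module E v))"


section \<open>The definitions are meaningful\<close>

text \<open>
  Classes act on \<open>M(X)\<close> independently of representatives, \<open>M(X)\<close> is a module for every branching
  system, and the three systems above are branching systems.
\<close>

lemma plus_list_simps [simp]: "0 = ([] :: 'a list)" "u + w = u @ (w :: 'a list)"
  by (simp_all add: zero_list_def plus_list_def)

lemma free_algebra_simps [simp]:
  "a \<in> carrier (free_algebra E) \<longleftrightarrow> Poly_Mapping.keys a \<subseteq> lists (generators E)"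
  "a \<otimes>\<^bsub>free_algebra E\<^esub> b = a * b" "\<one>\<^bsub>free_algebra E\<^esub> = 1"
  "\<zero>\<^bsub>free_algebra E\<^esub> = 0" "a \<oplus>\<^bsub>free_algebra E\<^esub> b = a + b"
  by (simp_all add: free_algebra_def)

lemma free_algebra_ring: "ring (free_algebra E :: ('v, 'e, 'k::field) free_elem ring)"
proof -
  let ?F = "free_algebra E :: ('v, 'e, 'k) free_elem ring"
  have a: "a + b \<in> carrier ?F" if "a \<in> carrier ?F" "b \<in> carrier ?F" for a b
    using Poly_Mapping.keys_add[of a b] that by auto
  have m: "a * b \<in> carrier ?F" if "a \<in> carrier ?F" "b \<in> carrier ?F" for a b
    using keys_mult[of a b] that by (fastforce simp: subset_iff)
  have n: "\<exists>b\<in>carrier ?F. b + a = 0" if "a \<in> carrier ?F" for a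
    using that by (intro bexI[of _ "- a"]) auto
  show ?thesis
    by (intro ringI abelian_groupI monoidI)
      (use a m n in \<open>simp_all add: algebra_simps del: free_algebra_simps(1)\<close>, simp_all)
qed

lemma leavitt_relators_carrier:
  assumes "wf_digraph E"
  shows "(leavitt_relators E :: ('v, 'e, 'k::field) free_elem set) \<subseteq> carrier (free_algebra E)"
proof
  interpret wf_digraph E by fact
  fix a :: "('v, 'e, 'k) free_elem" assume "a \<in> leavitt_relators E"
  then show "a \<in> carrier (free_algebra E)"
  proof cases
    case (regular v)
    have "Poly_Mapping.keys (\<Sum>e\<in>out_arcs E v. word [Edge e, Ghost e] :: ('v, 'e, 'k) free_elem)
       \<subseteq> lists (generators E)"
      by (rule order.trans[OF keys_sum]) (auto simp: generators_def)
    moreover have "[Vertex v] \<in> lists (generators E)"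
      using regular by (auto simp: generators_def regular_vertex_def)
    ultimately show ?thesis
      using keys_diff[of "word [Vertex v]" "\<Sum>e\<in>out_arcs E v. word [Edge e, Ghost e] :: ('v, 'e, 'k) free_elem"]
      unfolding regular by (simp only: free_algebra_simps) fastforce
  qed (auto simp: generators_def dest!: subsetD[OF keys_diff] split: if_splits)
qed

lemma leavitt_ideal_ideal:
  assumes "wf_digraph E"
  shows "ideal (leavitt_ideal E) (free_algebra E)"
  unfolding leavitt_ideal_def
  by (intro ring.genideal_ideal free_algebra_ring leavitt_relators_carrier assms)

lemma basis_act_add: "basis_act E X w x (c + d) = basis_act E X w x c + basis_act E X w x d"
  by (auto simp: basis_act_def single_add split: option.split)

lemma basis_act_0 [simp]: "basis_act E X w x 0 = 0"
  by (auto simp: basis_act_def split: option.split)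

lemma free_act_superset:
  assumes "finite A" "finite B" "Poly_Mapping.keys a \<subseteq> A" "Poly_Mapping.keys m \<subseteq> B"
  shows "free_act E X a m =
    (\<Sum>w\<in>A. \<Sum>x\<in>B. basis_act E X w x (Poly_Mapping.lookup a w * Poly_Mapping.lookup m x))"
proof -
  have "free_act E X a m = (\<Sum>w\<in>Poly_Mapping.keys a. \<Sum>x\<in>B.
      basis_act E X w x (Poly_Mapping.lookup a w * Poly_Mapping.lookup m x))"
    unfolding free_act_def using assms
    by (intro sum.cong refl sum.mono_neutral_left) (auto simp: in_keys_iff)
  also have "\<dots> = (\<Sum>w\<in>A. \<Sum>x\<in>B.
      basis_act E X w x (Poly_Mapping.lookup a w * Poly_Mapping.lookup m x))"
    using assms by (intro sum.mono_neutral_left) (auto simp: in_keys_iff)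
  finally show ?thesis .
qed

lemma free_act_add_left: "free_act E X (a + b) m = free_act E X a m + free_act E X b m"
proof -
  let ?A = "Poly_Mapping.keys a \<union> Poly_Mapping.keys b" and ?B = "Poly_Mapping.keys m"
  have *: "finite ?A" "finite ?B" by simp_all
  have "Poly_Mapping.keys (a + b) \<subseteq> ?A" by (rule Poly_Mapping.keys_add)
  then show ?thesis
    by (subst (1 2 3) free_act_superset[OF *])
      (auto simp: lookup_add distrib_right basis_act_add sum.distrib)
qed

lemma free_act_add_right: "free_act E X a (m + n) = free_act E X a m + free_act E X a n"
proof -
  let ?A = "Poly_Mapping.keys a" and ?B = "Poly_Mapping.keys m \<union> Poly_Mapping.keys n"
  have *: "finite ?A" "finite ?B" by simp_all
  have "Poly_Mapping.keys (m + n) \<subseteq> ?B" by (rule Poly_Mapping.keys_add)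
  then show ?thesis
    by (subst (1 2 3) free_act_superset[OF *])
      (auto simp: lookup_add distrib_left basis_act_add sum.distrib)
qed

lemma free_act_0 [simp]: "free_act E X 0 m = 0" "free_act E X a 0 = 0"
  by (simp_all add: free_act_def)

lemma free_act_uminus: "free_act E X (- a) m = - free_act E X a m"
  using free_act_add_left[of E X a "- a" m] by (simp add: minus_unique)

lemma free_act_diff: "free_act E X (a - b) m = free_act E X a m - free_act E X b m"
  using free_act_add_left[of E X a "- b" m] by (simp add: free_act_uminus)

lemma free_act_sum_left: "free_act E X (sum f S) m = (\<Sum>i\<in>S. free_act E X (f i) m)"
  by (induction S rule: infinite_finite_induct) (auto simp: free_act_add_left)

lemma free_act_single:
  "free_act E X (Poly_Mapping.single w c) (Poly_Mapping.single x d) = basis_act E X w x (c * d)"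
  by (subst free_act_superset[of "{w}" "{x}"]) auto

lemma poly_mapping_single_induct [case_names zero single add]:
  assumes "P 0" "\<And>k c. P (Poly_Mapping.single k c)" "\<And>a b. P a \<Longrightarrow> P b \<Longrightarrow> P (a + b)"
  shows "P (a :: 'a \<Rightarrow>\<^sub>0 'b::comm_monoid_add)"
proof (induction a rule: update_induct)
  case const show ?case by (rule assms)
next
  case (update a k c)
  have "Poly_Mapping.update k c a = Poly_Mapping.single k c + a"
    using update by (intro poly_mapping_eqI) (auto simp: lookup_update lookup_add lookup_single in_keys_iff when_def)
  then show ?case using assms update by auto
qed

lemma word_act_append:
  "word_act E X (u @ w) x = Option.bind (word_act E X w x) (word_act E X u)"
  by (induction u) (auto simp: Option.bind_eq_None_conv split: Option.bind_split)

lemma free_act_mult: "free_act E X (a * b) m = free_act E X a (free_act E X b m)"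
proof (induction a rule: poly_mapping_single_induct)
  case (single u c)
  show ?case
  proof (induction b rule: poly_mapping_single_induct)
    case (single w d)
    show ?case
    proof (induction m rule: poly_mapping_single_induct)
      case (single x e)
      show ?case
        by (auto simp: mult_single free_act_single basis_act_def word_act_append mult.assoc
            split: option.split Option.bind_split)
    qed (auto simp: free_act_add_right)
  qed (auto simp: free_act_add_left free_act_add_right distrib_left)
qed (auto simp: free_act_add_left distrib_right)

lemma poly_mapping_single_induct_keys [consumes 1, case_names zero single add]:
  assumes "Poly_Mapping.keys a \<subseteq> S" "P 0" "\<And>k c. k \<in> S \<Longrightarrow> P (Poly_Mapping.single k c)"
    "\<And>a b. P a \<Longrightarrow> P b \<Longrightarrow> P (a + b)"
  shows "P (a :: 'a \<Rightarrow>\<^sub>0 'b::comm_monoid_add)"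
  using assms(1)
proof (induction a rule: update_induct)
  case const show ?case by (rule assms)
next
  case (update a k c)
  have *: "Poly_Mapping.update k c a = Poly_Mapping.single k c + a"
    using update by (intro poly_mapping_eqI) (auto simp: lookup_update lookup_add lookup_single in_keys_iff when_def)
  have k: "k \<in> S" "Poly_Mapping.keys a \<subseteq> S"
    using update by (auto simp: keys_update)
  show ?case unfolding * by (rule assms(4)[OF assms(3)[OF k(1)] update.IH[OF k(2)]])
qed

context branching_system begin

lemma generator_act_points:
  assumes "g \<in> generators E" "x \<in> points X" "generator_act E X g x = Some y"
  shows "y \<in> points X"
proof (cases g)
  case (Edge e)
  with assms have e: "e \<in> arcs E" "x \<in> vertex_set X (head E e)" "y = edge_map X e x"
    by (auto simp: generators_def split: if_splits)
  then have "y \<in> edge_set X e" using edge_map_bij[of e] by (auto simp: bij_betw_def)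
  then show ?thesis
    using e edge_set_subset[of e] vertex_set_subset[of "tail E e"] tail_in_verts[of e] by blast
next
  case (Ghost e)
  with assms have e: "e \<in> arcs E" "x \<in> edge_set X e"
    "y = inv_into (vertex_set X (head E e)) (edge_map X e) x"
    by (auto simp: generators_def split: if_splits)
  then have "y \<in> vertex_set X (head E e)"
    using edge_map_bij[of e] by (auto simp: bij_betw_def intro: inv_into_into)
  then show ?thesis using e vertex_set_subset[of "head E e"] head_in_verts[of e] by blast
qed (use assms in \<open>auto split: if_splits\<close>)

lemma word_act_points:
  assumes "w \<in> lists (generators E)" "x \<in> points X" "word_act E X w x = Some y"
  shows "y \<in> points X"
  using assms(1,3)
proof (induction w arbitrary: y)
  case (Cons g w)
  then obtain z where "word_act E X w x = Some z" "generator_act E X g z = Some y"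
    by (auto simp: Option.bind_eq_Some_conv)
  then show ?case using Cons generator_act_points[of g z y] by auto
qed (use assms(2) in auto)

lemma free_act_points:
  assumes "a \<in> carrier (free_algebra E)" "Poly_Mapping.keys m \<subseteq> points X"
  shows "Poly_Mapping.keys (free_act E X a m) \<subseteq> points X"
proof -
  have "Poly_Mapping.keys a \<subseteq> lists (generators E)" using assms by simp
  then show ?thesis
  proof (induction a rule: poly_mapping_single_induct_keys)
    case (single w c)
    show ?case using assms(2)
    proof (induction m rule: poly_mapping_single_induct_keys)
      case (single x d)
      then show ?case using word_act_points[OF \<open>w \<in> _\<close> single]
        by (auto simp: free_act_single basis_act_def split: option.splits)
    next
      case (add m n)
      then show ?case using Poly_Mapping.keys_add[of "free_act E X (Poly_Mapping.single w c) m"]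
        by (simp add: free_act_add_right) blast
    qed auto
  next
    case (add a b)
    then show ?case using Poly_Mapping.keys_add[of "free_act E X a m"]
      by (simp add: free_act_add_left) blast
  qed auto
qed

lemma vertex_set_unique:
  "\<lbrakk>x \<in> vertex_set X v; x \<in> vertex_set X w; v \<in> verts E; w \<in> verts E\<rbrakk> \<Longrightarrow> v = w"
  using vertex_sets_disjoint by blast

lemma edge_set_unique:
  "\<lbrakk>x \<in> edge_set X e; x \<in> edge_set X f; e \<in> arcs E; f \<in> arcs E\<rbrakk> \<Longrightarrow> e = f"
  using edge_sets_disjoint by blast

lemma edge_map_in:
  "\<lbrakk>e \<in> arcs E; x \<in> vertex_set X (head E e)\<rbrakk> \<Longrightarrow> edge_map X e x \<in> edge_set X e"
  "\<lbrakk>e \<in> arcs E; x \<in> edge_set X e\<rbrakk> \<Longrightarrow>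
    inv_into (vertex_set X (head E e)) (edge_map X e) x \<in> vertex_set X (head E e)"
  "\<lbrakk>e \<in> arcs E; x \<in> vertex_set X (head E e)\<rbrakk> \<Longrightarrow>
    inv_into (vertex_set X (head E e)) (edge_map X e) (edge_map X e x) = x"
  "\<lbrakk>e \<in> arcs E; x \<in> edge_set X e\<rbrakk> \<Longrightarrow>
    edge_map X e (inv_into (vertex_set X (head E e)) (edge_map X e) x) = x"
  using edge_map_bij[of e]
  by (auto simp: bij_betw_def inv_into_into f_inv_into_f)

lemma free_act_relator:
  assumes "a \<in> leavitt_relators E" "Poly_Mapping.keys m \<subseteq> points X"
  shows "free_act E X a m = 0"
  using assms(2)
proof (induction m rule: poly_mapping_single_induct_keys)
  case (single x c)
  from assms(1) show ?case
  proof cases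
    case (vertex_vertex v w)
    then show ?thesis
      by (auto simp: free_act_diff free_act_single basis_act_def dest: vertex_set_unique)
  next
    case (source_edge e)
    then show ?thesis using edge_set_subset[of e] edge_map_in[of e x]
      by (auto simp: free_act_diff free_act_single basis_act_def split: option.splits)
  next
    case (edge_range e)
    then show ?thesis by (auto simp: free_act_diff free_act_single basis_act_def)
  next
    case (range_ghost e)
    then show ?thesis using edge_map_in[of e x]
      by (auto simp: free_act_diff free_act_single basis_act_def)
  next
    case (ghost_source e)
    then show ?thesis using edge_set_subset[of e]
      by (auto simp: free_act_diff free_act_single basis_act_def)
  next
    case (ghost_edge e f)
    have "e = f" if "x \<in> vertex_set X (head E f)" "edge_map X f x \<in> edge_set X e"
      using ghost_edge that edge_map_in(1)[of f x] edge_set_unique by blast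
    then show ?thesis using ghost_edge edge_map_in[of e x]
      by (auto simp: free_act_diff free_act_single basis_act_def)
  next
    case (regular v)
    have v: "v \<in> verts E" and fin: "finite (out_arcs E v)"
      using regular by (auto simp: regular_vertex_def infinite_emitter_def)
    have *: "basis_act E X [Edge e, Ghost e] x c = (if x \<in> edge_set X e then Poly_Mapping.single x c else 0)"
      if "e \<in> out_arcs E v" for e
      using that edge_map_in[of e x] by (auto simp: basis_act_def)
    have "(\<Sum>e\<in>out_arcs E v. if x \<in> edge_set X e then Poly_Mapping.single x c else 0) =
        (if x \<in> vertex_set X v then Poly_Mapping.single x c else 0)"
    proof (cases "x \<in> vertex_set X v")
      case True
      then obtain e where e: "e \<in> out_arcs E v" "x \<in> edge_set X e"
        using vertex_set_regular regular by auto
      have "(\<Sum>e\<in>out_arcs E v. if x \<in> edge_set X e then Poly_Mapping.single x c else 0) =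
          (\<Sum>f\<in>out_arcs E v. if f = e then Poly_Mapping.single x c else 0)"
        using e edge_set_unique by (intro sum.cong) auto
      with True e fin show ?thesis by simp
    next
      case False
      then show ?thesis using vertex_set_regular regular by auto
    qed
    moreover have "free_act E X (\<Sum>e\<in>out_arcs E v. word [Edge e, Ghost e]) (Poly_Mapping.single x c) =
        (\<Sum>e\<in>out_arcs E v. if x \<in> edge_set X e then Poly_Mapping.single x c else 0)"
      unfolding free_act_sum_left by (intro sum.cong refl) (simp add: free_act_single *)
    ultimately show ?thesis unfolding regular
      by (simp add: free_act_diff) (auto simp: free_act_single basis_act_def)
  qed
qed (auto simp: free_act_add_right)

lemma free_act_leavitt_ideal:
  fixes a :: "('v, 'e, 'k::field) free_elem"
  assumes "a \<in> leavitt_ideal E" "Poly_Mapping.keys m \<subseteq> points X"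
  shows "free_act E X a m = 0"
proof -
  let ?F = "free_algebra E :: ('v, 'e, 'k) free_elem ring"
  let ?J = "{a \<in> carrier ?F. \<forall>m. Poly_Mapping.keys m \<subseteq> points X \<longrightarrow> free_act E X a m = 0}"
  interpret F: ring ?F by (rule free_algebra_ring)
  have "ideal ?J ?F"
  proof (rule idealI[OF free_algebra_ring])
    show "subgroup ?J (add_monoid ?F)"
    proof (rule F.add.subgroupI)
      show "\<ominus>\<^bsub>?F\<^esub> a \<in> ?J" if "a \<in> ?J" for a
      proof -
        have "\<ominus>\<^bsub>?F\<^esub> a = - a"
          using that by (intro F.minus_equality) auto
        then show ?thesis using that by (auto simp: free_act_uminus)
      qed
      show "a \<oplus>\<^bsub>?F\<^esub> b \<in> ?J" if "a \<in> ?J" "b \<in> ?J" for a b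
        using that F.add.m_closed[of a b] by (auto simp: free_act_add_left)
    qed (auto intro: exI[of _ 0])
  next
    fix a b assume ab: "a \<in> ?J" "b \<in> carrier ?F"
    have "b \<otimes>\<^bsub>?F\<^esub> a \<in> carrier ?F" "a \<otimes>\<^bsub>?F\<^esub> b \<in> carrier ?F"
      using ab by (auto intro!: F.m_closed simp del: free_algebra_simps)
    then show "b \<otimes>\<^bsub>?F\<^esub> a \<in> ?J" "a \<otimes>\<^bsub>?F\<^esub> b \<in> ?J"
      using ab free_act_points[of b] by (auto simp: free_act_mult)
  qed
  moreover have "leavitt_relators E \<subseteq> ?J"
    using leavitt_relators_carrier[OF wf_digraph_axioms] free_act_relator by blast
  ultimately have "leavitt_ideal E \<subseteq> ?J"
    unfolding leavitt_ideal_def by (rule F.genideal_minimal)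
  then show ?thesis using assms by blast
qed

lemma free_act_class:
  fixes a :: "('v, 'e, 'k::field) free_elem"
  assumes "a \<in> carrier (free_algebra E)" "m \<in> carrier (branching_module E X)"
  shows "leavitt_class E a \<odot>\<^bsub>branching_module E X\<^esub> m = free_act E X a m"
proof -
  interpret I: ideal "leavitt_ideal E :: ('v, 'e, 'k) free_elem set" "free_algebra E"
    by (rule leavitt_ideal_ideal[OF wf_digraph_axioms])
  have m: "Poly_Mapping.keys m \<subseteq> points X"
    using assms(2) by (simp add: branching_module_def)
  have "free_act E X b m = free_act E X a m" if "b \<in> leavitt_class E a" for b
  proof -
    from that obtain h where "h \<in> leavitt_ideal E" "b = h + a"
      unfolding leavitt_class_def a_r_coset_defs by auto
    then show ?thesis using m by (simp add: free_act_add_left free_act_leavitt_ideal)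
  qed
  moreover have "a \<in> leavitt_class E a"
    unfolding leavitt_class_def using assms(1) by (rule I.a_rcos_self)
  ultimately have "(\<lambda>b. free_act E X b m) ` leavitt_class E a = {free_act E X a m}"
    by blast
  then show ?thesis by (simp add: branching_module_def)
qed

lemma branching_module_left_module:
  "left_module (leavitt_algebra E) (branching_module E X :: (('v, 'e, 'k::field) free_elem set, _) module)"
  (is "left_module ?L ?M")
proof -
  let ?F = "free_algebra E :: ('v, 'e, 'k) free_elem ring"
  interpret F: ring ?F by (rule free_algebra_ring)
  interpret I: ideal "leavitt_ideal E" ?F
    by (rule leavitt_ideal_ideal[OF wf_digraph_axioms])
  have add: "leavitt_class E a \<oplus>\<^bsub>?L\<^esub> leavitt_class E b = leavitt_class E (a + b)"
    and mult: "leavitt_class E a \<otimes>\<^bsub>?L\<^esub> leavitt_class E b = leavitt_class E (a * b)"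
    if "a \<in> carrier ?F" "b \<in> carrier ?F" for a b
    using I.a_rcos_sum[OF that] I.rcoset_mult_add[OF that]
    by (simp_all add: leavitt_algebra_def FactRing_def leavitt_class_def)
  have rep: "\<exists>a\<in>carrier ?F. C = leavitt_class E a" if "C \<in> carrier ?L" for C
    using that by (auto simp: leavitt_algebra_def)
  have M: "m \<in> carrier ?M \<longleftrightarrow> Poly_Mapping.keys m \<subseteq> points X" "m \<oplus>\<^bsub>?M\<^esub> n = m + n" "\<zero>\<^bsub>?M\<^esub> = 0" for m n
    by (simp_all add: branching_module_def)
  have closed: "free_act E X a m \<in> carrier ?M" if "a \<in> carrier ?F" "m \<in> carrier ?M" for a m
    using free_act_points that by (simp only: M)
  have plus_closed: "m + n \<in> carrier ?M" if "m \<in> carrier ?M" "n \<in> carrier ?M" for m n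
    using Poly_Mapping.keys_add[of m n] that by (auto simp: M)
  have "abelian_group ?M"
  proof (rule abelian_groupI)
    show "\<exists>n\<in>carrier ?M. n \<oplus>\<^bsub>?M\<^esub> m = \<zero>\<^bsub>?M\<^esub>" if "m \<in> carrier ?M" for m
      using that by (intro bexI[of _ "- m"]) (auto simp: M)
  qed (use plus_closed in \<open>auto simp: M(2,3) algebra_simps\<close>, auto simp: M)
  then show ?thesis
  proof (intro left_module.intro left_module_axioms.intro)
    fix r s m n assume r: "r \<in> carrier ?L" and m: "m \<in> carrier ?M"
    from rep[OF r] obtain a where a: "a \<in> carrier ?F" "r = leavitt_class E a" by blast
    show "r \<odot>\<^bsub>?M\<^esub> m \<in> carrier ?M"
      unfolding a(2) by (subst free_act_class[OF a(1) m]) (rule closed[OF a(1) m])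
    show "r \<odot>\<^bsub>?M\<^esub> (m \<oplus>\<^bsub>?M\<^esub> n) = r \<odot>\<^bsub>?M\<^esub> m \<oplus>\<^bsub>?M\<^esub> r \<odot>\<^bsub>?M\<^esub> n" if n: "n \<in> carrier ?M"
      unfolding a(2) M(2)
      by (simp add: free_act_class[OF a(1)] m n plus_closed[OF m n] free_act_add_right del: free_algebra_simps)
    assume s: "s \<in> carrier ?L"
    from rep[OF s] obtain b where b: "b \<in> carrier ?F" "s = leavitt_class E b" by blast
    have ab: "a + b \<in> carrier ?F" "a * b \<in> carrier ?F"
      using F.a_closed[OF a(1) b(1)] F.m_closed[OF a(1) b(1)] by simp_all
    show "(r \<oplus>\<^bsub>?L\<^esub> s) \<odot>\<^bsub>?M\<^esub> m = r \<odot>\<^bsub>?M\<^esub> m \<oplus>\<^bsub>?M\<^esub> s \<odot>\<^bsub>?M\<^esub> m"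
      unfolding a(2) b(2) M(2) add[OF a(1) b(1)]
      by (simp add: free_act_class[OF _ m] a b ab free_act_add_left del: free_algebra_simps)
    show "(r \<otimes>\<^bsub>?L\<^esub> s) \<odot>\<^bsub>?M\<^esub> m = r \<odot>\<^bsub>?M\<^esub> (s \<odot>\<^bsub>?M\<^esub> m)"
      unfolding a(2) b(2) mult[OF a(1) b(1)]
      by (simp add: free_act_class[OF _ m] free_act_class[OF _ closed[OF b(1) m]] a b ab free_act_mult del: free_algebra_simps)
  qed
qed

end


lemma infinite_path_branching_system:
  assumes "wf_digraph E"
  shows "branching_system E (infinite_path_branching E \<alpha>)"
proof -
  interpret wf_digraph E by fact
  have cons_path: "infinite_path E (case_nat e \<beta>)"
    if "e \<in> arcs E" "infinite_path E \<beta>" "tail E (\<beta> 0) = head E e" for e \<beta>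
    using that by (auto simp: infinite_path_def split: nat.split)
  have cons_tail: "tail_equivalent \<alpha> (case_nat e \<beta>)" if "tail_equivalent \<alpha> \<beta>" for e \<beta>
  proof -
    from that obtain m n where "\<forall>k. \<alpha> (m + k) = \<beta> (n + k)" by (auto simp: tail_equivalent_def)
    then have "\<forall>k. \<alpha> (m + k) = case_nat e \<beta> (Suc n + k)" by simp
    then show ?thesis unfolding tail_equivalent_def by blast
  qed
  have tl_tail: "tail_equivalent \<alpha> (\<lambda>n. \<beta> (Suc n))" if "tail_equivalent \<alpha> \<beta>" for \<beta>
  proof -
    from that obtain m n where *: "\<forall>k. \<alpha> (m + k) = \<beta> (n + k)" by (auto simp: tail_equivalent_def)
    have "\<alpha> (Suc m + k) = \<beta> (Suc (n + k))" for k using *[rule_format, of "Suc k"] by simp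
    then show ?thesis unfolding tail_equivalent_def by blast
  qed
  have eta: "case_nat (\<beta> 0) (\<lambda>n. \<beta> (Suc n)) = \<beta>" for \<beta> :: "nat \<Rightarrow> 'b"
    by (auto split: nat.split)
  show ?thesis
  proof
    fix e assume e: "e \<in> arcs E"
    show "bij_betw (edge_map (infinite_path_branching E \<alpha>) e)
      (vertex_set (infinite_path_branching E \<alpha>) (head E e)) (edge_set (infinite_path_branching E \<alpha>) e)"
      unfolding infinite_path_branching_def Let_def
      by (rule bij_betw_byWitness[where f' = "\<lambda>\<beta> n. \<beta> (Suc n)"])
        (use e in \<open>auto simp: cons_path cons_tail tl_tail eta, auto simp: infinite_path_def\<close>)
  next
    fix v assume v: "regular_vertex E v"
    then show "vertex_set (infinite_path_branching E \<alpha>) v =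
      (\<Union>e\<in>out_arcs E v. edge_set (infinite_path_branching E \<alpha>) e)"
      by (auto simp: infinite_path_branching_def Let_def infinite_path_def out_arcs_def)
  qed (auto simp: infinite_path_branching_def Let_def)
qed

lemma path_branching_system:
  assumes "wf_digraph E" "sink E v \<or> infinite_emitter E v"
  shows "branching_system E (path_branching E v)"
proof -
  interpret wf_digraph E by fact
  show ?thesis
  proof
    fix e assume e: "e \<in> arcs E"
    show "bij_betw (edge_map (path_branching E v) e)
      (vertex_set (path_branching E v) (head E e)) (edge_set (path_branching E v) e)"
      unfolding path_branching_def Let_def
      by (rule bij_betw_byWitness[where f' = "\<lambda>p. (head E e, tl (snd p))"])
        (use e in \<open>auto simp: is_path_def path_range_def awalk_Cons_iff neq_Nil_conv\<close>)
  next
    fix w assume "regular_vertex E w"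
    then have "w \<noteq> v" using assms by (auto simp: regular_vertex_def)
    then have "p \<noteq> [] \<and> hd p \<in> out_arcs E w" if "awalk w p v" for p
      using that by (cases p) (auto simp: awalk_Nil_iff awalk_Cons_iff)
    then show "vertex_set (path_branching E v) w =
      (\<Union>e\<in>out_arcs E w. edge_set (path_branching E v) e)"
      by (fastforce simp: path_branching_def Let_def is_path_def path_range_def awalk_Cons_iff
        neq_Nil_conv)
  qed (auto simp: path_branching_def Let_def is_path_def awalk_Cons_iff neq_Nil_conv)
qed


lemma cycle_iff_distinct_sources:
  assumes "wf_digraph E"
  shows "pre_digraph.cycle E c \<longleftrightarrow>
    (\<exists>u. pre_digraph.awalk E u c u) \<and> c \<noteq> [] \<and> distinct (map (tail E) c)"
proof -
  interpret wf_digraph E by fact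
  have "distinct (tl (awalk_verts u c)) \<longleftrightarrow> distinct (map (tail E) c)" if c: "awalk u c u" "c \<noteq> []" for u
  proof -
    have "cas u c u" using c(1) by blast
    have 1: "awalk_verts u c = tail E (hd c) # map (head E) c"
      using awalk_verts_conv'[OF \<open>cas u c u\<close>] c(2) by simp
    have 2: "awalk_verts u c = map (tail E) c @ [head E (last c)]"
      using c(2) by (simp add: awalk_verts_conv)
    have "head E (last c) = tail E (hd c)"
      using awhd_of_awalk[OF c(1)] awlast_of_awalk[OF c(1)] 1 2 by (metis NOMATCH_def last_snoc list.sel(1))
    moreover obtain e d where "c = e # d" using c(2) by (cases c) auto
    ultimately have "map (head E) c = map (tail E) d @ [tail E e]" "map (tail E) c = tail E e # map (tail E) d"
      using 1 2 by auto
    then show ?thesis unfolding 1 by (auto simp del: list.map)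
  qed
  then show ?thesis unfolding cycle_def by blast
qed

lemma red_reduced: "reduced x \<Longrightarrow> red x = x"
  by (cases x) (simp add: red.simps)

lemma red_append: "red ((u, p @ s), (v, q @ s)) = red ((u, p), (v, q))"
proof (induction s rule: rev_induct)
  case (snoc e s)
  have "red ((u, p @ s @ [e]), (v, q @ s @ [e])) = red ((u, p @ s), (v, q @ s))"
    by (subst red.simps) (simp add: reduced_def butlast_append)
  with snoc show ?case by simp
qed simp

lemma red_decomp:
  obtains p' q' s where "p = p' @ s" "q = q' @ s" "reduced ((u, p'), (v, q'))"
    "red ((u, p), (v, q)) = ((u, p'), (v, q'))"
proof -
  have "\<exists>p' q' s. p = p' @ s \<and> q = q' @ s \<and> reduced ((u, p'), (v, q'))"
  proof (induction p arbitrary: q rule: rev_induct)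
    case Nil
    have "reduced ((u, []), (v, q))" by (simp add: reduced_def)
    then show ?case by force
  next
    case (snoc e p)
    show ?case
    proof (cases "reduced ((u, p @ [e]), (v, q))")
      case True
      then show ?thesis by force
    next
      case False
      then have q: "q = butlast q @ [e]"
        by (auto simp: reduced_def)
      from snoc[of "butlast q"] obtain p' q' s where
        "p = p' @ s" "butlast q = q' @ s" "reduced ((u, p'), (v, q'))" by blast
      then have "p @ [e] = p' @ (s @ [e])" "q = q' @ (s @ [e])" using q by auto
      then show ?thesis using \<open>reduced ((u, p'), (v, q'))\<close> by blast
    qed
  qed
  then obtain p' q' s where *: "p = p' @ s" "q = q' @ s" "reduced ((u, p'), (v, q'))" by blast
  then have "red ((u, p), (v, q)) = ((u, p'), (v, q'))"
    by (simp add: red_append red_reduced)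
  with * show ?thesis by (rule that)
qed

lemma cycle_branching_system:
  assumes wf: "wf_digraph E" and c: "exclusive_cycle E c" and v: "v \<in> cycle_verts E c"
  shows "branching_system E (cycle_branching E c v)"
proof -
  interpret wf_digraph E by fact
  let ?C = "cycle_verts E c" and ?Y = "cycle_words E c v"
  from c obtain u where u: "awalk u c u" "c \<noteq> []" and dist: "distinct (map (tail E) c)"
    using cycle_iff_distinct_sources[OF wf] by (auto simp: exclusive_cycle_def)
  have C_subset: "?C \<subseteq> set (awalk_verts u c)"
    using awalk_verts_arc1 by (auto simp: cycle_verts_def)
  have strong: "x \<rightarrow>\<^sup>*\<^bsub>E\<^esub> y" if "x \<in> ?C" "y \<in> ?C" for x y
    using that C_subset awalk_verts_reachable_from[OF u(1)] awalk_verts_reachable_to[OF u(1)]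
      reachable_trans by blast
  have head_C: "head E e \<in> ?C" if e: "e \<in> set c" for e
  proof -
    obtain a b where ab: "c = a @ e # b" using e by (meson split_list)
    have "awalk (head E e) (b @ a) (tail E e)"
      using u(1) unfolding ab by (auto simp: awalk_Cons_iff)
    moreover have "f \<in> set c" if "b @ a = f # r" for f r
      using arg_cong[OF that, of set] ab by auto
    ultimately show ?thesis using e
      by (cases "b @ a") (auto simp: awalk_Nil_iff awalk_Cons_iff cycle_verts_def)
  qed
  have in_cycle: "e \<in> set c" if e: "e \<in> arcs E" "tail E e \<in> ?C" "head E e \<rightarrow>\<^sup>*\<^bsub>E\<^esub> tail E e" for e
  proof -
    from e(3) obtain p where p: "apath (head E e) p (tail E e)" by (auto simp: reachable_apath)
    then have "cycle (e # p)"
      using e by (auto simp: cycle_def awalk_Cons_iff apath_def)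
    moreover have "tail E e \<in> cycle_verts E (e # p)" by (simp add: cycle_verts_def)
    ultimately have "same_cycle c (e # p)"
      using c e(2) unfolding exclusive_cycle_def by blast
    then show ?thesis by (metis list.set_intros(1) same_cycle_def set_rotate)
  qed
  have walk_in_cycle: "set p \<subseteq> set c" if "awalk x p y" "x \<in> ?C" "y \<in> ?C" for x p y
    using that
  proof (induction p arbitrary: x)
    case (Cons e p)
    then have e: "e \<in> arcs E" "x = tail E e" "awalk (head E e) p y" by (auto simp: awalk_Cons_iff)
    then have "head E e \<rightarrow>\<^sup>*\<^bsub>E\<^esub> y" by (auto intro: reachable_awalkI)
    then have "head E e \<rightarrow>\<^sup>*\<^bsub>E\<^esub> tail E e" using strong[of y x] Cons e reachable_trans by blast
    then have "e \<in> set c" using in_cycle e Cons by blast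
    then show ?case using Cons e head_C by auto
  qed simp
  have Y: "((x, p), (y, q)) \<in> ?Y \<longleftrightarrow> y = v \<and> (\<exists>w\<in>?C. awalk x p w \<and> awalk v q w)" for x p y q
    by (auto simp: cycle_words_def is_path_def path_range_def)
  have Y_append: "((x, p), (y, q)) \<in> ?Y" if "((x, p @ s), (y, q @ s)) \<in> ?Y" for x p y q s
  proof -
    from that obtain w where w: "w \<in> ?C" "y = v" "awalk x (p @ s) w" "awalk v (q @ s) w"
      using Y by blast
    let ?w = "awlast v q"
    have q: "awalk v q ?w" "awalk ?w s w" using w(4) by auto
    have "?w \<in> ?C"
    proof (cases q)
      case Nil then show ?thesis using v by simp
    next
      case (Cons e q')
      then have "last q \<in> set c" using walk_in_cycle[OF w(4) v w(1)] by auto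
      then show ?thesis using head_C Cons by (simp add: awalk_verts_conv)
    qed
    moreover have "awalk x p ?w"
    proof (cases s)
      case Nil then show ?thesis using w q by (auto simp: awalk_Nil_iff)
    next
      case (Cons e s')
      then show ?thesis using w q by (auto simp: awalk_Cons_iff)
    qed
    ultimately show ?thesis using Y w q by blast
  qed
  have red_Y: "red z \<in> ?Y \<and> reduced (red z) \<and> fst (fst (red z)) = fst (fst z)" if "z \<in> ?Y" for z
  proof -
    obtain x p y q where z: "z = ((x, p), (y, q))" by (metis surj_pair)
    obtain p' q' s where "p = p' @ s" "q = q' @ s" "reduced ((x, p'), (y, q'))"
      "red z = ((x, p'), (y, q'))"
      using red_decomp[of p q x y] z by blast
    then show ?thesis using Y_append that z by auto
  qed
  have Y_Cons: "((tail E e, e # r), t) \<in> ?Y \<longleftrightarrow> ((head E e, r), t) \<in> ?Y" if "e \<in> arcs E" for e r t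
    using that by (cases t) (auto simp: Y awalk_Cons_iff)
  have red_Cons: "red ((tail E e, e # r), t) = red ((tail E e, e # snd (fst (red ((head E e, r), t)))), snd (red ((head E e, r), t)))"
    for e r t
  proof -
    obtain y q where t: "t = (y, q)" by (cases t)
    obtain p' q' s where "r = p' @ s" "q = q' @ s" "red ((head E e, r), t) = ((head E e, p'), (y, q'))"
      using red_decomp[of r q "head E e" y] t by blast
    then show ?thesis using red_append[of "tail E e" "e # p'" s y q'] t by simp
  qed
  have red_cases: "red ((tail E e, e # r), (y, q)) =
      (if r = [] \<and> q \<noteq> [] \<and> last q = e then ((tail E e, []), (y, butlast q)) else ((tail E e, e # r), (y, q)))"
    if "reduced ((head E e, r), (y, q))" for e r y q
  proof (cases "r = [] \<and> q \<noteq> [] \<and> last q = e")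
    case True
    then have "q = butlast q @ [e]" by (metis append_butlast_last_id)
    then have "red ((tail E e, e # r), (y, q)) = red ((tail E e, []), (y, butlast q))"
      using red_append[of "tail E e" "[]" "[e]" y "butlast q"] True by simp
    then show ?thesis using True by (simp add: red_reduced reduced_def)
  next
    case False
    then have "reduced ((tail E e, e # r), (y, q))"
      using that by (auto simp: reduced_def split: if_splits)
    then show ?thesis using False by (simp only: red_reduced if_False)
  qed
  let ?B = "cycle_branching E c v"
  have vset: "((x, p), t) \<in> vertex_set ?B w \<longleftrightarrow> ((x, p), t) \<in> ?Y \<and> reduced ((x, p), t) \<and> x = w" for x p t w
    by (auto simp: cycle_branching_def Let_def)
  have emap: "edge_map ?B e ((x, p), t) = red ((tail E e, e # p), t)" for e x p t
    by (simp add: cycle_branching_def Let_def)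
  have eset: "edge_set ?B e = edge_map ?B e ` vertex_set ?B (head E e)" if ea: "e \<in> arcs E" for e
  proof
    show "edge_map ?B e ` vertex_set ?B (head E e) \<subseteq> edge_set ?B e"
    proof
      fix z assume "z \<in> edge_map ?B e ` vertex_set ?B (head E e)"
      then obtain p t where "((head E e, p), t) \<in> ?Y" "z = red ((tail E e, e # p), t)"
        by (auto simp: emap vset image_iff)
      then show "z \<in> edge_set ?B e" using Y_Cons[OF ea]
        by (cases t) (auto simp: cycle_branching_def Let_def)
    qed
    show "edge_set ?B e \<subseteq> edge_map ?B e ` vertex_set ?B (head E e)"
    proof
      fix z assume "z \<in> edge_set ?B e"
      then obtain r t where z: "((head E e, r), t) \<in> ?Y" "z = red ((tail E e, e # r), t)"
        using Y_Cons[OF ea] by (auto simp: cycle_branching_def Let_def)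
      obtain x p t' where red: "red ((head E e, r), t) = ((x, p), t')" by (metis surj_pair)
      then have "((x, p), t') \<in> vertex_set ?B (head E e)"
        using red_Y[OF z(1)] by (auto simp: vset)
      moreover have "z = edge_map ?B e ((x, p), t')"
        using z red_Cons[of e r t] red by (simp add: emap)
      ultimately show "z \<in> edge_map ?B e ` vertex_set ?B (head E e)" by blast
    qed
  qed
  have emap_cases: "(\<exists>p q. edge_map ?B e z = ((tail E e, e # p), (v, q))) \<or>
      (\<exists>q. edge_map ?B e z = ((tail E e, []), (v, q)) \<and> e \<in> set c)"
    and emap_in: "edge_map ?B e z \<in> ?Y" "reduced (edge_map ?B e z)"
      "fst (fst (edge_map ?B e z)) = tail E e"
    if e: "e \<in> arcs E" and z: "z \<in> vertex_set ?B (head E e)" for e z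
  proof -
    obtain p q where z': "z = ((head E e, p), (v, q))" and Yz: "((head E e, p), (v, q)) \<in> ?Y"
      "reduced ((head E e, p), (v, q))"
      using z by (cases z) (auto simp: cycle_branching_def Let_def Y)
    have "e \<in> set c" if "p = []" "q \<noteq> []" "last q = e"
    proof -
      obtain w where "w \<in> ?C" "awalk v q w" using Yz Y by blast
      then have "set q \<subseteq> set c" using walk_in_cycle v by blast
      then show ?thesis using that by auto
    qed
    then show "(\<exists>p q. edge_map ?B e z = ((tail E e, e # p), (v, q))) \<or>
      (\<exists>q. edge_map ?B e z = ((tail E e, []), (v, q)) \<and> e \<in> set c)"
      using red_cases[OF Yz(2)] by (auto simp: z' emap)
    show "edge_map ?B e z \<in> ?Y" "reduced (edge_map ?B e z)"
      "fst (fst (edge_map ?B e z)) = tail E e"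
      using red_Y[of "((tail E e, e # p), (v, q))"] Y_Cons[OF e] Yz by (auto simp: z' emap)
  qed
  have esub: "edge_set ?B e \<subseteq> vertex_set ?B (tail E e)" if e: "e \<in> arcs E" for e
  proof
    fix z assume "z \<in> edge_set ?B e"
    then obtain y where y: "y \<in> vertex_set ?B (head E e)" "z = edge_map ?B e y"
      unfolding eset[OF e] by blast
    obtain x p t where "z = ((x, p), t)" by (metis surj_pair)
    then show "z \<in> vertex_set ?B (tail E e)"
      using emap_in[OF e y(1)] unfolding y(2)[symmetric] by (simp add: vset)
  qed
  show ?thesis
  proof
    show "vertex_set ?B w \<subseteq> points ?B" for w by (auto simp: cycle_branching_def Let_def)
  next
    fix e assume e: "e \<in> arcs E"
    then show "edge_set ?B e \<subseteq> vertex_set ?B (tail E e)" by (rule esub)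
    have "inj_on (edge_map ?B e) (vertex_set ?B (head E e))"
    proof (rule inj_onI)
      fix z z' assume zz: "z \<in> vertex_set ?B (head E e)" "z' \<in> vertex_set ?B (head E e)"
        and eq: "edge_map ?B e z = edge_map ?B e z'"
      obtain p q p' q' where z: "z = ((head E e, p), (v, q))" "reduced z"
        and z': "z' = ((head E e, p'), (v, q'))" "reduced z'"
        using zz by (cases z; cases z') (auto simp: cycle_branching_def Let_def Y)
      have last_eq: "q = q'" if "q \<noteq> []" "q' \<noteq> []" "butlast q = butlast q'" "last q = last q'"
        using that by (metis append_butlast_last_id)
      let ?P = "p = [] \<and> q \<noteq> [] \<and> last q = e" and ?P' = "p' = [] \<and> q' \<noteq> [] \<and> last q' = e"
      have R: "(if ?P then ((tail E e, []), (v, butlast q)) else ((tail E e, e # p), (v, q))) =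
        (if ?P' then ((tail E e, []), (v, butlast q')) else ((tail E e, e # p'), (v, q')))"
        using eq red_cases[OF z(2)[unfolded z(1)]] red_cases[OF z'(2)[unfolded z'(1)]]
        unfolding z(1) z'(1) emap by (simp only:)
      have R1: "(if ?P then [] else e # p) = (if ?P' then [] else e # p')"
        using arg_cong[OF R, of "\<lambda>x. snd (fst x)"] by (simp only: if_distrib fst_conv snd_conv cong: if_cong)
      have R2: "(if ?P then butlast q else q) = (if ?P' then butlast q' else q')"
        using arg_cong[OF R, of "\<lambda>x. snd (snd x)"] by (simp only: if_distrib fst_conv snd_conv cong: if_cong)
      have "p = p' \<and> q = q'"
      proof (cases ?P)
        case True
        then have P': ?P' using R1 by (metis list.distinct(1))
        then have "butlast q = butlast q'" using R2 True by (simp only: simp_thms if_True)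
        then show ?thesis using True P' last_eq by metis
      next
        case False
        then have P': "\<not> ?P'" using R1 by (metis list.distinct(1))
        show ?thesis using R1 R2 unfolding if_not_P[OF False] if_not_P[OF P'] by (metis list.inject)
      qed
      then show "z = z'" unfolding z(1) z'(1) by simp
    qed
    then show "bij_betw (edge_map ?B e) (vertex_set ?B (head E e)) (edge_set ?B e)"
      unfolding bij_betw_def using eset[OF e] by simp
  next
    fix w w' assume "w \<in> verts E" "w' \<in> verts E" "w \<noteq> w'"
    then show "vertex_set ?B w \<inter> vertex_set ?B w' = {}"
      by (auto simp: cycle_branching_def Let_def)
  next
    fix e f assume ef: "e \<in> arcs E" "f \<in> arcs E" "e \<noteq> f"
    have inj: "e = f" if "e \<in> set c" "f \<in> set c" "tail E e = tail E f"
      using that dist by (auto simp: distinct_map inj_on_def)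
    show "edge_set ?B e \<inter> edge_set ?B f = {}"
    proof (rule ccontr)
      assume "edge_set ?B e \<inter> edge_set ?B f \<noteq> {}"
      then obtain z z' where zz: "z \<in> vertex_set ?B (head E e)" "z' \<in> vertex_set ?B (head E f)"
        "edge_map ?B e z = edge_map ?B f z'"
        unfolding eset[OF ef(1)] eset[OF ef(2)] by blast
      then show False
        using emap_cases[OF ef(1) zz(1)] emap_cases[OF ef(2) zz(2)] inj ef(3) by auto
    qed
  next
    fix w assume w: "regular_vertex E w"
    show "vertex_set ?B w = (\<Union>e\<in>out_arcs E w. edge_set ?B e)"
    proof
      show "(\<Union>e\<in>out_arcs E w. edge_set ?B e) \<subseteq> vertex_set ?B w"
        using esub by fastforce
      show "vertex_set ?B w \<subseteq> (\<Union>e\<in>out_arcs E w. edge_set ?B e)"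
      proof
        fix z assume z: "z \<in> vertex_set ?B w"
        then obtain p q where z': "z = ((w, p), (v, q))" and Yz: "z \<in> ?Y" "reduced z"
          by (cases z) (auto simp: cycle_branching_def Let_def Y)
        have member: "z \<in> edge_set ?B e"
          if "z = red ((tail E e, e # r), s)" "((tail E e, e # r), s) \<in> ?Y" for e r s
          using that by (cases s) (auto simp: cycle_branching_def Let_def)
        show "z \<in> (\<Union>e\<in>out_arcs E w. edge_set ?B e)"
        proof (cases p)
          case (Cons e r)
          then have e: "e \<in> out_arcs E w" "z = ((tail E e, e # r), (v, q))"
            using Yz z' by (auto simp: Y awalk_Cons_iff)
          then have "z \<in> edge_set ?B e" using member[of e r "(v, q)"] Yz by (simp add: red_reduced)
          then show ?thesis using e by blast
        next
          case Nil
          then have w: "w \<in> ?C" "awalk v q w" using Yz z' by (auto simp: Y awalk_Nil_iff)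
          then obtain e where e: "e \<in> set c" "tail E e = w" by (auto simp: cycle_verts_def)
          then have ea: "e \<in> arcs E" using u(1) by blast
          have "awalk v (q @ [e]) (head E e)" "awalk w [e] (head E e)"
            using w e ea by (auto simp: awalk_Cons_iff awalk_Nil_iff)
          then have "((tail E e, e # []), (v, q @ [e])) \<in> ?Y"
            using head_C[OF e(1)] e by (auto simp: Y)
          moreover have "z = red ((tail E e, e # []), (v, q @ [e]))"
            using red_append[of w "[]" "[e]" v q] Yz(2) z' Nil e by (simp add: red_reduced)
          ultimately have "z \<in> edge_set ?B e" by (rule member[rotated])
          then show ?thesis using e ea by auto
        qed
      qed
    qed
  qed
qed

end

(*
  A graded ideal I of L_K(E) is determined by the set T of vertices outside I together with the set B
  of those infinite emitters v in T that emit only finitely many edges into T and whose gap element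
  v - (sum of e e^* over these edges) is not in I.  Proof: a homogeneous element of I whose ghost paths
  all have source v is treated by induction on the maximal length of these ghost paths, multiplying by
  the edges e emitted by v on the right.

  If M is graded simple, T is directed.  A vertex v in B yields x in M killed by all e^* with source v,
  so that M is spanned by the elements p x, T = R(v) and B = {v}; these are the invariants of N_v.
  If B is empty, the type depends on the vertices v with T = R(v): if there is none, T has a countable
  cofinal subset, because the paths q with q^* x nonzero form a finitely branching tree, and a
  strictly decreasing path can be built; otherwise these vertices carry a sink, an exclusive cycle, an
  infinite emitter, or enough cycles for an infinite path that is not eventually periodic.
  Conversely T and B can be computed for each module in the list, and they determine its type.
*)
theory Submission
  imports Defs "HOL-Library.Countable_Set"
begin

section \<open>Congruence modulo the Leavitt relations\<close>

text \<open>Neither linear independence of the normal forms nor the grading of the algebra itself is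
  established. Elements are representatives in the free algebra modulo the Leavitt ideal, and the
  gradedness of an annihilator is read off from a degree on the module. Homogeneity enters the
  comparison of ideals because the paths in the ghost-free part of a homogeneous element have equal
  length: multiplying by a single \<open>p^*\<close> isolates one coefficient and returns a vertex.
  The obstacle is an infinite emitter \<open>v\<close>, which is not the sum of its
  \<open>e e^*\<close>; the gap element measures the failure and forces the second invariant
  \<open>B\<close>. The need for a degree also explains why exclusive cycles get \<open>N_c\<close>:
  for such a cycle \<open>c\<close> based at \<open>v\<close>, the element \<open>c - v\<close>
  kills \<open>V_[ccc...]\<close> while \<open>v\<close> does not, so that annihilator is not
  graded, whereas \<open>N_c\<close> remembers how often the cycle is run through. Countability
  matters because an infinite path has only countably many vertices: a directed support without a
  countable cofinal subset has to be excluded before a decreasing path can be cofinal.\<close>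

abbreviation single :: "'a \<Rightarrow> 'b \<Rightarrow> 'a \<Rightarrow>\<^sub>0 'b::zero" where
  "single \<equiv> Poly_Mapping.single"

text \<open>These are exactly the representatives from which the carrier of
  \<open>leavitt_algebra\<close> is built.\<close>

definition free_plus :: "('v, 'e) pre_digraph \<Rightarrow> ('v, 'e, 'k::field) free_elem set" where
  "free_plus E = {a. Poly_Mapping.keys a \<subseteq> lists (generators E) - {[]}}"

lemma free_plus_subset: "free_plus E \<subseteq> carrier (free_algebra E)"
  unfolding free_plus_def by (simp only: free_algebra_simps(1) subset_iff mem_Collect_eq) blast

lemma free_plus_zero [simp]: "0 \<in> free_plus E"
  by (simp add: free_plus_def)

lemma free_plus_add: "\<lbrakk>a \<in> free_plus E; b \<in> free_plus E\<rbrakk> \<Longrightarrow> a + b \<in> free_plus E"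
  using Poly_Mapping.keys_add[of a b] unfolding free_plus_def by blast

lemma free_plus_diff: "\<lbrakk>a \<in> free_plus E; b \<in> free_plus E\<rbrakk> \<Longrightarrow> a - b \<in> free_plus E"
  using keys_diff[of a b] unfolding free_plus_def by blast

lemma free_plus_sum: "(\<And>i. i \<in> S \<Longrightarrow> f i \<in> free_plus E) \<Longrightarrow> sum f S \<in> free_plus E"
  by (induction S rule: infinite_finite_induct) (auto intro: free_plus_add)

lemma free_plus_mult_left:
  assumes "a \<in> free_plus E" "b \<in> carrier (free_algebra E)"
  shows "b * a \<in> free_plus E"
  using assms keys_mult[of b a] unfolding free_plus_def by (fastforce simp: subset_iff)

lemma free_plus_mult_right:
  assumes "a \<in> free_plus E" "b \<in> carrier (free_algebra E)"
  shows "a * b \<in> free_plus E"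
  using assms keys_mult[of a b] unfolding free_plus_def by (fastforce simp: subset_iff)

lemma free_plus_mult: "\<lbrakk>a \<in> free_plus E; b \<in> free_plus E\<rbrakk> \<Longrightarrow> a * b \<in> free_plus E"
  using free_plus_mult_right free_plus_subset by blast

lemma free_plus_single: "\<lbrakk>w \<in> lists (generators E); w \<noteq> []\<rbrakk> \<Longrightarrow> single w c \<in> free_plus E"
  by (simp add: free_plus_def)

lemma Vertex_in_generators [simp]: "Vertex v \<in> generators E \<longleftrightarrow> v \<in> verts E"
  and Edge_in_generators [simp]: "Edge e \<in> generators E \<longleftrightarrow> e \<in> arcs E"
  and Ghost_in_generators [simp]: "Ghost e \<in> generators E \<longleftrightarrow> e \<in> arcs E"
  by (auto simp: generators_def)

lemma single_carrier: "w \<in> lists (generators E) \<Longrightarrow> single w c \<in> carrier (free_algebra E)"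
  by simp

lemma carrier_single_one: "single [] c \<in> carrier (free_algebra E)"
  by simp

text \<open>Calculating with representatives keeps the products of \<open>Poly_Mapping\<close>
  available and lets a relation be applied inside a word.\<close>

definition lcong :: "('v, 'e) pre_digraph \<Rightarrow> ('v, 'e, 'k::field) free_elem \<Rightarrow>
    ('v, 'e, 'k) free_elem \<Rightarrow> bool" where
  "lcong E a b \<longleftrightarrow> a - b \<in> leavitt_ideal E"

context wf_digraph begin

lemma leavitt_ideal_zero [simp]: "(0 :: ('a, 'b, 'k::field) free_elem) \<in> leavitt_ideal G"
  and leavitt_ideal_add: "\<lbrakk>a \<in> leavitt_ideal G; b \<in> leavitt_ideal G\<rbrakk> \<Longrightarrow> a + b \<in> leavitt_ideal G"
  and leavitt_ideal_uminus: "a \<in> leavitt_ideal G \<Longrightarrow> - a \<in> leavitt_ideal G"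
  and leavitt_ideal_mult_left:
    "\<lbrakk>a \<in> leavitt_ideal G; b \<in> carrier (free_algebra G)\<rbrakk> \<Longrightarrow> b * a \<in> leavitt_ideal G"
  and leavitt_ideal_mult_right:
    "\<lbrakk>a \<in> leavitt_ideal G; b \<in> carrier (free_algebra G)\<rbrakk> \<Longrightarrow> a * b \<in> leavitt_ideal G"
  for a b :: "('a, 'b, 'k::field) free_elem"
proof -
  interpret I: ideal "leavitt_ideal G" "free_algebra G :: ('a, 'b, 'k) free_elem ring"
    by (rule leavitt_ideal_ideal[OF wf_digraph_axioms])
  show "(0 :: ('a, 'b, 'k) free_elem) \<in> leavitt_ideal G" using additive_subgroup.zero_closed[OF I.is_additive_subgroup] by simp
  show "a + b \<in> leavitt_ideal G" if "a \<in> leavitt_ideal G" "b \<in> leavitt_ideal G"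
    using additive_subgroup.a_closed[OF I.is_additive_subgroup that] by simp
  show "- a \<in> leavitt_ideal G" if a: "a \<in> leavitt_ideal G"
  proof -
    have "a \<in> carrier (free_algebra G)" using I.a_subset a by blast
    then have "\<ominus>\<^bsub>free_algebra G\<^esub> a = - a"
      by (intro I.minus_equality) (simp_all)
    then show ?thesis using additive_subgroup.a_inv_closed[OF I.is_additive_subgroup a] by simp
  qed
  show "b * a \<in> leavitt_ideal G" if "a \<in> leavitt_ideal G" "b \<in> carrier (free_algebra G)"
    using I.I_l_closed[OF that] by simp
  show "a * b \<in> leavitt_ideal G" if "a \<in> leavitt_ideal G" "b \<in> carrier (free_algebra G)"
    using I.I_r_closed[OF that] by simp
qed

lemma leavitt_relators_subset_ideal:
  "(leavitt_relators G :: ('a, 'b, 'k::field) free_elem set) \<subseteq> leavitt_ideal G"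
proof -
  interpret F: ring "free_algebra G :: ('a, 'b, 'k) free_elem ring" by (rule free_algebra_ring)
  show ?thesis unfolding leavitt_ideal_def
    by (rule F.genideal_self[OF leavitt_relators_carrier[OF wf_digraph_axioms]])
qed

text \<open>No relator has a constant term, and the elements without constant term form an ideal.
  Hence a congruence never leads out of \<open>free_plus\<close>, and ideals of the Leavitt path
  algebra can be lifted to it.\<close>

lemma leavitt_ideal_subset_free_plus:
  "(leavitt_ideal G :: ('a, 'b, 'k::field) free_elem set) \<subseteq> free_plus G"
proof -
  let ?F = "free_algebra G :: ('a, 'b, 'k) free_elem ring"
  interpret F: ring ?F by (rule free_algebra_ring)
  have "ideal (free_plus G) ?F"
  proof (rule idealI[OF free_algebra_ring])
    show "subgroup (free_plus G) (add_monoid ?F)"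
    proof (rule F.add.subgroupI)
      show "\<ominus>\<^bsub>?F\<^esub> a \<in> free_plus G" if a: "a \<in> free_plus G" for a
      proof -
        have "a \<in> carrier ?F" using a free_plus_subset by blast
        then have "\<ominus>\<^bsub>?F\<^esub> a = - a" by (intro F.minus_equality) auto
        then show ?thesis using free_plus_diff[OF free_plus_zero a] by simp
      qed
      show "a \<oplus>\<^bsub>?F\<^esub> b \<in> free_plus G" if "a \<in> free_plus G" "b \<in> free_plus G" for a b
        using free_plus_add[OF that] by simp
      show "free_plus G \<noteq> {}" using free_plus_zero by blast
    qed (rule free_plus_subset)
  next
    fix a b :: "('a, 'b, 'k) free_elem" assume ab: "a \<in> free_plus G" "b \<in> carrier ?F"
    then show "b \<otimes>\<^bsub>?F\<^esub> a \<in> free_plus G" "a \<otimes>\<^bsub>?F\<^esub> b \<in> free_plus G"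
      using free_plus_mult_left[OF ab] free_plus_mult_right[OF ab] by simp_all
  qed
  moreover have "leavitt_relators G \<subseteq> (free_plus G :: ('a, 'b, 'k) free_elem set)"
  proof
    fix a :: "('a, 'b, 'k) free_elem" assume a: "a \<in> leavitt_relators G"
    have "Poly_Mapping.lookup a [] = 0"
      using a by cases (simp_all add: lookup_minus lookup_single lookup_sum)
    then show "a \<in> free_plus G"
      using subsetD[OF leavitt_relators_carrier[OF wf_digraph_axioms] a]
      by (auto simp: free_plus_def in_keys_iff simp del: in_lists_conv_set)
  qed
  ultimately show ?thesis unfolding leavitt_ideal_def by (rule F.genideal_minimal)
qed

lemma lcong_refl [simp, intro]: "lcong G a a"
  by (simp add: lcong_def)

lemma lcong_sym: "lcong G a b \<Longrightarrow> lcong G b a"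
  using leavitt_ideal_uminus[of "a - b"] by (simp add: lcong_def)

lemma lcong_trans [trans]: "\<lbrakk>lcong G a b; lcong G b c\<rbrakk> \<Longrightarrow> lcong G a c"
  using leavitt_ideal_add[of "a - b" "b - c"] by (simp add: lcong_def)

lemma lcong_add: "\<lbrakk>lcong G a b; lcong G c d\<rbrakk> \<Longrightarrow> lcong G (a + c) (b + d)"
  using leavitt_ideal_add[of "a - b" "c - d"] by (simp add: lcong_def algebra_simps)

lemma lcong_uminus: "lcong G a b \<Longrightarrow> lcong G (- a) (- b)"
  using leavitt_ideal_uminus[of "a - b"] by (simp add: lcong_def algebra_simps)

lemma lcong_diff: "\<lbrakk>lcong G a b; lcong G c d\<rbrakk> \<Longrightarrow> lcong G (a - c) (b - d)"
  using lcong_add[OF _ lcong_uminus] by fastforce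

lemma lcong_sum: "(\<And>i. i \<in> S \<Longrightarrow> lcong G (f i) (g i)) \<Longrightarrow> lcong G (sum f S) (sum g S)"
  by (induction S rule: infinite_finite_induct) (auto intro: lcong_add)

lemma lcong_mult_left: "\<lbrakk>lcong G a b; c \<in> carrier (free_algebra G)\<rbrakk> \<Longrightarrow> lcong G (c * a) (c * b)"
  using leavitt_ideal_mult_left[of "a - b" c] unfolding lcong_def by (simp only: right_diff_distrib)

lemma lcong_mult_right: "\<lbrakk>lcong G a b; c \<in> carrier (free_algebra G)\<rbrakk> \<Longrightarrow> lcong G (a * c) (b * c)"
  using leavitt_ideal_mult_right[of "a - b" c] unfolding lcong_def by (simp only: left_diff_distrib)

lemma lcong_relator: "a - b \<in> leavitt_relators G \<Longrightarrow> lcong G a b"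
  using leavitt_relators_subset_ideal unfolding lcong_def by blast

text \<open>The rewriting rule of the calculus: a congruence of words applies to any factor, under
  any coefficient. Since 0 is not a word, vanishing factors need a version of their own.\<close>

lemma lcong_context:
  assumes "lcong G (word x) (word y :: ('a, 'b, 'k::field) free_elem)"
    and "u \<in> lists (generators G)" "w \<in> lists (generators G)"
  shows "lcong G (single (u @ x @ w) (c::'k)) (single (u @ y @ w) c)"
proof -
  have "lcong G (single u c * (word x * word w)) (single u c * (word y * word w))"
    by (intro lcong_mult_left lcong_mult_right assms single_carrier)
  then show ?thesis by (simp add: mult_single)
qed

lemma lcong_context_zero:
  assumes "lcong G (word x) (0 :: ('a, 'b, 'k::field) free_elem)"
    and "u \<in> lists (generators G)" "w \<in> lists (generators G)"
  shows "lcong G (single (u @ x @ w) (c::'k)) 0"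
proof -
  have "lcong G (single u c * (word x * word w)) (single u c * (0 * word w))"
    by (intro lcong_mult_left lcong_mult_right assms single_carrier)
  then show ?thesis by (simp add: mult_single)
qed

lemma vertex_vertex_cong: "v \<in> verts G \<Longrightarrow> lcong G (word [Vertex v, Vertex v]) (word [Vertex v])"
  using lcong_relator[OF leavitt_relators.vertex_vertex[of v G v]] by simp

lemma vertex_vertex_zero:
  "\<lbrakk>v \<in> verts G; w \<in> verts G; v \<noteq> w\<rbrakk> \<Longrightarrow> lcong G (word [Vertex v, Vertex w]) 0"
  using lcong_relator[OF leavitt_relators.vertex_vertex[of v G w]] by simp

lemma source_edge_cong: "e \<in> arcs G \<Longrightarrow> lcong G (word [Vertex (tail G e), Edge e]) (word [Edge e])"
  by (rule lcong_relator[OF leavitt_relators.source_edge])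

lemma edge_range_cong: "e \<in> arcs G \<Longrightarrow> lcong G (word [Edge e, Vertex (head G e)]) (word [Edge e])"
  by (rule lcong_relator[OF leavitt_relators.edge_range])

lemma range_ghost_cong: "e \<in> arcs G \<Longrightarrow> lcong G (word [Vertex (head G e), Ghost e]) (word [Ghost e])"
  by (rule lcong_relator[OF leavitt_relators.range_ghost])

lemma ghost_source_cong: "e \<in> arcs G \<Longrightarrow> lcong G (word [Ghost e, Vertex (tail G e)]) (word [Ghost e])"
  by (rule lcong_relator[OF leavitt_relators.ghost_source])

lemma ghost_edge_cong: "e \<in> arcs G \<Longrightarrow> lcong G (word [Ghost e, Edge e]) (word [Vertex (head G e)])"
  using lcong_relator[OF leavitt_relators.ghost_edge[of e G e]] by simp

lemma ghost_edge_zero: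
  "\<lbrakk>e \<in> arcs G; f \<in> arcs G; e \<noteq> f\<rbrakk> \<Longrightarrow> lcong G (word [Ghost e, Edge f]) 0"
  using lcong_relator[OF leavitt_relators.ghost_edge[of e G f]] by simp

lemma regular_cong:
  "regular_vertex G v \<Longrightarrow> lcong G (word [Vertex v]) (\<Sum>e\<in>out_arcs G v. word [Edge e, Ghost e])"
  by (rule lcong_relator[OF leavitt_relators.regular])

lemma vertex_edge_zero:
  assumes "e \<in> arcs G" "v \<in> verts G" "v \<noteq> tail G e"
  shows "lcong G (word [Vertex v, Edge e]) (0 :: ('a, 'b, 'k::field) free_elem)"
proof -
  have "lcong G (word ([Vertex v] @ [Edge e] @ []) :: ('a, 'b, 'k) free_elem)
      (word ([Vertex v] @ [Vertex (tail G e), Edge e] @ []))"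
    by (intro lcong_context lcong_sym[OF source_edge_cong]) (use assms in auto)
  also have "lcong G (word ([] @ [Vertex v, Vertex (tail G e)] @ [Edge e])) (0 :: ('a, 'b, 'k) free_elem)"
    by (intro lcong_context_zero vertex_vertex_zero) (use assms in auto)
  then have "lcong G (word ([Vertex v] @ [Vertex (tail G e), Edge e] @ [])) (0 :: ('a, 'b, 'k) free_elem)"
    by simp
  finally show ?thesis by simp
qed

lemma ghost_vertex_zero:
  assumes "e \<in> arcs G" "v \<in> verts G" "v \<noteq> tail G e"
  shows "lcong G (word [Ghost e, Vertex v]) (0 :: ('a, 'b, 'k::field) free_elem)"
proof -
  have "lcong G (word ([] @ [Ghost e] @ [Vertex v]) :: ('a, 'b, 'k) free_elem)
      (word ([] @ [Ghost e, Vertex (tail G e)] @ [Vertex v]))"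
    by (intro lcong_context lcong_sym[OF ghost_source_cong]) (use assms in auto)
  also have "lcong G (word ([Ghost e] @ [Vertex (tail G e), Vertex v] @ [])) (0 :: ('a, 'b, 'k) free_elem)"
    by (intro lcong_context_zero vertex_vertex_zero) (use assms in auto)
  then have "lcong G (word ([] @ [Ghost e, Vertex (tail G e)] @ [Vertex v])) (0 :: ('a, 'b, 'k) free_elem)"
    by simp
  finally show ?thesis by simp
qed

section \<open>Normal forms and homogeneous elements\<close>

text \<open>The word \<open>p w q\<^sup>*\<close>, where \<open>w\<close> is the common range of \<open>p\<close> and \<open>q\<close>.\<close>

definition nf :: "'b list \<Rightarrow> 'a \<Rightarrow> 'b list \<Rightarrow> ('a, 'b) generator list" where
  "nf p w q = map Edge p @ Vertex w # rev (map Ghost q)"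

text \<open>Only a spanning set: modulo the ideal a regular vertex \<open>v\<close> is the sum of
  its \<open>e e^*\<close>, so distinct normal forms may be dependent.\<close>

definition nf_words :: "int \<Rightarrow> ('a, 'b) generator list set" where
  "nf_words n = {nf p w q | p w q. (\<exists>u. awalk u p w) \<and> (\<exists>u. awalk u q w) \<and>
     int (length p) - int (length q) = n}"

definition homogeneous :: "int \<Rightarrow> ('a, 'b, 'k::field) free_elem \<Rightarrow> bool" where
  "homogeneous n a \<longleftrightarrow> Poly_Mapping.keys a \<subseteq> nf_words n"

lemma awalk_arcs: "awalk u p w \<Longrightarrow> set p \<subseteq> arcs G"
  by blast

lemma nf_generators:
  assumes "awalk u p w" "awalk u' q w"
  shows "nf p w q \<in> lists (generators G)"
  using awalk_arcs[OF assms(1)] awalk_arcs[OF assms(2)] awalk_last_in_verts[OF assms(1)]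
  by (auto simp: nf_def subset_iff)

lemma nf_words_generators: "x \<in> nf_words n \<Longrightarrow> x \<in> lists (generators G) - {[]}"
  using nf_generators by (fastforce simp: nf_words_def nf_def)

lemma homogeneous_free_plus: "homogeneous n a \<Longrightarrow> a \<in> free_plus G"
  using nf_words_generators by (auto simp: homogeneous_def free_plus_def simp del: in_lists_conv_set)

lemma homogeneous_zero [simp]: "homogeneous n 0"
  by (simp add: homogeneous_def)

lemma homogeneous_add: "\<lbrakk>homogeneous n a; homogeneous n b\<rbrakk> \<Longrightarrow> homogeneous n (a + b)"
  using Poly_Mapping.keys_add[of a b] unfolding homogeneous_def by blast

lemma homogeneous_sum: "(\<And>i. i \<in> S \<Longrightarrow> homogeneous n (f i)) \<Longrightarrow> homogeneous n (sum f S)"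
  by (induction S rule: infinite_finite_induct) (auto intro: homogeneous_add)

lemma vertex_nf_cong:
  assumes "awalk u p w" "awalk v q w" "v' \<in> verts G"
  shows "lcong G (word [Vertex v'] * single (nf p w q) (c::'k::field))
    (if v' = u then single (nf p w q) c else 0)"
proof -
  have q: "rev (map Ghost q) \<in> lists (generators G)" using awalk_arcs[OF assms(2)] by (auto simp: subset_iff)
  show ?thesis
  proof (cases p)
    case Nil
    then have u: "u = w" "w \<in> verts G" using assms by (auto simp: awalk_Nil_iff)
    have "lcong G (single ([] @ [Vertex w, Vertex w] @ rev (map Ghost q)) c)
      (single ([] @ [Vertex w] @ rev (map Ghost q)) c)"
      by (intro lcong_context vertex_vertex_cong q) (use u in auto)
    moreover have "lcong G (single ([] @ [Vertex v', Vertex w] @ rev (map Ghost q)) c) 0" if "v' \<noteq> w"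
      by (intro lcong_context_zero vertex_vertex_zero q) (use u assms that in auto)
    ultimately show ?thesis using Nil u by (auto simp: nf_def mult_single)
  next
    case (Cons e p')
    then have e: "e \<in> arcs G" "u = tail G e" "awalk (head G e) p' w" using assms by (auto simp: awalk_Cons_iff)
    have g: "nf p' w q \<in> lists (generators G)" using nf_generators assms e by blast
    have "lcong G (single ([] @ [Vertex (tail G e), Edge e] @ nf p' w q) c)
      (single ([] @ [Edge e] @ nf p' w q) c)"
      by (intro lcong_context source_edge_cong g) (use e in auto)
    moreover have "lcong G (single ([] @ [Vertex v', Edge e] @ nf p' w q) c) 0" if "v' \<noteq> u"
      by (intro lcong_context_zero vertex_edge_zero g) (use e assms that in auto)
    ultimately show ?thesis using Cons e by (auto simp: nf_def mult_single)
  qed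
qed

text \<open>A generator prepended to a normal form lengthens it, is absorbed, cancels against its
  first edge, or gives 0; so one word always suffices and no sums arise.\<close>

lemma word_normal_form:
  assumes "x \<in> lists (generators G)" "x \<noteq> []"
  shows "lcong G (word x :: ('a, 'b, 'k::field) free_elem) 0 \<or>
    (\<exists>n. \<exists>y\<in>nf_words n. lcong G (word x :: ('a, 'b, 'k) free_elem) (word y))"
  using assms
proof (induction x rule: list.induct)
  case (Cons g x)
  have g: "g \<in> generators G" using Cons.prems by simp
  have nfI: ?case if "lcong G (word (g # x) :: ('a, 'b, 'k) free_elem) (word (nf p w q))" "awalk u p w" "awalk u' q w" for p w q u u'
    using that unfolding nf_words_def by blast
  show ?case
  proof (cases "x = []")
    case True
    show ?thesis
    proof (cases g)
      case (Vertex v)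
      then show ?thesis using g True by (intro nfI[of "[]" v "[]"]) (auto simp: nf_def awalk_Nil_iff)
    next
      case (Edge e)
      then show ?thesis using g True lcong_sym[OF edge_range_cong[of e]]
        by (intro nfI[of "[e]" "head G e" "[]"]) (auto simp: nf_def awalk_Nil_iff awalk_Cons_iff)
    next
      case (Ghost e)
      then show ?thesis using g True lcong_sym[OF range_ghost_cong[of e]]
        by (intro nfI[of "[]" "head G e" "[e]"]) (auto simp: nf_def awalk_Nil_iff awalk_Cons_iff)
    qed
  next
    case False
    have left: "lcong G (word (g # x)) (word [g] * b)" if "lcong G (word x) b" for b :: "('a, 'b, 'k) free_elem"
      using lcong_mult_left[OF that, of "word [g]"] g by (simp add: mult_single)
    consider (zero) "lcong G (word x :: ('a, 'b, 'k) free_elem) 0"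
      | (nf) n y where "y \<in> nf_words n" "lcong G (word x :: ('a, 'b, 'k) free_elem) (word y)"
      using Cons False by auto
    then show ?thesis
    proof cases
      case zero
      from left[OF this] show ?thesis by simp
    next
      case (nf n y)
      then obtain p w q u u' where y: "y = nf p w q" "awalk u p w" "awalk u' q w"
        unfolding nf_words_def by blast
      have yg: "y \<in> lists (generators G)" using nf_generators y by blast
      have vertex: "lcong G (word (Vertex v # y) :: ('a, 'b, 'k) free_elem) (if v = u then word y else 0)"
        if "v \<in> verts G" for v
        using vertex_nf_cong[OF y(2,3) that, of 1] by (simp add: y(1) mult_single split: if_splits)
      have gy: "lcong G (word (g # x) :: ('a, 'b, 'k) free_elem) (word (g # y))"
        using left[OF nf(2)] by (simp add: mult_single)
      \<comment> \<open>Writing \<open>g\<close> as \<open>g v\<close> lets the vertex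
        \<open>v\<close> test whether the source \<open>u\<close> of the normal form fits; if it
        does not, the product vanishes.\<close>
      have through: "lcong G (word (g # x) :: ('a, 'b, 'k) free_elem) (if v = u then word (g # y) else 0)"
        if "lcong G (word [g]) (word [g, Vertex v] :: ('a, 'b, 'k) free_elem)" "v \<in> verts G" for v
      proof -
        have "lcong G (word ([] @ [g] @ y)) (word ([] @ [g, Vertex v] @ y) :: ('a, 'b, 'k) free_elem)"
          by (intro lcong_context that yg) simp
        then have "lcong G (word (g # y)) (word [g] * word (Vertex v # y) :: ('a, 'b, 'k) free_elem)"
          by (simp add: mult_single)
        from lcong_trans[OF gy this] have "lcong G (word (g # x)) (word [g] * word (Vertex v # y) :: ('a, 'b, 'k) free_elem)" .
        also have "lcong G (word [g] * word (Vertex v # y)) (word [g] * (if v = u then word y else 0) :: ('a, 'b, 'k) free_elem)"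
          using g by (intro lcong_mult_left vertex that) simp
        finally show ?thesis by (simp add: mult_single split: if_splits)
      qed
      show ?thesis
      proof (cases g)
        case (Vertex v)
        then have "lcong G (word (g # x) :: ('a, 'b, 'k) free_elem) (if v = u then word y else 0)"
          using lcong_trans[OF gy] vertex[of v] g by simp
        then show ?thesis using nf(1) by (auto split: if_splits)
      next
        case (Edge e)
        have e: "e \<in> arcs G" using Edge g by simp
        have eu: "lcong G (word (g # x) :: ('a, 'b, 'k) free_elem) (if head G e = u then word (g # y) else 0)"
          by (rule through) (use lcong_sym[OF edge_range_cong[OF e]] e Edge in simp_all)
        show ?thesis
        proof (cases "head G e = u")
          case True
          then show ?thesis using eu y e Edge
            by (intro nfI[of "e # p" w q "tail G e" u']) (auto simp: nf_def awalk_Cons_iff)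
        qed (use eu in simp)
      next
        case (Ghost e)
        have e: "e \<in> arcs G" using Ghost g by simp
        have eu: "lcong G (word (g # x) :: ('a, 'b, 'k) free_elem) (if tail G e = u then word (g # y) else 0)"
          by (rule through) (use lcong_sym[OF ghost_source_cong[OF e]] e Ghost in simp_all)
        show ?thesis
        proof (cases p)
          case Nil
          show ?thesis
          proof (cases "tail G e = u")
            case True
            let ?q = "rev (map Ghost q)"
            have u: "u = w" using y(2) Nil by (simp add: awalk_Nil_iff)
            have q: "?q \<in> lists (generators G)" using awalk_arcs[OF y(3)] by (auto simp: subset_iff)
            have "lcong G (word (g # x)) (word ([] @ [Ghost e, Vertex (tail G e)] @ ?q) :: ('a, 'b, 'k) free_elem)"
              using eu True u by (simp add: Ghost y(1) Nil nf_def)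
            also have "lcong G \<dots> (word ([] @ [Ghost e] @ ?q))"
              by (intro lcong_context ghost_source_cong e q) simp
            also have "lcong G \<dots> (word ([] @ [Vertex (head G e), Ghost e] @ ?q))"
              by (intro lcong_context lcong_sym[OF range_ghost_cong[OF e]] q) simp
            \<comment> \<open>Ghost words are reversed, so a ghost edge added on the left is the
              last edge of the path.\<close>
            finally have "lcong G (word (g # x)) (word (nf [] (head G e) (q @ [e])) :: ('a, 'b, 'k) free_elem)"
              by (simp add: nf_def)
            then show ?thesis
              by (rule nfI) (use y e True u in \<open>auto simp: awalk_Nil_iff awalk_Cons_iff\<close>)
          qed (use eu in simp)
        next
          case (Cons f p')
          then have f: "f \<in> arcs G" "awalk (head G f) p' w" using y(2) by (auto simp: awalk_Cons_iff)
          have gy': "lcong G (word (g # x)) (word ([] @ [Ghost e, Edge f] @ nf p' w q) :: ('a, 'b, 'k) free_elem)"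
            using gy by (simp add: Ghost y(1) Cons nf_def)
          have r: "nf p' w q \<in> lists (generators G)" using nf_generators f(2) y(3) by blast
          show ?thesis
          proof (cases "e = f")
            case True
            note gy'
            also have "lcong G (word ([] @ [Ghost e, Edge f] @ nf p' w q))
                (word ([] @ [Vertex (head G e)] @ nf p' w q) :: ('a, 'b, 'k) free_elem)"
              unfolding True[symmetric] by (intro lcong_context ghost_edge_cong e r) simp
            also have "lcong G \<dots> (word (nf p' w q))"
              using vertex_nf_cong[OF f(2) y(3), of "head G e" 1] e True by (simp add: mult_single)
            finally show ?thesis by (rule nfI[OF _ f(2) y(3)])
          next
            case False
            have "lcong G (word ([] @ [Ghost e, Edge f] @ nf p' w q)) (0 :: ('a, 'b, 'k) free_elem)"
              by (intro lcong_context_zero ghost_edge_zero e f False r) simp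
            then show ?thesis using lcong_trans[OF gy'] by blast
          qed
        qed
      qed
    qed
  qed
qed simp

lemma lcong_scale:
  assumes "lcong G (word x) (word y :: ('a, 'b, 'k::field) free_elem)"
  shows "lcong G (single x (c::'k)) (single y c)"
  using lcong_context[OF assms, of "[]" "[]" c] by simp

text \<open>Existence only. What uniqueness would give is demanded from the kernel at hand instead,
  by \<open>graded_kernel\<close>.\<close>

lemma homogeneous_decomposition_ex:
  assumes "(a :: ('a, 'b, 'k::field) free_elem) \<in> free_plus G"
  shows "\<exists>N h. finite N \<and> (\<forall>n. homogeneous n (h n)) \<and> lcong G a (\<Sum>n\<in>N. h n)"
proof -
  have "Poly_Mapping.keys a \<subseteq> lists (generators G) - {[]}" using assms by (simp add: free_plus_def)
  then show ?thesis
  proof (induction a rule: poly_mapping_single_induct_keys)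
    case zero
    show ?case by (intro exI[of _ "{}"] exI[of _ "\<lambda>_. 0"]) auto
  next
    case (single x c)
    then consider (z) "lcong G (word x :: ('a, 'b, 'k) free_elem) 0"
      | (n) n y where "y \<in> nf_words n" "lcong G (word x :: ('a, 'b, 'k) free_elem) (word y)"
      using word_normal_form by (metis DiffE singletonI)
    then show ?case
    proof cases
      case z
      then have "lcong G (single x c) 0"
        using lcong_context_zero[OF z, of "[]" "[]" c] by simp
      then show ?thesis by (intro exI[of _ "{}"] exI[of _ "\<lambda>_. 0"]) auto
    next
      case (n n y)
      then show ?thesis
        by (intro exI[of _ "{n}"] exI[of _ "\<lambda>m. if m = n then single y c else 0"])
          (auto simp: lcong_scale homogeneous_def)
    qed
  next
    case (add a b)
    then obtain N h N' h' where h: "finite N" "\<forall>n. homogeneous n (h n)" "lcong G a (\<Sum>n\<in>N. h n)"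
      "finite N'" "\<forall>n. homogeneous n (h' n)" "lcong G b (\<Sum>n\<in>N'. h' n)" by blast
    let ?h = "\<lambda>n. (if n \<in> N then h n else 0) + (if n \<in> N' then h' n else 0)"
    have "(\<Sum>n\<in>N \<union> N'. ?h n) = (\<Sum>n\<in>N. h n) + (\<Sum>n\<in>N'. h' n)"
      using h by (simp add: sum.distrib sum.If_cases Int_absorb1)
    then show ?case using h
      by (intro exI[of _ "N \<union> N'"] exI[of _ ?h]) (auto intro!: homogeneous_add lcong_add)
  qed
qed

section \<open>Filtering by the length of ghost paths\<close>

definition real_part :: "int \<Rightarrow> 'a \<Rightarrow> ('a, 'b, 'k::field) free_elem \<Rightarrow> bool" where
  "real_part n v a \<longleftrightarrow> Poly_Mapping.keys a \<subseteq> {nf p v [] | p. (\<exists>u. awalk u p v) \<and> int (length p) = n}"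

text \<open>
  The homogeneous elements of degree \<open>n\<close> that are sums of words \<open>p q\<^sup>*\<close> with \<open>q\<close> of source \<open>v\<close> and
  length at most \<open>m\<close>, sorted by the first edge of \<open>q\<close>.
\<close>

primrec ghost_bounded :: "nat \<Rightarrow> int \<Rightarrow> 'a \<Rightarrow> ('a, 'b, 'k::field) free_elem \<Rightarrow> bool" where
  "ghost_bounded 0 n v a = real_part n v a"
| "ghost_bounded (Suc m) n v a = (\<exists>A F b. real_part n v A \<and> finite F \<and> F \<subseteq> out_arcs G v \<and>
     (\<forall>e\<in>F. ghost_bounded m (n + 1) (head G e) (b e)) \<and> a = A + (\<Sum>e\<in>F. b e * word [Ghost e]))"

lemma real_part_zero [simp]: "real_part n v 0"
  by (simp add: real_part_def)

lemma real_part_add: "\<lbrakk>real_part n v a; real_part n v b\<rbrakk> \<Longrightarrow> real_part n v (a + b)"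
  using Poly_Mapping.keys_add[of a b] unfolding real_part_def by blast

lemma real_part_edge:
  assumes "real_part n (tail G e) (a :: ('a, 'b, 'k::field) free_elem)" "e \<in> arcs G"
  shows "\<exists>b. real_part (n + 1) (head G e) b \<and> lcong G (a * word [Edge e]) b"
proof -
  have "Poly_Mapping.keys a \<subseteq> {nf p (tail G e) [] | p. (\<exists>u. awalk u p (tail G e)) \<and> int (length p) = n}"
    using assms(1) by (simp add: real_part_def)
  then show ?thesis
  proof (induction a rule: poly_mapping_single_induct_keys)
    case zero
    show ?case by (intro exI[of _ 0]) auto
  next
    case (single x c)
    then obtain p u where p: "x = nf p (tail G e) []" "awalk u p (tail G e)" "int (length p) = n" by blast
    have Ep: "map Edge p \<in> lists (generators G)" using awalk_arcs[OF p(2)] by (auto simp: subset_iff)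
    have "lcong G (single (map Edge p @ [Vertex (tail G e), Edge e] @ []) c)
        (single (map Edge p @ [Edge e] @ []) c)"
      by (intro lcong_context source_edge_cong assms Ep) auto
    also have "lcong G (single (map Edge p @ [Edge e] @ []) c)
        (single (map Edge p @ [Edge e, Vertex (head G e)] @ []) c)"
      by (intro lcong_context lcong_sym[OF edge_range_cong] assms Ep) auto
    finally have "lcong G (single x c * word [Edge e]) (single (nf (p @ [e]) (head G e) []) c)"
      by (simp add: p nf_def mult_single)
    moreover have "real_part (n + 1) (head G e) (single (nf (p @ [e]) (head G e) []) c)"
      using p assms(2) unfolding real_part_def
      by (auto intro!: exI[of _ "p @ [e]"] exI[of _ u] simp: awalk_Cons_iff awalk_Nil_iff)
    ultimately show ?case by blast
  next
    case (add a b)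
    then obtain a' b' where "real_part (n + 1) (head G e) a'" "lcong G (a * word [Edge e]) a'"
      "real_part (n + 1) (head G e) b'" "lcong G (b * word [Edge e]) b'" by blast
    then show ?case unfolding distrib_right by (intro exI[of _ "a' + b'"] conjI real_part_add lcong_add)
  qed
qed

lemma ghost_bounded_zero [simp]: "ghost_bounded m n v 0"
  by (induction m arbitrary: n v) (auto intro!: exI[of _ 0] exI[of _ "{}"])

lemma ghost_bounded_add:
  "\<lbrakk>ghost_bounded m n v a; ghost_bounded m n v b\<rbrakk> \<Longrightarrow> ghost_bounded m n v (a + b)"
proof (induction m arbitrary: n v a b)
  case 0
  then show ?case by (simp add: real_part_add)
next
  case (Suc m)
  obtain A F f where a: "real_part n v A" "finite F" "F \<subseteq> out_arcs G v"
    "\<forall>e\<in>F. ghost_bounded m (n + 1) (head G e) (f e)" "a = A + (\<Sum>e\<in>F. f e * word [Ghost e])"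
    using Suc.prems(1) by auto
  obtain B H h where b: "real_part n v B" "finite H" "H \<subseteq> out_arcs G v"
    "\<forall>e\<in>H. ghost_bounded m (n + 1) (head G e) (h e)" "b = B + (\<Sum>e\<in>H. h e * word [Ghost e])"
    using Suc.prems(2) by auto
  let ?f = "\<lambda>e. (if e \<in> F then f e else 0) + (if e \<in> H then h e else 0)"
  have "(\<Sum>e\<in>F \<union> H. ?f e * word [Ghost e]) = (\<Sum>e\<in>F \<union> H. (if e \<in> F then f e * word [Ghost e] else 0)) +
      (\<Sum>e\<in>F \<union> H. (if e \<in> H then h e * word [Ghost e] else 0))"
    by (simp add: distrib_right flip: sum.distrib) (intro sum.cong; simp)
  also have "\<dots> = (\<Sum>e\<in>F. f e * word [Ghost e]) + (\<Sum>e\<in>H. h e * word [Ghost e])"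
    using a b by (simp add: sum.If_cases Int_absorb1)
  finally have "a + b = (A + B) + (\<Sum>e\<in>F \<union> H. ?f e * word [Ghost e])"
    using a b by (simp add: algebra_simps)
  moreover have "ghost_bounded m (n + 1) (head G e) (?f e)" if "e \<in> F \<union> H" for e
    using that a b by (intro Suc.IH) auto
  ultimately show ?case using a b
    unfolding ghost_bounded.simps(2) by (intro exI[of _ "A + B"] exI[of _ "F \<union> H"] exI[of _ ?f]) (auto intro: real_part_add)
qed

lemma ghost_bounded_real: "real_part n v a \<Longrightarrow> ghost_bounded m n v a"
  by (cases m) (auto intro!: exI[of _ a] exI[of _ "{}"])

lemma ghost_bounded_Suc: "ghost_bounded m n v a \<Longrightarrow> ghost_bounded (Suc m) n v a"
proof (induction m arbitrary: n v a)
  case 0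
  then show ?case using ghost_bounded_real[of n v a "Suc 0"] by simp
next
  case (Suc m)
  from Suc.prems obtain A F b where "real_part n v A" "finite F" "F \<subseteq> out_arcs G v"
     "\<forall>e\<in>F. ghost_bounded m (n + 1) (head G e) (b e)" "a = A + (\<Sum>e\<in>F. b e * word [Ghost e])"
    by auto
  moreover from this have "\<forall>e\<in>F. ghost_bounded (Suc m) (n + 1) (head G e) (b e)" using Suc.IH by blast
  ultimately show ?case unfolding ghost_bounded.simps(2)[of "Suc m"] by blast
qed

lemma ghost_bounded_mono: "\<lbrakk>ghost_bounded m n v a; m \<le> k\<rbrakk> \<Longrightarrow> ghost_bounded k n v a"
  by (induction k) (auto simp: le_Suc_eq simp del: ghost_bounded.simps intro: ghost_bounded_Suc)

text \<open>All ghost paths start at \<open>v\<close>; this is what lets right multiplication by a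
  vertex separate the pieces of a homogeneous element.\<close>

lemma ghost_bounded_homogeneous_source:
  "\<lbrakk>ghost_bounded m n v a; v \<in> verts G\<rbrakk> \<Longrightarrow>
    Poly_Mapping.keys a \<subseteq> {nf p w q | p w q. (\<exists>u. awalk u p w) \<and> awalk v q w \<and> int (length p) - int (length q) = n}"
proof (induction m arbitrary: n v a)
  case 0
  then show ?case by (fastforce simp: real_part_def awalk_Nil_iff)
next
  case (Suc m)
  obtain A F f where a: "real_part n v A" "finite F" "F \<subseteq> out_arcs G v"
    "\<forall>e\<in>F. ghost_bounded m (n + 1) (head G e) (f e)" "a = A + (\<Sum>e\<in>F. f e * word [Ghost e])"
    using Suc.prems(1) by auto
  let ?S = "{nf p w q | p w q. (\<exists>u. awalk u p w) \<and> awalk v q w \<and> int (length p) - int (length q) = n}"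
  have "Poly_Mapping.keys A \<subseteq> ?S"
    using a(1) Suc.prems(2) by (fastforce simp: real_part_def awalk_Nil_iff)
  moreover have "Poly_Mapping.keys (f e * word [Ghost e]) \<subseteq> ?S" if e: "e \<in> F" for e
  proof
    fix x assume "x \<in> Poly_Mapping.keys (f e * word [Ghost e])"
    then obtain y where y: "y \<in> Poly_Mapping.keys (f e)" "x = y @ [Ghost e]"
      using keys_mult[of "f e" "word [Ghost e]"] by (auto split: if_splits)
    have ea: "e \<in> arcs G" "tail G e = v" using e a by auto
    have "ghost_bounded m (n + 1) (head G e) (f e)" using a e by blast
    then obtain p w q u where "y = nf p w q" "awalk u p w" "awalk (head G e) q w" "int (length p) - int (length q) = n + 1"
      using Suc.IH[of "n + 1" "head G e" "f e"] y ea by auto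
    then have "x = nf p w (e # q)" "awalk u p w" "awalk v (e # q) w" "int (length p) - int (length (e # q)) = n"
      using y ea by (auto simp: nf_def awalk_Cons_iff)
    then show "x \<in> ?S" by blast
  qed
  then have "Poly_Mapping.keys (\<Sum>e\<in>F. f e * word [Ghost e]) \<subseteq> ?S"
    using keys_sum[of "\<lambda>e. f e * word [Ghost e]" F] by blast
  ultimately show ?case unfolding a(5) using Poly_Mapping.keys_add[of A "\<Sum>e\<in>F. f e * word [Ghost e]"] by blast
qed

lemma ghost_bounded_homogeneous: "\<lbrakk>ghost_bounded m n v a; v \<in> verts G\<rbrakk> \<Longrightarrow> homogeneous n a"
  using ghost_bounded_homogeneous_source[of m n v a] unfolding homogeneous_def nf_words_def by blast

lemma ghost_bounded_free_plus: "\<lbrakk>ghost_bounded m n v a; v \<in> verts G\<rbrakk> \<Longrightarrow> a \<in> free_plus G"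
  using ghost_bounded_homogeneous homogeneous_free_plus by blast

lemma nf_vertex_cong:
  assumes "awalk u p w" "awalk v q w" "v' \<in> verts G"
  shows "lcong G (single (nf p w q) (c::'k::field) * word [Vertex v'])
    (if v' = v then single (nf p w q) c else 0)"
proof -
  have Ep: "map Edge p \<in> lists (generators G)" using awalk_arcs[OF assms(1)] by (auto simp: subset_iff)
  show ?thesis
  proof (cases q)
    case Nil
    then have v: "v = w" "w \<in> verts G" using assms by (auto simp: awalk_Nil_iff)
    have "lcong G (single (map Edge p @ [Vertex w, Vertex w] @ []) c)
      (single (map Edge p @ [Vertex w] @ []) c)"
      by (intro lcong_context vertex_vertex_cong Ep) (use v in auto)
    moreover have "lcong G (single (map Edge p @ [Vertex w, Vertex v'] @ []) c) 0" if "v' \<noteq> w"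
      by (intro lcong_context_zero vertex_vertex_zero Ep) (use v assms that in auto)
    ultimately show ?thesis using Nil v by (auto simp: nf_def mult_single)
  next
    case (Cons e q')
    then have e: "e \<in> arcs G" "v = tail G e" "awalk (head G e) q' w" using assms by (auto simp: awalk_Cons_iff)
    have g: "nf p w q' \<in> lists (generators G)" using nf_generators assms e by blast
    have "lcong G (single (nf p w q' @ [Ghost e, Vertex (tail G e)] @ []) c)
      (single (nf p w q' @ [Ghost e] @ []) c)"
      by (intro lcong_context ghost_source_cong g) (use e in auto)
    moreover have "lcong G (single (nf p w q' @ [Ghost e, Vertex v'] @ []) c) 0" if "v' \<noteq> v"
      by (intro lcong_context_zero ghost_vertex_zero g) (use e assms that in auto)
    ultimately show ?thesis using Cons e by (auto simp: nf_def mult_single)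
  qed
qed

lemma ghost_bounded_vertex:
  assumes "ghost_bounded m n v (a :: ('a, 'b, 'k::field) free_elem)" "v \<in> verts G" "v' \<in> verts G"
  shows "lcong G (a * word [Vertex v']) (if v' = v then a else 0)"
  using ghost_bounded_homogeneous_source[OF assms(1,2)]
proof (induction a rule: poly_mapping_single_induct_keys)
  case (single x c)
  then show ?case using nf_vertex_cong assms by blast
next
  case (add a b)
  from lcong_add[OF add.IH] show ?case by (simp add: distrib_right split: if_splits)
qed auto

lemma ghost_bounded_nf:
  assumes "awalk u p w" "awalk v q w"
  shows "ghost_bounded (length q) (int (length p) - int (length q)) v (single (nf p w q) (c::'k::field))"
  using assms(2)
proof (induction q arbitrary: v)
  case Nil
  then show ?case using assms(1) by (auto simp: real_part_def awalk_Nil_iff)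
next
  case (Cons e q)
  then have e: "e \<in> arcs G" "v = tail G e" "awalk (head G e) q w" by (auto simp: awalk_Cons_iff)
  have IH: "ghost_bounded (length q) (int (length p) - int (length q)) (head G e) (single (nf p w q) c)"
    by (rule Cons.IH[OF e(3)])
  have "single (nf p w (e # q)) c = 0 + (\<Sum>f\<in>{e}. single (nf p w q) c * word [Ghost f])"
    by (simp add: mult_single nf_def)
  moreover have "int (length p) - int (length (e # q)) + 1 = int (length p) - int (length q)" by simp
  ultimately show ?case
    using IH e unfolding list.size add_0_right add_Suc_right ghost_bounded.simps
    by (intro exI[of _ 0] exI[of _ "{e}"] exI[of _ "\<lambda>_. single (nf p w q) c"]) simp
qed

text \<open>The normal forms are sorted by the source of the ghost path. Finitely many terms have a
  common bound \<open>m\<close>.\<close>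

lemma homogeneous_ghost_bounded:
  assumes "homogeneous n (a :: ('a, 'b, 'k::field) free_elem)"
  shows "\<exists>m V f. finite V \<and> V \<subseteq> verts G \<and> (\<forall>v\<in>V. ghost_bounded m n v (f v)) \<and> a = (\<Sum>v\<in>V. f v)"
proof -
  have "Poly_Mapping.keys a \<subseteq> nf_words n" using assms by (simp add: homogeneous_def)
  then show ?thesis
  proof (induction a rule: poly_mapping_single_induct_keys)
    case zero
    show ?case by (intro exI[of _ 0] exI[of _ "{}"]) auto
  next
    case (single x c)
    then obtain p w q u v where x: "x = nf p w q" "awalk u p w" "awalk v q w" "int (length p) - int (length q) = n"
      by (auto simp: nf_words_def)
    have "v \<in> verts G" using x by blast
    then show ?case using ghost_bounded_nf[OF x(2,3)] x(1,4)
      by (intro exI[of _ "length q"] exI[of _ "{v}"] exI[of _ "\<lambda>_. single x c"]) auto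
  next
    case (add a b)
    then obtain m V f k W g where
      a: "finite V" "V \<subseteq> verts G" "\<forall>v\<in>V. ghost_bounded m n v (f v)" "a = (\<Sum>v\<in>V. f v)" and
      b: "finite W" "W \<subseteq> verts G" "\<forall>v\<in>W. ghost_bounded k n v (g v)" "b = (\<Sum>v\<in>W. g v)" by blast
    let ?f = "\<lambda>v. (if v \<in> V then f v else 0) + (if v \<in> W then g v else 0)"
    have "a + b = (\<Sum>v\<in>V \<union> W. ?f v)"
      using a b by (simp add: sum.distrib sum.If_cases Int_absorb1)
    moreover have "ghost_bounded (max m k) n v (?f v)" if "v \<in> V \<union> W" for v
      using that a b by (intro ghost_bounded_add) (auto intro: ghost_bounded_mono)
    ultimately show ?case using a b by (intro exI[of _ "max m k"] exI[of _ "V \<union> W"] exI[of _ ?f]) auto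
  qed
qed

text \<open>With equal lengths neither path is a proper prefix of the other, so cancellation ends in
  a vertex or in 0 and no piece of a path is left over.\<close>

lemma ghost_path_cong:
  assumes "awalk u p w" "awalk u' q w" "length p = length q"
  shows "lcong G (word (rev (map Ghost p) @ nf q w [])) (if p = q then word [Vertex w] else (0 :: ('a, 'b, 'k::field) free_elem))"
  using assms
proof (induction p arbitrary: q u u')
  case Nil
  then show ?case by (simp add: nf_def)
next
  case (Cons e p)
  then obtain f q' where q: "q = f # q'" by (cases q) auto
  have e: "e \<in> arcs G" "awalk (head G e) p w" and f: "f \<in> arcs G" "awalk (head G f) q' w"
    using Cons.prems q by (auto simp: awalk_Cons_iff)
  have gens: "rev (map Ghost p) \<in> lists (generators G)" using awalk_arcs[OF e(2)] by (auto simp: subset_iff)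
  have gens': "nf q' w [] \<in> lists (generators G)"
    using f(2) awalk_last_in_verts[OF f(2)] by (intro nf_generators) (auto simp: awalk_Nil_iff)
  have split: "rev (map Ghost (e # p)) @ nf q w [] = rev (map Ghost p) @ [Ghost e, Edge f] @ nf q' w []"
    by (simp add: q nf_def)
  show ?case
  proof (cases "e = f")
    case False
    then show ?thesis unfolding split using lcong_context_zero[OF ghost_edge_zero gens gens', of e f 1] e f q by simp
  next
    case True
    have "lcong G (word (rev (map Ghost p) @ [Ghost e, Edge f] @ nf q' w []))
      (word (rev (map Ghost p) @ [Vertex (head G e)] @ nf q' w []) :: ('a, 'b, 'k) free_elem)"
      using True e by (intro lcong_context gens gens') (simp add: ghost_edge_cong)
    also have "lcong G (word (rev (map Ghost p) @ [Vertex (head G e)] @ nf q' w []))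
        (word (rev (map Ghost p) @ nf q' w []) :: ('a, 'b, 'k) free_elem)"
    proof -
      have "awalk w [] w" "head G e \<in> verts G" using f(2) e(1) by (auto simp: awalk_Nil_iff)
      from vertex_nf_cong[OF f(2) this, of 1]
      have "lcong G (word ([Vertex (head G e)] @ nf q' w [])) (word (nf q' w []) :: ('a, 'b, 'k) free_elem)"
        using True by (simp add: mult_single)
      from lcong_context[OF this gens, of "[]" 1] show ?thesis by simp
    qed
    also have "lcong G (word (rev (map Ghost p) @ nf q' w [])) (if p = q' then word [Vertex w] else (0 :: ('a, 'b, 'k) free_elem))"
      using e f Cons.prems q by (intro Cons.IH) auto
    finally show ?thesis unfolding split using True q by simp
  qed
qed

text \<open>All paths in \<open>a\<close> have the same length and end at \<open>v\<close>. If
  \<open>p\<close> occurs with coefficient \<open>c\<close>, then the inverse of \<open>c\<close>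
  times \<open>v p^*\<close> kills every other term and turns the term of \<open>p\<close> into
  \<open>v\<close>.\<close>

lemma real_part_extract:
  assumes "real_part n v (a :: ('a, 'b, 'k::field) free_elem)" "a \<noteq> 0"
  shows "\<exists>g\<in>free_plus G. lcong G (g * a) (word [Vertex v])"
proof -
  from assms(2) obtain x where x: "x \<in> Poly_Mapping.keys a" by (metis all_not_in_conv keys_eq_empty)
  then obtain p u where p: "x = nf p v []" "awalk u p v" "int (length p) = n"
    using assms(1) unfolding real_part_def by blast
  let ?g = "single (rev (map Ghost p)) (1 :: 'k)"
  have v: "v \<in> verts G" using p(2) by blast
  have gens: "rev (map Ghost p) \<in> lists (generators G)" using awalk_arcs[OF p(2)] by (auto simp: subset_iff)
  \<comment> \<open>Stated for every \<open>b\<close> with such keys, because the induction passes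
    to summands of \<open>a\<close> in which \<open>x\<close> need not occur.\<close>
  have 1: "lcong G (?g * b) (single [Vertex v] (Poly_Mapping.lookup b x))"
    if "Poly_Mapping.keys b \<subseteq> {nf p v [] | p. (\<exists>u. awalk u p v) \<and> int (length p) = n}" for b :: "('a, 'b, 'k) free_elem"
    using that
  proof (induction b rule: poly_mapping_single_induct_keys)
    case (single y c)
    then obtain q u' where q: "y = nf q v []" "awalk u' q v" "int (length q) = n" by blast
    have "lcong G (single [] c * word (rev (map Ghost p) @ nf q v []))
      (single [] c * (if p = q then word [Vertex v] else 0))"
      by (intro lcong_mult_left carrier_single_one ghost_path_cong) (use p q in auto)
    moreover have "x = y \<longleftrightarrow> p = q"
      by (auto simp: p q nf_def inj_map_eq_map inj_on_def)
    ultimately show ?case by (auto simp: mult_single q p lookup_single when_def)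
  next
    case (add b d)
    from lcong_add[OF add.IH] show ?case by (simp add: distrib_left lookup_add single_add)
  qed auto
  let ?c = "Poly_Mapping.lookup a x"
  have c: "?c \<noteq> 0" using x by (simp add: in_keys_iff)
  \<comment> \<open>The additional vertex keeps the multiplier free of a constant term when
    \<open>p\<close> is empty.\<close>
  let ?h = "single (Vertex v # rev (map Ghost p)) (inverse ?c)"
  have "?h * a = single [Vertex v] (inverse ?c) * (?g * a)"
    by (simp add: mult_single flip: mult.assoc)
  also have "lcong G \<dots> (single [Vertex v] (inverse ?c) * single [Vertex v] ?c)"
    using assms(1) v by (intro lcong_mult_left 1 single_carrier) (auto simp: real_part_def)
  then have "lcong G (single [Vertex v] (inverse ?c) * (?g * a)) (word ([] @ [Vertex v, Vertex v] @ []))"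
    using c by (simp add: mult_single)
  also have "lcong G (word ([] @ [Vertex v, Vertex v] @ []) :: ('a, 'b, 'k) free_elem) (word ([] @ [Vertex v] @ []))"
    by (intro lcong_context vertex_vertex_cong v) auto
  finally have "lcong G (?h * a) (word [Vertex v])" by simp
  moreover have "?h \<in> free_plus G" using gens v by (intro free_plus_single) auto
  ultimately show ?thesis by blast
qed

end

section \<open>Ideals of the Leavitt path algebra, lifted to the free algebra\<close>

text \<open>For the set \<open>F\<close> of edges from \<open>v\<close> that end outside of a hereditary set \<open>H\<close>, this is the element usually written \<open>v\<^sup>H\<close>.\<close>

definition gap :: "('v, 'e) pre_digraph \<Rightarrow> 'e set \<Rightarrow> 'v \<Rightarrow> ('v, 'e, 'k::field) free_elem" where
  "gap E F v = word [Vertex v] - (\<Sum>e\<in>F. word [Edge e, Ghost e])"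

definition kept_edges :: "('v, 'e) pre_digraph \<Rightarrow> ('v, 'e, 'k::field) free_elem set \<Rightarrow> 'v \<Rightarrow> 'e set" where
  "kept_edges E A v = {e \<in> out_arcs E v. word [Vertex (head E e)] \<notin> A}"

text \<open>The preimage of an ideal of the Leavitt path algebra. The multipliers range over
  \<open>free_plus\<close>, as the algebra has no identity in general.\<close>

locale leavitt_kernel = wf_digraph G for G :: "('v, 'e) pre_digraph" +
  fixes A :: "('v, 'e, 'k::field) free_elem set"
  assumes kernel_free_plus: "A \<subseteq> free_plus G"
    and ideal_subset_kernel: "leavitt_ideal G \<subseteq> A"
    and kernel_diff: "\<lbrakk>a \<in> A; b \<in> A\<rbrakk> \<Longrightarrow> a - b \<in> A"
    and kernel_mult_left: "\<lbrakk>a \<in> A; b \<in> free_plus G\<rbrakk> \<Longrightarrow> b * a \<in> A"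
    and kernel_mult_right: "\<lbrakk>a \<in> A; b \<in> free_plus G\<rbrakk> \<Longrightarrow> a * b \<in> A"
begin

lemma kernel_zero [simp]: "0 \<in> A"
  using ideal_subset_kernel leavitt_ideal_zero by blast

lemma kernel_add: "\<lbrakk>a \<in> A; b \<in> A\<rbrakk> \<Longrightarrow> a + b \<in> A"
  using kernel_diff[of a "0 - b"] kernel_diff[of 0 b] by simp

lemma kernel_sum: "(\<And>i. i \<in> S \<Longrightarrow> f i \<in> A) \<Longrightarrow> sum f S \<in> A"
  by (induction S rule: infinite_finite_induct) (auto intro: kernel_add)

lemma kernel_cong: "lcong G a b \<Longrightarrow> a \<in> A \<longleftrightarrow> b \<in> A"
  using kernel_add[of b "a - b"] kernel_diff[of a "a - b"] ideal_subset_kernel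
  by (auto simp: lcong_def)

text \<open>Gradedness phrased for representatives: the components are those of a given sum of
  homogeneous elements, whatever sum is chosen.\<close>

definition graded_kernel :: bool where
  "graded_kernel \<longleftrightarrow> (\<forall>N h. finite N \<and> (\<forall>n. homogeneous n (h n)) \<and> (\<Sum>n\<in>N. h n) \<in> A \<longrightarrow> (\<forall>n\<in>N. h n \<in> A))"

lemma kernel_edge: "\<lbrakk>e \<in> arcs G; word [Edge e] \<in> A\<rbrakk> \<Longrightarrow> word [Vertex (head G e)] \<in> A"
  using kernel_mult_left[of "word [Edge e]" "word [Ghost e]"] kernel_cong[OF ghost_edge_cong[of e]]
  by (simp add: mult_single free_plus_single)

lemma kernel_ghost: "\<lbrakk>e \<in> arcs G; word [Vertex (head G e)] \<in> A\<rbrakk> \<Longrightarrow> word [Ghost e] \<in> A"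
  using kernel_mult_right[of "word [Vertex (head G e)]" "word [Ghost e]"] kernel_cong[OF range_ghost_cong[of e]]
  by (simp add: mult_single free_plus_single)

end

section \<open>Comparison of two ideals through vertices and gap elements\<close>

context wf_digraph begin

lemma edge_ghost_free_plus: "e \<in> arcs G \<Longrightarrow> word [Edge e] \<in> free_plus G" "e \<in> arcs G \<Longrightarrow> word [Ghost e] \<in> free_plus G"
  "e \<in> arcs G \<Longrightarrow> word [Edge e, Ghost e] \<in> free_plus G" "v \<in> verts G \<Longrightarrow> word [Vertex v] \<in> free_plus G"
  by (auto intro!: free_plus_single)

lemma gap_free_plus: "\<lbrakk>v \<in> verts G; F \<subseteq> out_arcs G v\<rbrakk> \<Longrightarrow> gap G F v \<in> free_plus G"
  unfolding gap_def by (intro free_plus_diff free_plus_sum edge_ghost_free_plus) auto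

lemma vertex_gap_cong:
  assumes "v \<in> verts G" "F \<subseteq> out_arcs G v"
  shows "lcong G (word [Vertex v] * gap G F v) (gap G F v :: ('a, 'b, 'k::field) free_elem)"
proof -
  have "lcong G (word [Vertex v, Vertex v] - (\<Sum>e\<in>F. word ([] @ [Vertex (tail G e), Edge e] @ [Ghost e]))) (word [Vertex v] - (\<Sum>e\<in>F. word ([] @ [Edge e] @ [Ghost e]) :: ('a, 'b, 'k) free_elem))"
    by (intro lcong_diff lcong_sum vertex_vertex_cong lcong_context source_edge_cong) (use assms in auto)
  moreover have "(\<Sum>e\<in>F. word [Vertex v, Edge e, Ghost e] :: ('a, 'b, 'k) free_elem) = (\<Sum>e\<in>F. word [Vertex (tail G e), Edge e, Ghost e])"
    using assms by (intro sum.cong) auto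
  ultimately show ?thesis by (simp add: gap_def right_diff_distrib sum_distrib_left mult_single)
qed

text \<open>The gap element removes from \<open>v\<close> what passes through \<open>F\<close>:
  ghost edges of \<open>F\<close> annihilate it, while the other ghost edges do not notice that
  anything was removed.\<close>

lemma ghost_gap_cong:
  assumes "v \<in> verts G" "F \<subseteq> out_arcs G v" "finite F" "e \<in> out_arcs G v"
  shows "lcong G (word [Ghost e] * gap G F v) (if e \<in> F then 0 else word [Ghost e] :: ('a, 'b, 'k::field) free_elem)"
proof -
  have e: "e \<in> arcs G" "tail G e = v" using assms by auto
  have "lcong G (word [Ghost e, Edge f, Ghost f]) (if e = f then word [Ghost e] else 0 :: ('a, 'b, 'k) free_elem)" if f: "f \<in> F" for f
  proof (cases "e = f")
    case True
    have "lcong G (word ([] @ [Ghost e, Edge e] @ [Ghost e])) (word ([] @ [Vertex (head G e)] @ [Ghost e]) :: ('a, 'b, 'k) free_elem)"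
      by (intro lcong_context ghost_edge_cong) (use e in auto)
    then show ?thesis using lcong_trans[OF _ range_ghost_cong[OF e(1)]] True by simp
  next
    case False
    have "lcong G (word ([] @ [Ghost e, Edge f] @ [Ghost f])) (0 :: ('a, 'b, 'k) free_elem)"
      by (intro lcong_context_zero ghost_edge_zero) (use e f assms False in auto)
    then show ?thesis using False by simp
  qed
  then have "lcong G (word [Ghost e, Vertex v] - (\<Sum>f\<in>F. word [Ghost e, Edge f, Ghost f]))
     (word [Ghost e] - (\<Sum>f\<in>F. if e = f then word [Ghost e] else 0 :: ('a, 'b, 'k) free_elem))"
    using ghost_source_cong[OF e(1)] e by (intro lcong_diff lcong_sum) auto
  then show ?thesis using assms(3) by (simp add: gap_def right_diff_distrib sum_distrib_left mult_single split: if_splits)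
qed

text \<open>Right multiplication by \<open>e\<close> strips the ghost edge off the summand that ends
  in \<open>e^*\<close> and kills the other ghost summands. The bound on the ghost length drops by
  one, which drives the later induction.\<close>

lemma ghost_bounded_edge:
  assumes "real_part n v A" "finite F" "F \<subseteq> out_arcs G v" "v \<in> verts G"
    "\<forall>e\<in>F. ghost_bounded m (n + 1) (head G e) (b e)" "e \<in> out_arcs G v"
  shows "lcong G ((A + (\<Sum>e\<in>F. b e * word [Ghost e])) * word [Edge e])
    (A * word [Edge e] + (if e \<in> F then b e else (0 :: ('a, 'b, 'k::field) free_elem)))"
proof -
  have e: "e \<in> arcs G" "tail G e = v" using assms by auto
  have *: "lcong G (b f * word [Ghost f, Edge e]) (if f = e then b f else 0)" if f: "f \<in> F" for f
  proof -
    have fa: "f \<in> arcs G" "ghost_bounded m (n + 1) (head G f) (b f)" using f assms by auto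
    have bf: "b f \<in> carrier (free_algebra G)" using ghost_bounded_free_plus[OF fa(2)] head_in_verts[OF fa(1)] free_plus_subset by blast
    show ?thesis
    proof (cases "f = e")
      case True
      have "lcong G (b f * word [Ghost f, Edge f]) (b f * word [Vertex (head G f)])"
        by (intro lcong_mult_left ghost_edge_cong fa bf)
      also have "lcong G (b f * word [Vertex (head G f)]) (b f)"
        using ghost_bounded_vertex[OF fa(2), of "head G f"] fa by simp
      finally show ?thesis using True by simp
    next
      case False
      have "lcong G (b f * word [Ghost f, Edge e]) (b f * 0)"
        by (intro lcong_mult_left ghost_edge_zero bf) (use False fa e in auto)
      then show ?thesis using False by simp
    qed
  qed
  have "lcong G (A * word [Edge e] + (\<Sum>f\<in>F. b f * word [Ghost f, Edge e]))
     (A * word [Edge e] + (\<Sum>f\<in>F. if f = e then b f else 0))"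
    by (intro lcong_add lcong_sum * lcong_refl)
  then show ?thesis using assms(2) by (simp add: distrib_right sum_distrib_right mult.assoc mult_single)
qed

text \<open>Induction on the ghost length: each \<open>a e\<close> has a smaller bound, so
  \<open>a e\<close> and \<open>a e e^*\<close> lie in \<open>J\<close>. At a regular vertex these
  products sum to \<open>a\<close>. At an infinite emitter with nonzero ghost-free part, those over
  the kept edges sum to \<open>a\<close> only up to \<open>a\<close> times the gap element;
  membership of \<open>a\<close> in \<open>I\<close> then forces the gap element into
  \<open>I\<close>, hence into \<open>J\<close>.\<close>

lemma ghost_bounded_in_kernel:
  assumes I: "leavitt_kernel G I" and J: "leavitt_kernel G (J :: ('a, 'b, 'k::field) free_elem set)"
    and verts: "\<And>v. \<lbrakk>v \<in> verts G; word [Vertex v] \<in> I\<rbrakk> \<Longrightarrow> word [Vertex v] \<in> J"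
    and gaps: "\<And>v. \<lbrakk>infinite_emitter G v; word [Vertex v] \<notin> I; finite (kept_edges G I v); gap G (kept_edges G I v) v \<in> I\<rbrakk>
      \<Longrightarrow> gap G (kept_edges G I v) v \<in> J"
    and a: "ghost_bounded m n v a" "v \<in> verts G" "a \<in> I"
  shows "a \<in> J"
proof -
  interpret I: leavitt_kernel G I by fact
  interpret J: leavitt_kernel G J by fact
  have V: "a \<in> J" if "ghost_bounded m n v a" "v \<in> verts G" "word [Vertex v] \<in> I" for m n v a
  proof -
    have "word [Vertex v] \<in> J" using that verts by blast
    then have "a * word [Vertex v] \<in> J"
      using that ghost_bounded_free_plus J.kernel_mult_left by blast
    then show ?thesis using J.kernel_cong[OF ghost_bounded_vertex[OF that(1,2,2)]] by simp
  qed
  \<comment> \<open>A nonzero ghost-free left factor can be reduced to its range vertex without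
    leaving the ideal.\<close>
  have strip: "word [Vertex v] * b \<in> I" if A: "real_part n v A" "A \<noteq> 0" "b \<in> free_plus G" "A * b \<in> I" for n v A b
  proof -
    obtain g where g: "g \<in> free_plus G" "lcong G (g * A) (word [Vertex v])"
      using real_part_extract[OF A(1,2)] by blast
    have "lcong G (g * A * b) (word [Vertex v] * b)"
      using subsetD[OF free_plus_subset A(3)] by (intro lcong_mult_right g(2))
    moreover have "g * A * b \<in> I" using I.kernel_mult_left[OF A(4) g(1)] by (simp add: mult.assoc)
    ultimately show ?thesis using I.kernel_cong by blast
  qed
  have R: "word [Vertex v] \<in> I" if "real_part n v A" "A \<noteq> 0" "v \<in> verts G" "A \<in> I" for n v A
  proof -
    have "A * word [Vertex v] \<in> I" using that I.kernel_mult_right edge_ghost_free_plus by blast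
    then show ?thesis
      using strip[OF that(1,2) edge_ghost_free_plus(4)[OF that(3)]] I.kernel_cong[OF vertex_vertex_cong[OF that(3)]]
      by (simp add: mult_single)
  qed
  show ?thesis using a
  proof (induction m arbitrary: n v a)
    case 0
    then have "real_part n v a" by simp
    then show ?case using R[of n v a] V[OF 0(1,2)] 0(2,3) by (cases "a = 0") simp_all
  next
    case (Suc m)
    note v = \<open>v \<in> verts G\<close>
    obtain A F b where a: "real_part n v A" "finite F" "F \<subseteq> out_arcs G v"
      "\<forall>e\<in>F. ghost_bounded m (n + 1) (head G e) (b e)" "a = A + (\<Sum>e\<in>F. b e * word [Ghost e])"
      using Suc.prems(1) by auto
    note af = ghost_bounded_free_plus[OF Suc.prems(1) v]
    have edge: "a * word [Edge e] \<in> J" if e: "e \<in> out_arcs G v" for e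
    proof -
      have ea: "e \<in> arcs G" "tail G e = v" using e by auto
      obtain A' where A': "real_part (n + 1) (head G e) A'" "lcong G (A * word [Edge e]) A'"
        using real_part_edge a(1) ea by metis
      let ?c = "A' + (if e \<in> F then b e else 0)"
      have "lcong G (a * word [Edge e]) (A * word [Edge e] + (if e \<in> F then b e else 0))"
        unfolding a(5) by (rule ghost_bounded_edge[OF a(1,2,3) v a(4) e])
      also have "lcong G \<dots> ?c" by (intro lcong_add A' lcong_refl)
      finally have c: "lcong G (a * word [Edge e]) ?c" .
      have "a * word [Edge e] \<in> I" using Suc.prems(3) ea edge_ghost_free_plus I.kernel_mult_right by blast
      then have "?c \<in> I" using I.kernel_cong[OF c] by blast
      moreover have "ghost_bounded m (n + 1) (head G e) ?c"
        using a(4) A'(1) by (intro ghost_bounded_add) (auto intro: ghost_bounded_real)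
      ultimately have "?c \<in> J" using Suc.IH[OF _ head_in_verts[OF ea(1)]] by blast
      then show ?thesis using J.kernel_cong[OF c] by blast
    qed
    have sum: "a * (\<Sum>e\<in>H. word [Edge e, Ghost e]) \<in> J" if "H \<subseteq> out_arcs G v" for H
    proof -
      have "a * word [Edge e, Ghost e] \<in> J" if e: "e \<in> H" for e
      proof -
        have e: "e \<in> out_arcs G v" "e \<in> arcs G" using e \<open>H \<subseteq> _\<close> by auto
        have "a * word [Edge e] * word [Ghost e] \<in> J" 
          by (rule J.kernel_mult_right[OF edge[OF e(1)] edge_ghost_free_plus(2)[OF e(2)]])
        then show ?thesis by (simp add: mult.assoc mult_single)
      qed
      then show ?thesis unfolding sum_distrib_left by (rule J.kernel_sum)
    qed
    have cong: "lcong G (a * word [Vertex v]) a" using ghost_bounded_vertex[OF Suc.prems(1) v v] by simp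
    show ?case
    proof (cases "word [Vertex v] \<in> I")
      case True
      then show ?thesis using V Suc.prems by blast
    next
      case nI: False
      show ?thesis
      proof (cases "A = 0")
        case True
        \<comment> \<open>Without a ghost-free part \<open>a e\<close> is congruent to
          \<open>b e\<close>, so finitely many edges recover \<open>a\<close> even at an infinite
          emitter.\<close>
        have "b e * word [Ghost e] \<in> J" if e: "e \<in> F" for e
        proof -
          have e': "e \<in> out_arcs G v" "e \<in> arcs G" using e a by auto
          have "lcong G (a * word [Edge e]) (b e)"
            using ghost_bounded_edge[OF a(1,2,3) v a(4) e'(1)] True e a(5) by simp
          then have "b e \<in> J" using J.kernel_cong edge[OF e'(1)] by blast
          then show ?thesis using J.kernel_mult_right edge_ghost_free_plus e' by blast
        qed
        then show ?thesis unfolding a(5) using True by (auto intro: J.kernel_sum)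
      next
        case nz: False
        show ?thesis
        proof (cases "finite (out_arcs G v)")
          case fin: True
          show ?thesis
          proof (cases "out_arcs G v = {}")
            case True
            then have "a = A" using a by auto
            then show ?thesis using R[OF a(1) nz v] Suc.prems nI by blast
          next
            case False
            then have "regular_vertex G v" using v fin by (auto simp: regular_vertex_def sink_def infinite_emitter_def)
            then have "lcong G (a * word [Vertex v]) (a * (\<Sum>e\<in>out_arcs G v. word [Edge e, Ghost e]))"
              using af free_plus_subset by (intro lcong_mult_left regular_cong) blast+
            then show ?thesis using sum[of "out_arcs G v"] J.kernel_cong cong by blast
          qed
        next
          case inf: False
          let ?H = "kept_edges G I v"
          \<comment> \<open>For an edge outside \<open>F\<close> the product \<open>a e\<close>
            reduces to \<open>A e\<close>; as it lies in \<open>I\<close>, so do \<open>e\<close>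
            and its range. This is why only finitely many edges are kept.\<close>
          have "?H \<subseteq> F"
          proof
            fix e assume e: "e \<in> ?H"
            then have e': "e \<in> out_arcs G v" "e \<in> arcs G" "tail G e = v" by (auto simp: kept_edges_def)
            show "e \<in> F"
            proof (rule ccontr)
              assume "e \<notin> F"
              then have "lcong G (a * word [Edge e]) (A * word [Edge e])"
                using ghost_bounded_edge[OF a(1,2,3) v a(4) e'(1)] a(5) by simp
              moreover have "a * word [Edge e] \<in> I"
                using Suc.prems e' edge_ghost_free_plus I.kernel_mult_right by blast
              ultimately have "A * word [Edge e] \<in> I" using I.kernel_cong by blast
              then have "word [Vertex v] * word [Edge e] \<in> I"
                using strip[OF a(1) nz] e' edge_ghost_free_plus by blast
              then have "word [Edge e] \<in> I" using I.kernel_cong[OF source_edge_cong[OF e'(2)]] e' by (simp add: mult_single)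
              then show False using I.kernel_edge e e' by (auto simp: kept_edges_def)
            qed
          qed
          then have H: "finite ?H" "?H \<subseteq> out_arcs G v" using a finite_subset by blast+
          let ?g = "gap G ?H v"
          have gf: "?g \<in> free_plus G" using gap_free_plus v H by blast
          \<comment> \<open>The ghost summands stay in both ideals after multiplication by the gap
            element: for a kept edge the product is 0, and for any other edge \<open>e^*\<close>
            itself belongs to both.\<close>
          have Fg: "b e * word [Ghost e] * ?g \<in> I \<and> b e * word [Ghost e] * ?g \<in> J" if e: "e \<in> F" for e
          proof -
            have e': "e \<in> out_arcs G v" "e \<in> arcs G" using e a by auto
            have be: "b e \<in> free_plus G" using a(4) e ghost_bounded_free_plus head_in_verts[OF e'(2)] by blast
            have "word [Ghost e] * ?g \<in> I \<and> word [Ghost e] * ?g \<in> J"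
            proof (cases "e \<in> ?H")
              case True
              then have "lcong G (word [Ghost e] * ?g) (0 :: ('a, 'b, 'k) free_elem)"
                using ghost_gap_cong[OF v H(2,1) e'(1)] by simp
              then show ?thesis using I.kernel_cong[of _ 0] J.kernel_cong[of _ 0] by simp
            next
              case False
              then have "word [Vertex (head G e)] \<in> I" using e' by (auto simp: kept_edges_def)
              moreover from this have "word [Vertex (head G e)] \<in> J" using verts e' by auto
              ultimately have "word [Ghost e] \<in> I" "word [Ghost e] \<in> J"
                using I.kernel_ghost J.kernel_ghost e' by blast+
              then show ?thesis using gf I.kernel_mult_right J.kernel_mult_right by blast
            qed
            then show ?thesis using be I.kernel_mult_left J.kernel_mult_left by (simp add: mult.assoc)
          qed
          have split: "a * ?g = A * ?g + (\<Sum>e\<in>F. b e * word [Ghost e] * ?g)"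
            unfolding a(5) distrib_right sum_distrib_right ..
          have "a * ?g \<in> I" using Suc.prems gf I.kernel_mult_right by blast
          moreover have "(\<Sum>e\<in>F. b e * word [Ghost e] * ?g) \<in> I" using Fg by (blast intro: I.kernel_sum)
          ultimately have "a * ?g - (\<Sum>e\<in>F. b e * word [Ghost e] * ?g) \<in> I" by (rule I.kernel_diff)
          then have "A * ?g \<in> I" unfolding split by simp
          then have "word [Vertex v] * ?g \<in> I" using strip[OF a(1) nz gf] by blast
          then have "?g \<in> I" using I.kernel_cong[OF vertex_gap_cong[OF v H(2)]] by blast
          moreover have "infinite_emitter G v" using inf v by (simp add: infinite_emitter_def)
          ultimately have "?g \<in> J" using gaps nI H(1) by blast
          then have "a * ?g \<in> J" using af J.kernel_mult_left by blast
          moreover have "a * word [Vertex v] = a * ?g + a * (\<Sum>e\<in>?H. word [Edge e, Ghost e])"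
            by (simp add: gap_def right_diff_distrib)
          ultimately have "a * word [Vertex v] \<in> J" using J.kernel_add[OF _ sum[OF H(2)]] by simp
          then show ?thesis using J.kernel_cong[OF cong] by blast
        qed
      qed
    qed
  qed
qed

lemma graded_kernel_subset:
  assumes I: "leavitt_kernel G I" "leavitt_kernel.graded_kernel G I"
    and J: "leavitt_kernel G (J :: ('a, 'b, 'k::field) free_elem set)"
    and verts: "\<And>v. \<lbrakk>v \<in> verts G; word [Vertex v] \<in> I\<rbrakk> \<Longrightarrow> word [Vertex v] \<in> J"
    and gaps: "\<And>v. \<lbrakk>infinite_emitter G v; word [Vertex v] \<notin> I; finite (kept_edges G I v); gap G (kept_edges G I v) v \<in> I\<rbrakk>
      \<Longrightarrow> gap G (kept_edges G I v) v \<in> J"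
  shows "I \<subseteq> J"
proof
  interpret I: leavitt_kernel G I by fact
  interpret J: leavitt_kernel G J by fact
  fix a assume a: "a \<in> I"
  then obtain N h where h: "finite N" "\<forall>n. homogeneous n (h n)" "lcong G a (\<Sum>n\<in>N. h n)"
    using homogeneous_decomposition_ex I.kernel_free_plus by blast
  then have hI: "\<forall>n\<in>N. h n \<in> I" using a I.kernel_cong I(2) I.graded_kernel_def by blast
  have "h n \<in> J" if n: "n \<in> N" for n
  proof -
    obtain m V f where f: "finite V" "V \<subseteq> verts G" "\<forall>v\<in>V. ghost_bounded m n v (f v)" "h n = (\<Sum>v\<in>V. f v)"
      using homogeneous_ghost_bounded h(2) by metis
    have "f v \<in> J" if v: "v \<in> V" for v
    proof -
      have vv: "v \<in> verts G" using v f by blast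
      \<comment> \<open>Right multiplication by \<open>v\<close> isolates the part whose ghost paths
        start at \<open>v\<close>.\<close>
      have "lcong G (\<Sum>u\<in>V. f u * word [Vertex v]) (\<Sum>u\<in>V. if v = u then f u else 0)"
        using f vv by (intro lcong_sum ghost_bounded_vertex) auto
      then have "lcong G (h n * word [Vertex v]) (f v)"
        using f(1) v by (simp add: f(4) sum_distrib_right)
      moreover have "h n * word [Vertex v] \<in> I" using hI n vv I.kernel_mult_right edge_ghost_free_plus by blast
      ultimately have "f v \<in> I" using I.kernel_cong by blast
      then show ?thesis using ghost_bounded_in_kernel[OF I(1) J verts gaps] f(3) v vv by blast
    qed
    then show ?thesis unfolding f(4) by (rule J.kernel_sum)
  qed
  then show "a \<in> J" using h(3) J.kernel_cong J.kernel_sum by blast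
qed

end

section \<open>Support and defects as invariants of a graded ideal\<close>

definition support :: "('v, 'e) pre_digraph \<Rightarrow> ('v, 'e, 'k::field) free_elem set \<Rightarrow> 'v set" where
  "support E A = {v \<in> verts E. word [Vertex v] \<notin> A}"

text \<open>\<open>v\<close> need not be a breaking vertex: if \<open>v\<close> emits no edge into the support, the gap element is \<open>v\<close> itself.\<close>

definition defects :: "('v, 'e) pre_digraph \<Rightarrow> ('v, 'e, 'k::field) free_elem set \<Rightarrow> 'v set" where
  "defects E A = {v \<in> support E A. infinite_emitter E v \<and> finite (kept_edges E A v) \<and>
     gap E (kept_edges E A v) v \<notin> A}"

context wf_digraph begin

lemma kept_edges_support: "kept_edges G A v = {e \<in> out_arcs G v. head G e \<in> support G A}"
  by (auto simp: kept_edges_def support_def)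

text \<open>The kept edges, and with them the gap elements, depend on the support alone. Equal
  supports therefore make the two ideals be tested on the same elements.\<close>

lemma graded_kernels_eq:
  assumes "leavitt_kernel G I" "leavitt_kernel.graded_kernel G I"
    and "leavitt_kernel G J" "leavitt_kernel.graded_kernel G J"
    and "support G I = support G (J :: ('a, 'b, 'k::field) free_elem set)" "defects G I = defects G J"
  shows "I = J"
proof -
  have kept: "kept_edges G I v = kept_edges G J v" for v
    by (simp add: kept_edges_support assms(5))
  have v: "word [Vertex v] \<in> I \<longleftrightarrow> word [Vertex v] \<in> J" if "v \<in> verts G" for v
    using assms(5) that by (auto simp: support_def)
  have g: "gap G (kept_edges G I v) v \<in> I \<longleftrightarrow> gap G (kept_edges G I v) v \<in> J"
    if "infinite_emitter G v" "word [Vertex v] \<notin> I" "finite (kept_edges G I v)" for v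
  proof -
    have "v \<in> verts G" using that by (simp add: infinite_emitter_def)
    then have "v \<in> defects G I \<longleftrightarrow> gap G (kept_edges G I v) v \<notin> I"
      "v \<in> defects G J \<longleftrightarrow> gap G (kept_edges G I v) v \<notin> J"
      using that v kept[of v] by (auto simp: defects_def support_def)
    then show ?thesis using assms(6) by blast
  qed
  have "I \<subseteq> J"
  proof (rule graded_kernel_subset[OF assms(1,2,3)])
    show "word [Vertex v] \<in> J" if "v \<in> verts G" "word [Vertex v] \<in> I" for v using v that by blast
    show "gap G (kept_edges G I v) v \<in> J"
      if "infinite_emitter G v" "word [Vertex v] \<notin> I" "finite (kept_edges G I v)" "gap G (kept_edges G I v) v \<in> I" for v
      using that g[of v] by simp
  qed
  moreover have "J \<subseteq> I"
  proof (rule graded_kernel_subset[OF assms(3,4,1)])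
    show "word [Vertex v] \<in> I" if "v \<in> verts G" "word [Vertex v] \<in> J" for v using v that by blast
    show "gap G (kept_edges G J v) v \<in> I"
      if "infinite_emitter G v" "word [Vertex v] \<notin> J" "finite (kept_edges G J v)" "gap G (kept_edges G J v) v \<in> J" for v
      using that v[of v] g[of v] unfolding kept by (simp add: infinite_emitter_def)
  qed
  ultimately show ?thesis by blast
qed

section \<open>Modules\<close>

lemma leavitt_class_cong:
  assumes "lcong G a b"
  shows "leavitt_class G a = leavitt_class G (b :: ('a, 'b, 'k::field) free_elem)"
proof -
  have "leavitt_class G a \<subseteq> leavitt_class G b" if "lcong G a b" for a b :: "('a, 'b, 'k) free_elem"
  proof
    fix c assume "c \<in> leavitt_class G a"
    then obtain h where h: "h \<in> leavitt_ideal G" "c = h + a"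
      unfolding leavitt_class_def a_r_coset_defs by auto
    then have "h + (a - b) \<in> leavitt_ideal G" "c = (h + (a - b)) + b"
      using that leavitt_ideal_add by (auto simp: lcong_def)
    then show "c \<in> leavitt_class G b"
      unfolding leavitt_class_def a_r_coset_defs by (auto intro!: bexI[of _ "h + (a - b)"])
  qed
  then show ?thesis using assms lcong_sym by blast
qed

lemma leavitt_algebra_carrier:
  "carrier (leavitt_algebra G) = leavitt_class G ` (free_plus G :: ('a, 'b, 'k::field) free_elem set)"
proof -
  have "{a \<in> carrier (free_algebra G). [] \<notin> Poly_Mapping.keys a} = (free_plus G :: ('a, 'b, 'k) free_elem set)"
    by (simp only: free_plus_def free_algebra_simps(1)) blast
  then show ?thesis by (simp add: leavitt_algebra_def)
qed

lemma leavitt_class_ops: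
  fixes a b :: "('a, 'b, 'k::field) free_elem"
  assumes "a \<in> free_plus G" "b \<in> free_plus G"
  shows "leavitt_class G a \<oplus>\<^bsub>leavitt_algebra G\<^esub> leavitt_class G b = leavitt_class G (a + b)"
    and "leavitt_class G a \<otimes>\<^bsub>leavitt_algebra G\<^esub> leavitt_class G b = leavitt_class G (a * b)"
proof -
  interpret I: ideal "leavitt_ideal G" "free_algebra G :: ('a, 'b, 'k) free_elem ring"
    by (rule leavitt_ideal_ideal[OF wf_digraph_axioms])
  have ab: "a \<in> carrier (free_algebra G)" "b \<in> carrier (free_algebra G)"
    using assms free_plus_subset by blast+
  show "leavitt_class G a \<oplus>\<^bsub>leavitt_algebra G\<^esub> leavitt_class G b = leavitt_class G (a + b)"
    "leavitt_class G a \<otimes>\<^bsub>leavitt_algebra G\<^esub> leavitt_class G b = leavitt_class G (a * b)"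
    using I.a_rcos_sum[OF ab] I.rcoset_mult_add[OF ab]
    by (simp_all add: leavitt_algebra_def FactRing_def leavitt_class_def)
qed

end

definition ann_kernel :: "('v, 'e) pre_digraph \<Rightarrow> (('v, 'e, 'k::field) free_elem set, 'm, 't) module_scheme \<Rightarrow>
    ('v, 'e, 'k) free_elem set" where
  "ann_kernel E M = {a \<in> free_plus E. \<forall>x\<in>carrier M. leavitt_class E a \<odot>\<^bsub>M\<^esub> x = \<zero>\<^bsub>M\<^esub>}"

text \<open>An annihilator and its lift determine each other, and neither type mentions the carrier,
  so modules on different carriers can be compared.\<close>

lemma annihilator_eq_iff_ann_kernel_eq:
  fixes M :: "(('v, 'e, 'k::field) free_elem set, 'm, 't) module_scheme"
    and N :: "(('v, 'e, 'k) free_elem set, 'n, 's) module_scheme"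
  assumes "wf_digraph E"
  shows "annihilator (leavitt_algebra E) M = annihilator (leavitt_algebra E) N \<longleftrightarrow> ann_kernel E M = ann_kernel E N"
proof -
  interpret wf_digraph E by fact
  have ker: "ann_kernel E L = {a \<in> free_plus E. leavitt_class E a \<in> annihilator (leavitt_algebra E) L}"
    for L :: "(('v, 'e, 'k) free_elem set, 'l, 'u) module_scheme"
    by (auto simp: ann_kernel_def annihilator_def leavitt_algebra_carrier)
  have ann: "annihilator (leavitt_algebra E) L = leavitt_class E ` ann_kernel E L"
    for L :: "(('v, 'e, 'k) free_elem set, 'l, 'u) module_scheme"
    by (auto simp: ann_kernel_def annihilator_def leavitt_algebra_carrier)
  show ?thesis
  proof
    assume "annihilator (leavitt_algebra E) M = annihilator (leavitt_algebra E) N"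
    then show "ann_kernel E M = ann_kernel E N" unfolding ker[of M] ker[of N] by (simp only:)
  next
    assume "ann_kernel E M = ann_kernel E N"
    then show "annihilator (leavitt_algebra E) M = annihilator (leavitt_algebra E) N"
      unfolding ann[of M] ann[of N] by (simp only:)
  qed
qed

text \<open>\<open>M\<close> has no scalar multiplication of its own: coefficients act only as part
  of elements without constant term.\<close>

locale leavitt_module = wf_digraph G + left_module "leavitt_algebra G" M
  for G :: "('v, 'e) pre_digraph" and M :: "(('v, 'e, 'k::field) free_elem set, 'm, 't) module_scheme" (structure)
begin

definition act :: "('v, 'e, 'k) free_elem \<Rightarrow> 'm \<Rightarrow> 'm" where
  "act a x = leavitt_class G a \<odot>\<^bsub>M\<^esub> x"

lemma class_carrier: "a \<in> free_plus G \<Longrightarrow> leavitt_class G a \<in> carrier (leavitt_algebra G)"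
  by (simp add: leavitt_algebra_carrier)

lemma act_closed [simp]: "\<lbrakk>a \<in> free_plus G; x \<in> carrier M\<rbrakk> \<Longrightarrow> act a x \<in> carrier M"
  unfolding act_def by (intro smult_closed class_carrier)

lemma act_add: "\<lbrakk>a \<in> free_plus G; b \<in> free_plus G; x \<in> carrier M\<rbrakk> \<Longrightarrow> act (a + b) x = act a x \<oplus> act b x"
  unfolding act_def by (simp add: smult_l_distr class_carrier flip: leavitt_class_ops)

lemma act_mult: "\<lbrakk>a \<in> free_plus G; b \<in> free_plus G; x \<in> carrier M\<rbrakk> \<Longrightarrow> act (a * b) x = act a (act b x)"
  unfolding act_def by (simp add: smult_assoc class_carrier flip: leavitt_class_ops)

lemma act_add_right: "\<lbrakk>a \<in> free_plus G; x \<in> carrier M; y \<in> carrier M\<rbrakk> \<Longrightarrow> act a (x \<oplus> y) = act a x \<oplus> act a y"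
  unfolding act_def by (intro smult_r_distr class_carrier)

lemma act_cong: "lcong G a b \<Longrightarrow> act a x = act b x"
  unfolding act_def using leavitt_class_cong by metis

lemma act_zero [simp]: "x \<in> carrier M \<Longrightarrow> act 0 x = \<zero>"
  using act_add[of 0 0 x] by (simp add: a_comm)

lemma act_zero_right [simp]: "a \<in> free_plus G \<Longrightarrow> act a \<zero> = \<zero>"
  using act_add_right[of a "\<zero>" "\<zero>"] by simp

lemma ann_kernel_iff: "a \<in> ann_kernel G M \<longleftrightarrow> a \<in> free_plus G \<and> (\<forall>x\<in>carrier M. act a x = \<zero>)"
  by (simp add: ann_kernel_def act_def)

lemma leavitt_kernel_ann_kernel: "leavitt_kernel G (ann_kernel G M)"
proof
  show "leavitt_ideal G \<subseteq> ann_kernel G M"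
  proof
    fix a :: "('v, 'e, 'k) free_elem" assume a: "a \<in> leavitt_ideal G"
    then have "lcong G a 0" by (simp add: lcong_def)
    then show "a \<in> ann_kernel G M"
      using a leavitt_ideal_subset_free_plus act_cong[of a 0] by (auto simp: ann_kernel_iff)
  qed
  show "a - b \<in> ann_kernel G M" if "a \<in> ann_kernel G M" "b \<in> ann_kernel G M" for a b
  proof -
    have ab: "a \<in> free_plus G" "b \<in> free_plus G" using that by (auto simp: ann_kernel_iff)
    note that' = that
    have "act (a - b) x = \<zero>" if x: "x \<in> carrier M" for x
      using act_add[OF free_plus_diff[OF ab] ab(2) x] x that' free_plus_diff[OF ab]
      by (simp add: ann_kernel_iff)
    then show ?thesis using free_plus_diff[OF ab] by (simp add: ann_kernel_iff)
  qed
qed (auto simp: ann_kernel_iff act_mult free_plus_mult)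

end

section \<open>Annihilators of branching modules\<close>

context branching_system begin

lemma branching_leavitt_module:
  "leavitt_module E (branching_module E X :: (('v, 'e, 'k::field) free_elem set, 'x \<Rightarrow>\<^sub>0 'k) module)"
  unfolding leavitt_module_def using branching_module_left_module wf_digraph_axioms by blast

lemma ann_kernel_branching_iff:
  "a \<in> ann_kernel E (branching_module E X) \<longleftrightarrow> a \<in> free_plus E \<and>
     (\<forall>x\<in>points X. \<forall>c. free_act E X a (single x (c :: 'k::field)) = 0)"
proof -
  have 1: "free_act E X a m = 0" if "Poly_Mapping.keys m \<subseteq> points X"
    and zero: "\<forall>x\<in>points X. \<forall>c. free_act E X a (single x (c :: 'k::field)) = 0" for m
    using that(1)
  proof (induction m rule: poly_mapping_single_induct_keys)
    case (single x c)
    then show ?case using zero by blast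
  qed (simp_all add: free_act_add_right)
  have 3: "m \<in> carrier (branching_module E X) \<longleftrightarrow> Poly_Mapping.keys m \<subseteq> points X"
    "\<zero>\<^bsub>branching_module E X\<^esub> = 0" for m :: "'x \<Rightarrow>\<^sub>0 'k"
    by (simp_all add: branching_module_def)
  have 2: "leavitt_class E a \<odot>\<^bsub>branching_module E X\<^esub> m = free_act E X a m"
    if "a \<in> free_plus E" "Poly_Mapping.keys m \<subseteq> points X" for m
    by (rule free_act_class[OF subsetD[OF free_plus_subset that(1)]]) (use that(2) 3(1) in blast)
  show ?thesis
  proof (intro iffI conjI ballI allI)
    assume a: "a \<in> ann_kernel E (branching_module E X)"
    then show af: "a \<in> free_plus E" by (simp add: ann_kernel_def)
    fix x and c :: 'k assume "x \<in> points X"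
    then have "Poly_Mapping.keys (single x c) \<subseteq> points X" by simp
    then show "free_act E X a (single x c) = 0"
      using a 2[OF af, of "single x c"] 3 unfolding ann_kernel_def mem_Collect_eq by metis
  next
    assume "a \<in> free_plus E \<and> (\<forall>x\<in>points X. \<forall>c. free_act E X a (single x (c :: 'k)) = 0)"
    then show "a \<in> ann_kernel E (branching_module E X)"
      unfolding ann_kernel_def by (simp add: 1 2 3)
  qed
qed

abbreviation branching_kernel :: "('v, 'e, 'k::field) free_elem set" where
  "branching_kernel \<equiv> ann_kernel E (branching_module E X)"

lemma single_all_zero: "(\<forall>c. single x (c :: 'k::field) = 0) \<longleftrightarrow> False"
proof -
  have "Poly_Mapping.lookup (single x (1 :: 'k)) x \<noteq> Poly_Mapping.lookup 0 x" by simp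
  then have "single x (1 :: 'k) \<noteq> 0" by (rule contrapos_nn) (simp only:)
  then show ?thesis by blast
qed

text \<open>The vertex \<open>v\<close> acts as the projection onto the span of
  \<open>X_v\<close>.\<close>

lemma support_branching:
  "support E (branching_kernel :: ('v, 'e, 'k::field) free_elem set) = {v \<in> verts E. vertex_set X v \<noteq> {}}"
proof -
  have "word [Vertex v] \<in> (branching_kernel :: ('v, 'e, 'k) free_elem set) \<longleftrightarrow> vertex_set X v = {}" if v: "v \<in> verts E" for v
    using vertex_set_subset[OF v] v
    by (auto simp: ann_kernel_branching_iff free_act_single basis_act_def free_plus_single single_all_zero)
  then show ?thesis by (auto simp: support_def)
qed

text \<open>Each \<open>e e^*\<close> projects onto the span of \<open>X_e\<close>, so the gap
  element projects onto the span of those points of \<open>X_v\<close> that lie in no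
  \<open>X_e\<close> with \<open>e\<close> in \<open>F\<close>.\<close>

lemma gap_branching:
  assumes "v \<in> verts E" "finite F" "F \<subseteq> out_arcs E v"
  shows "gap E F v \<in> (branching_kernel :: ('v, 'e, 'k::field) free_elem set) \<longleftrightarrow> vertex_set X v \<subseteq> (\<Union>e\<in>F. edge_set X e)"
proof -
  let ?U = "\<Union>e\<in>F. edge_set X e"
  have arcs: "e \<in> arcs E" "tail E e = v" if "e \<in> F" for e using that assms(3) by auto
  have sub: "x \<in> vertex_set X v" if "x \<in> ?U" for x
    using that edge_set_subset arcs by blast
  have act: "free_act E X (gap E F v) (single x c) =
     (if x \<in> vertex_set X v \<and> x \<notin> ?U then single x c else 0)" for x and c :: 'k
  proof -
    let ?s = "single x c"
    have *: "basis_act E X [Edge e, Ghost e] x c = (if x \<in> edge_set X e then ?s else 0)" if "e \<in> F" for e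
      using edge_map_in(2,4)[OF arcs(1)[OF that], of x] by (simp add: basis_act_def)
    have gap: "free_act E X (gap E F v) ?s = (if x \<in> vertex_set X v then ?s else 0) - (\<Sum>e\<in>F. if x \<in> edge_set X e then ?s else 0)"
      by (simp add: gap_def free_act_diff free_act_sum_left free_act_single *) (simp add: basis_act_def)
    show ?thesis
    proof (cases "x \<in> ?U")
      case True
      then obtain e where e: "e \<in> F" "x \<in> edge_set X e" by blast
      have "(\<Sum>f\<in>F. if x \<in> edge_set X f then ?s else 0) = (\<Sum>f\<in>F. if f = e then ?s else 0)"
        using e edge_set_unique[OF e(2)] arcs by (intro sum.cong refl if_cong) blast+
      also have "\<dots> = ?s" using e assms(2) by simp
      finally show ?thesis unfolding gap using sub[OF True] True by simp
    next
      case False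
      then have "(\<Sum>f\<in>F. if x \<in> edge_set X f then ?s else 0) = 0" by (intro sum.neutral) auto
      then show ?thesis unfolding gap using False by (simp only: diff_0_right simp_thms)
    qed
  qed
  have "gap E F v \<in> (branching_kernel :: ('v, 'e, 'k) free_elem set) \<longleftrightarrow>
      (\<forall>x\<in>points X. \<not> (x \<in> vertex_set X v \<and> x \<notin> ?U))"
    using assms by (simp add: ann_kernel_branching_iff act single_all_zero gap_free_plus)
  then show ?thesis using vertex_set_subset[OF assms(1)] by blast
qed

lemma defects_branching:
  fixes T defines "T \<equiv> {v \<in> verts E. vertex_set X v \<noteq> {}}"
  shows "defects E (branching_kernel :: ('v, 'e, 'k::field) free_elem set) =
    {v \<in> T. infinite_emitter E v \<and> finite {e \<in> out_arcs E v. head E e \<in> T} \<and>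
      \<not> vertex_set X v \<subseteq> (\<Union>e\<in>{e \<in> out_arcs E v. head E e \<in> T}. edge_set X e)}"
proof -
  have s: "support E (branching_kernel :: ('v, 'e, 'k) free_elem set) = T"
    by (simp add: support_branching T_def)
  then have k: "kept_edges E (branching_kernel :: ('v, 'e, 'k) free_elem set) v = {e \<in> out_arcs E v. head E e \<in> T}" for v
    by (simp add: kept_edges_support)
  have g: "gap E {e \<in> out_arcs E v. head E e \<in> T} v \<in> (branching_kernel :: ('v, 'e, 'k) free_elem set) \<longleftrightarrow>
    vertex_set X v \<subseteq> (\<Union>e\<in>{e \<in> out_arcs E v. head E e \<in> T}. edge_set X e)"
    if "v \<in> verts E" "finite {e \<in> out_arcs E v. head E e \<in> T}" for v
    using that by (intro gap_branching) auto
  show ?thesis unfolding defects_def s k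
  proof (intro Collect_cong conj_cong refl)
    fix v assume "v \<in> T" "finite {e \<in> out_arcs E v. head E e \<in> T}"
    moreover from this have "v \<in> verts E" by (simp add: T_def)
    ultimately show "gap E {e \<in> out_arcs E v. head E e \<in> T} v \<notin> (branching_kernel :: ('v, 'e, 'k) free_elem set) \<longleftrightarrow>
      \<not> vertex_set X v \<subseteq> (\<Union>e\<in>{e \<in> out_arcs E v. head E e \<in> T}. edge_set X e)"
      by (simp only: g not_False_eq_True)
  qed
qed

fun weight :: "('v, 'e) generator \<Rightarrow> int" where
  "weight (Vertex v) = 0" | "weight (Edge e) = 1" | "weight (Ghost e) = -1"

lemma word_act_degree:
  assumes deg: "\<And>e x. \<lbrakk>e \<in> arcs E; x \<in> vertex_set X (head E e)\<rbrakk> \<Longrightarrow> deg (edge_map X e x) = deg x + (1::int)"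
    and "w \<in> lists (generators E)" "word_act E X w x = Some y"
  shows "deg y = deg x + sum_list (map weight w)"
  using assms(2,3)
proof (induction w arbitrary: y rule: list.induct)
  case (Cons g w)
  then obtain z where z: "word_act E X w x = Some z" "generator_act E X g z = Some y"
    by (auto simp: Option.bind_eq_Some_conv)
  have "g \<in> generators E" "w \<in> lists (generators E)" using Cons.prems by auto
  then have "deg z = deg x + sum_list (map weight w)" using Cons.IH z by blast
  moreover have "deg y = deg z + weight g"
  proof (cases g)
    case (Ghost e)
    then have e: "e \<in> arcs E" "z \<in> edge_set X e" "y = inv_into (vertex_set X (head E e)) (edge_map X e) z"
      using \<open>g \<in> generators E\<close> z(2) by (auto split: if_splits)
    then show ?thesis using deg[OF e(1) edge_map_in(2)[OF e(1,2)]] edge_map_in(4)[OF e(1,2)] Ghost by simp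
  qed (use z(2) deg \<open>g \<in> generators E\<close> in \<open>auto split: if_splits\<close>)
  ultimately show ?case by simp
qed auto

text \<open>A degree that every edge raises by one grades the module. Homogeneous elements of
  different degrees move a point to points of different degrees, so their effects cannot
  cancel.\<close>

lemma graded_kernel_branching:
  assumes deg: "\<And>e x. \<lbrakk>e \<in> arcs E; x \<in> vertex_set X (head E e)\<rbrakk> \<Longrightarrow> deg (edge_map X e x) = deg x + (1::int)"
  shows "leavitt_kernel.graded_kernel E (branching_kernel :: ('v, 'e, 'k::field) free_elem set)"
proof -
  interpret leavitt_kernel E "branching_kernel :: ('v, 'e, 'k) free_elem set"
    by (rule leavitt_module.leavitt_kernel_ann_kernel[OF branching_leavitt_module])
  have hom: "Poly_Mapping.keys (free_act E X a (single x (c::'k))) \<subseteq> {y. deg y = deg x + n}"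
    if "homogeneous n a" for n a x c
  proof -
    have "Poly_Mapping.keys a \<subseteq> nf_words n" using that by (simp add: homogeneous_def)
    then show ?thesis
    proof (induction a rule: poly_mapping_single_induct_keys)
      case zero
      show ?case by simp
    next
      case (single w d)
      then obtain p u q where "w = nf p u q" "int (length p) - int (length q) = n" by (auto simp: nf_words_def)
      then have wt: "sum_list (map weight w) = n"
        by (simp add: nf_def comp_def sum_list_triv flip: rev_map)
      have "w \<in> lists (generators E)" using nf_words_generators[OF single] by blast
      then have "deg y = deg x + n" if "word_act E X w x = Some y" for y
        using word_act_degree[where deg = deg, OF deg] that wt by blast
      then show ?case by (simp add: free_act_single basis_act_def split: option.split)
    next
      case (add a b)
      then show ?case
        using Poly_Mapping.keys_add[of "free_act E X a (single x c)" "free_act E X b (single x c)"]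
        by (simp add: free_act_add_left) blast
    qed
  qed
  show ?thesis unfolding graded_kernel_def
  proof (intro allI impI ballI)
    fix N n and h :: "int \<Rightarrow> ('v, 'e, 'k) free_elem"
    assume h: "finite N \<and> (\<forall>n. homogeneous n (h n)) \<and> (\<Sum>n\<in>N. h n) \<in> branching_kernel" and n: "n \<in> N"
    have "free_act E X (h n) (single x (c::'k)) = 0" if x: "x \<in> points X" for x c
    proof (rule poly_mapping_eqI)
      fix y
      let ?f = "\<lambda>n. Poly_Mapping.lookup (free_act E X (h n) (single x c)) y"
      have zero: "?f m = 0" if "deg y \<noteq> deg x + m" for m
        using hom[of m "h m" x c] h that by (auto simp: in_keys_iff)
      have "free_act E X (\<Sum>n\<in>N. h n) (single x c) = 0"
        using h x by (simp add: ann_kernel_branching_iff)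
      then have "(\<Sum>m\<in>N. ?f m) = 0" by (metis free_act_sum_left lookup_sum lookup_zero)
      moreover have "(\<Sum>m\<in>N. ?f m) = (\<Sum>m\<in>N. if m = n then ?f n else 0)" if "deg y = deg x + n"
        using zero that by (intro sum.cong) auto
      ultimately have "?f n = 0" using zero[of n] h n by (cases "deg y = deg x + n") simp_all
      then show "?f n = Poly_Mapping.lookup 0 y" by simp
    qed
    moreover have "h n \<in> free_plus E" using h homogeneous_free_plus[of n "h n"] by blast
    ultimately show "h n \<in> branching_kernel" by (simp add: ann_kernel_branching_iff)
  qed
qed

end

section \<open>The invariants of the modules\<close>

context wf_digraph begin

lemma root_set_iff: "u \<in> root_set G V \<longleftrightarrow> (\<exists>v\<in>V. u \<rightarrow>\<^sup>* v)"
  using reachable_in_verts(1) by (auto simp: root_set_def)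

lemma root_set_upward: "\<lbrakk>u \<rightarrow>\<^sup>* w; w \<in> root_set G V\<rbrakk> \<Longrightarrow> u \<in> root_set G V"
  unfolding root_set_iff using reachable_trans by blast

lemma edge_reachable: "e \<in> arcs G \<Longrightarrow> tail G e \<rightarrow>\<^sup>* head G e"
  by (intro reachable_adjI) (auto simp: arcs_ends_conv)

lemma infinite_path_reachable:
  assumes "infinite_path G \<alpha>" "i \<le> j"
  shows "tail G (\<alpha> i) \<rightarrow>\<^sup>* tail G (\<alpha> j)"
  using assms(2)
proof (induction j rule: dec_induct)
  case base
  then show ?case using assms(1) by (auto simp: infinite_path_def)
next
  case (step n)
  have "tail G (\<alpha> n) \<rightarrow>\<^sup>* tail G (\<alpha> (Suc n))"
    using edge_reachable[of "\<alpha> n"] assms(1) by (simp add: infinite_path_def)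
  then show ?case using step.IH reachable_trans by blast
qed

text \<open>Supplies a point of \<open>X_u\<close> for every vertex \<open>u\<close> above the
  path.\<close>

lemma infinite_path_append:
  assumes "infinite_path G \<alpha>" "awalk u p (tail G (\<alpha> n))"
  shows "\<exists>\<beta>. infinite_path G \<beta> \<and> tail_equivalent \<alpha> \<beta> \<and> tail G (\<beta> 0) = u"
  using assms(2)
proof (induction p arbitrary: u)
  case Nil
  have "tail_equivalent \<alpha> (\<lambda>k. \<alpha> (n + k))"
    unfolding tail_equivalent_def by (intro exI[of _ n] exI[of _ 0]) simp
  then show ?case using assms(1) Nil
    by (intro exI[of _ "\<lambda>k. \<alpha> (n + k)"]) (auto simp: awalk_Nil_iff infinite_path_def)
next
  case (Cons e p)
  then have e: "e \<in> arcs G" "tail G e = u" "awalk (head G e) p (tail G (\<alpha> n))" by (auto simp: awalk_Cons_iff)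
  from Cons.IH[OF e(3)] obtain \<beta> where \<beta>: "infinite_path G \<beta>" "tail_equivalent \<alpha> \<beta>" "tail G (\<beta> 0) = head G e" by blast
  obtain m k where mk: "\<forall>j. \<alpha> (m + j) = \<beta> (k + j)" using \<beta>(2) by (auto simp: tail_equivalent_def)
  have "infinite_path G (case_nat e \<beta>)" using \<beta> e by (auto simp: infinite_path_def split: nat.split)
  moreover have "\<forall>j. \<alpha> (m + j) = case_nat e \<beta> (Suc k + j)" using mk by simp
  then have "tail_equivalent \<alpha> (case_nat e \<beta>)" unfolding tail_equivalent_def by blast
  ultimately show ?case using e by (intro exI[of _ "case_nat e \<beta>"]) auto
qed

lemma tail_equivalent_root:
  assumes "infinite_path G \<alpha>" "infinite_path G \<beta>" "tail_equivalent \<alpha> \<beta>"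
  shows "tail G (\<beta> 0) \<in> root_set G (infinite_path_verts G \<alpha>)"
proof -
  from assms(3) obtain m n where mn: "\<forall>k. \<alpha> (m + k) = \<beta> (n + k)" by (auto simp: tail_equivalent_def)
  then have "\<alpha> m = \<beta> n" by (metis add.right_neutral)
  then have "tail G (\<beta> 0) \<rightarrow>\<^sup>* tail G (\<alpha> m)" using infinite_path_reachable[OF assms(2), of 0 n] by simp
  then show ?thesis unfolding root_set_iff infinite_path_verts_def by blast
qed

text \<open>Deleting the first edge of a point gives another point, so first edges end in the
  support. Hence each \<open>X_v\<close> is covered by edges into the support and every gap element
  acts as 0.\<close>

lemma V_support:
  assumes "infinite_path G \<alpha>"
  shows "support G (ann_kernel G (V_module G \<alpha>) :: ('a, 'b, 'k::field) free_elem set) = root_set G (infinite_path_verts G \<alpha>)"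
    and "defects G (ann_kernel G (V_module G \<alpha>) :: ('a, 'b, 'k) free_elem set) = {}"
proof -
  interpret B: branching_system G "infinite_path_branching G \<alpha>"
    by (rule infinite_path_branching_system[OF wf_digraph_axioms])
  let ?X = "infinite_path_branching G \<alpha>" and ?T = "root_set G (infinite_path_verts G \<alpha>)"
  have vs: "vertex_set ?X v = {\<beta>. infinite_path G \<beta> \<and> tail_equivalent \<alpha> \<beta> \<and> tail G (\<beta> 0) = v}"
    and es: "edge_set ?X e = {\<beta>. infinite_path G \<beta> \<and> tail_equivalent \<alpha> \<beta> \<and> \<beta> 0 = e}" for v e
    by (auto simp: infinite_path_branching_def Let_def)
  have T: "{v \<in> verts G. vertex_set ?X v \<noteq> {}} = ?T"
  proof (intro subset_antisym subsetI)
    fix v assume "v \<in> {v \<in> verts G. vertex_set ?X v \<noteq> {}}"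
    then show "v \<in> ?T" using tail_equivalent_root[OF assms] unfolding vs by blast
  next
    fix v assume v: "v \<in> ?T"
    then obtain n where "v \<rightarrow>\<^sup>* tail G (\<alpha> n)" by (auto simp: root_set_iff infinite_path_verts_def)
    then obtain p where "awalk v p (tail G (\<alpha> n))" unfolding reachable_awalk by blast
    from infinite_path_append[OF assms this] show "v \<in> {v \<in> verts G. vertex_set ?X v \<noteq> {}}"
      using v unfolding vs root_set_def by blast
  qed
  show "support G (ann_kernel G (V_module G \<alpha>) :: ('a, 'b, 'k) free_elem set) = ?T"
    unfolding V_module_def B.support_branching T ..
  have "vertex_set ?X v \<subseteq> (\<Union>e\<in>{e \<in> out_arcs G v. head G e \<in> ?T}. edge_set ?X e)" for v
  proof
    fix \<beta> assume "\<beta> \<in> vertex_set ?X v"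
    then have \<beta>: "infinite_path G \<beta>" "tail_equivalent \<alpha> \<beta>" "tail G (\<beta> 0) = v" by (auto simp: vs)
    have "infinite_path G (\<lambda>n. \<beta> (Suc n))" using \<beta>(1) by (auto simp: infinite_path_def)
    moreover have "tail_equivalent \<alpha> (\<lambda>n. \<beta> (Suc n))"
    proof -
      from \<beta>(2) obtain m n where *: "\<forall>k. \<alpha> (m + k) = \<beta> (n + k)" by (auto simp: tail_equivalent_def)
      have "\<alpha> (Suc m + k) = \<beta> (Suc (n + k))" for k using *[rule_format, of "Suc k"] by simp
      then show ?thesis unfolding tail_equivalent_def by blast
    qed
    ultimately have "tail G (\<beta> (Suc 0)) \<in> ?T" using tail_equivalent_root[OF assms] by blast
    then have "\<beta> 0 \<in> {e \<in> out_arcs G v. head G e \<in> ?T}" using \<beta> by (auto simp: infinite_path_def)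
    then show "\<beta> \<in> (\<Union>e\<in>{e \<in> out_arcs G v. head G e \<in> ?T}. edge_set ?X e)" using \<beta> unfolding es by blast
  qed
  then show "defects G (ann_kernel G (V_module G \<alpha>) :: ('a, 'b, 'k) free_elem set) = {}"
    unfolding V_module_def B.defects_branching T by blast
qed

text \<open>For a path that is not eventually periodic, the shift between tail equivalent paths is unique and yields a grading.\<close>

lemma V_graded:
  assumes "infinite_path G \<alpha>" and aper: "\<And>N L. L > 0 \<Longrightarrow> \<exists>n\<ge>N. \<alpha> (n + L) \<noteq> \<alpha> n"
  shows "leavitt_kernel.graded_kernel G (ann_kernel G (V_module G \<alpha>) :: ('a, 'b, 'k::field) free_elem set)"
proof -
  interpret B: branching_system G "infinite_path_branching G \<alpha>"
    by (rule infinite_path_branching_system[OF wf_digraph_axioms])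
  \<comment> \<open>Two different shifts \<open>n - m\<close> and \<open>n' - m'\<close> would make
    \<alpha> eventually periodic with their difference as period. The index \<open>j\<close> is
    taken so large that no subtraction is truncated.\<close>
  have no: False if 1: "\<forall>k. \<alpha> (m + k) = \<beta> (n + k)" and 2: "\<forall>k. \<alpha> (m' + k) = \<beta> (n' + k)" and 3: "n + m' < n' + m" for m n m' n' \<beta>
  proof -
    obtain j where j: "j \<ge> m + m' + n + n'" "\<alpha> (j + (n' + m - (n + m'))) \<noteq> \<alpha> j"
      using aper[of "n' + m - (n + m')" "m + m' + n + n'"] 3 by auto
    have "\<alpha> j = \<beta> (n' + (j - m'))" using 2[rule_format, of "j - m'"] j(1) by simp
    also have "n' + (j - m') = n + (j + n' - m' - n)" using j(1) by simp
    also have "\<beta> \<dots> = \<alpha> (m + (j + n' - m' - n))" using 1 by simp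
    also have "m + (j + n' - m' - n) = j + (n' + m - (n + m'))" using j(1) 3 by simp
    finally show False using j(2) by simp
  qed
  define deg where "deg \<beta> = (THE d. \<exists>m n. (\<forall>k. \<alpha> (m + k) = \<beta> (n + k)) \<and> d = int n - int m)" for \<beta> :: "nat \<Rightarrow> 'b"
  have deg: "deg \<beta> = int n - int m" if "\<forall>k. \<alpha> (m + k) = \<beta> (n + k)" for \<beta> m n
    unfolding deg_def
  proof (rule the_equality)
    fix d assume "\<exists>m n. (\<forall>k. \<alpha> (m + k) = \<beta> (n + k)) \<and> d = int n - int m"
    then obtain m' n' where mn: "\<forall>k. \<alpha> (m' + k) = \<beta> (n' + k)" "d = int n' - int m'" by blast
    have "\<not> n + m' < n' + m" "\<not> n' + m < n + m'" using no[OF mn(1) that] no[OF that mn(1)] by blast+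
    then show "d = int n - int m" using mn(2) by linarith
  qed (use that in blast)
  show ?thesis unfolding V_module_def
  proof (rule B.graded_kernel_branching)
    fix e \<beta> assume "\<beta> \<in> vertex_set (infinite_path_branching G \<alpha>) (head G e)"
    then obtain m n where mn: "\<forall>k. \<alpha> (m + k) = \<beta> (n + k)"
      by (auto simp: infinite_path_branching_def Let_def tail_equivalent_def)
    then have "\<forall>k. \<alpha> (m + k) = case_nat e \<beta> (Suc n + k)" by simp
    from deg[OF this] deg[OF mn] show "deg (edge_map (infinite_path_branching G \<alpha>) e \<beta>) = deg \<beta> + 1"
      by (simp add: infinite_path_branching_def Let_def)
  qed
qed

section \<open>Paths that end at a sink or an infinite emitter\<close>

lemma path_branching_sets:
  "vertex_set (path_branching G v) w = {(w, p) | p. awalk w p v}"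
  "edge_set (path_branching G v) e = {(u, e # p) | u p. awalk u (e # p) v}"
proof -
  have p: "is_path G (u, p) \<and> path_range G (u, p) = v \<longleftrightarrow> awalk u p v" for u p
    by (auto simp: is_path_def path_range_def)
  show "vertex_set (path_branching G v) w = {(w, p) | p. awalk w p v}"
    unfolding path_branching_def Let_def using p by force
  show "edge_set (path_branching G v) e = {(u, e # p) | u p. awalk u (e # p) v}"
    unfolding path_branching_def Let_def using p by (force simp: neq_Nil_conv)
qed

lemma returning_edges_eq: "returning_edges G v = {e \<in> out_arcs G v. head G e \<in> root_set G {v}}"
  by (simp add: returning_edges_def)

text \<open>The trivial path at \<open>v\<close> is the only point without a first edge, so only the
  gap element of \<open>v\<close> can act nontrivially. A sink is not an infinite emitter and thus
  gives no defect.\<close>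

lemma N_support:
  assumes "sink G v \<or> infinite_emitter G v"
  shows "support G (ann_kernel G (N_module G v) :: ('a, 'b, 'k::field) free_elem set) = root_set G {v}"
    and "defects G (ann_kernel G (N_module G v) :: ('a, 'b, 'k) free_elem set) =
      (if infinite_emitter G v \<and> finite (returning_edges G v) then {v} else {})"
    and "leavitt_kernel.graded_kernel G (ann_kernel G (N_module G v) :: ('a, 'b, 'k) free_elem set)"
proof -
  interpret B: branching_system G "path_branching G v"
    by (rule path_branching_system[OF wf_digraph_axioms assms])
  let ?X = "path_branching G v" and ?T = "root_set G {v}"
  have v: "v \<in> verts G" using assms by (auto simp: sink_def infinite_emitter_def)
  have T: "{w \<in> verts G. vertex_set ?X w \<noteq> {}} = ?T"
    unfolding path_branching_sets root_set_def reachable_awalk by blast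
  show "support G (ann_kernel G (N_module G v) :: ('a, 'b, 'k) free_elem set) = ?T"
    unfolding N_module_def B.support_branching T ..
  have "vertex_set ?X w \<subseteq> (\<Union>e\<in>{e \<in> out_arcs G w. head G e \<in> ?T}. edge_set ?X e)" if wv: "w \<noteq> v" for w
  proof
    fix x assume "x \<in> vertex_set ?X w"
    then obtain p where p: "x = (w, p)" "awalk w p v" by (auto simp: path_branching_sets)
    then obtain e q where e: "p = e # q" using wv by (cases p) (auto simp: awalk_Nil_iff)
    then have "e \<in> arcs G" "tail G e = w" "awalk (head G e) q v" using p by (auto simp: awalk_Cons_iff)
    then have "e \<in> {e \<in> out_arcs G w. head G e \<in> ?T}" by (auto simp: root_set_iff intro: reachable_awalkI)
    moreover have "x \<in> edge_set ?X e" using p e by (auto simp: path_branching_sets)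
    ultimately show "x \<in> (\<Union>e\<in>{e \<in> out_arcs G w. head G e \<in> ?T}. edge_set ?X e)" by blast
  qed
  moreover have "\<not> vertex_set ?X v \<subseteq> (\<Union>e\<in>H. edge_set ?X e)" for H
  proof -
    have "(v, []) \<in> vertex_set ?X v" using v by (auto simp: path_branching_sets awalk_Nil_iff)
    moreover have "(v, []) \<notin> edge_set ?X e" for e by (auto simp: path_branching_sets)
    ultimately show ?thesis by blast
  qed
  moreover have "v \<in> ?T" using v by (simp add: root_set_iff)
  moreover have "{w \<in> T. P w \<and> Q w \<and> \<not> S w} = (if P v \<and> Q v then {v} else {})"
    if "\<And>w. w \<noteq> v \<Longrightarrow> S w" "\<not> S v" "v \<in> T" for T and P Q S :: "'a \<Rightarrow> bool"
  proof -
    have "S w \<longleftrightarrow> w \<noteq> v" for w using that(1,2) by blast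
    then show ?thesis using that(3) by auto
  qed
  ultimately show "defects G (ann_kernel G (N_module G v) :: ('a, 'b, 'k) free_elem set) =
      (if infinite_emitter G v \<and> finite (returning_edges G v) then {v} else {})"
    unfolding N_module_def B.defects_branching T returning_edges_eq by presburger
  show "leavitt_kernel.graded_kernel G (ann_kernel G (N_module G v) :: ('a, 'b, 'k) free_elem set)"
    unfolding N_module_def
    by (rule B.graded_kernel_branching[where deg = "\<lambda>p. int (length (snd p))"])
      (simp add: path_branching_def Let_def)
qed

text \<open>A returning edge at a vertex of \<open>c\<close> closes up to a cycle through that
  vertex, which exclusiveness identifies with \<open>c\<close>.\<close>

lemma exclusive_cycle_edge:
  assumes "exclusive_cycle G c" "e \<in> arcs G" "tail G e \<in> cycle_verts G c" "head G e \<rightarrow>\<^sup>* tail G e"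
  shows "e \<in> set c"
proof -
  from assms(4) obtain p where p: "apath (head G e) p (tail G e)" by (auto simp: reachable_apath)
  then have "cycle (e # p)"
    using assms(2) by (auto simp: cycle_def awalk_Cons_iff apath_def)
  moreover have "tail G e \<in> cycle_verts G (e # p)" by (simp add: cycle_verts_def)
  ultimately have "same_cycle c (e # p)"
    using assms(1,3) unfolding exclusive_cycle_def by blast
  then show ?thesis by (metis list.set_intros(1) same_cycle_def set_rotate)
qed

lemma cycle_walk:
  assumes "cycle c" "x \<in> cycle_verts G c" "y \<in> cycle_verts G c"
  shows "x \<rightarrow>\<^sup>* y"
proof -
  obtain u where u: "awalk u c u" using assms(1) by (auto simp: cycle_def)
  have sub: "z \<in> set (awalk_verts u c)" if "z \<in> cycle_verts G c" for z
    using that awalk_verts_arc1[of _ c u] by (auto simp: cycle_verts_def)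
  show ?thesis
    by (rule reachable_trans[OF awalk_verts_reachable_to[OF u sub[OF assms(2)]]
          awalk_verts_reachable_from[OF u sub[OF assms(3)]]])
qed

lemma cycle_head:
  assumes "cycle c" "e \<in> set c"
  shows "head G e \<in> cycle_verts G c"
proof -
  obtain u where u: "awalk u c u" using assms(1) by (auto simp: cycle_def)
  obtain a b where ab: "c = a @ e # b" using assms(2) by (meson split_list)
  have "awalk (head G e) (b @ a) (tail G e)"
    using u unfolding ab by (auto simp: awalk_Cons_iff)
  moreover have "f \<in> set c" if "b @ a = f # r" for f r
    using arg_cong[OF that, of set] ab by auto
  ultimately show ?thesis using assms(2)
    by (cases "b @ a") (auto simp: awalk_Nil_iff awalk_Cons_iff cycle_verts_def)
qed

lemma cycle_verts_verts:
  assumes "cycle c"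
  shows "cycle_verts G c \<subseteq> verts G"
proof
  fix x assume "x \<in> cycle_verts G c"
  then obtain u e where "awalk u c u" "e \<in> set c" "x = tail G e" using assms unfolding cycle_def cycle_verts_def by blast
  then show "x \<in> verts G" using awalk_arcs tail_in_verts by blast
qed

text \<open>In contrast to paths that end at a vertex, a reduced word with trivial \<open>p\<close>
  still lies in some \<open>X_e\<close>: it is the reduction of \<open>e (q e)^*\<close> for the
  cycle edge \<open>e\<close> at its source. This excludes defects.\<close>

lemma N_cycle_support:
  assumes c: "exclusive_cycle G c" and v: "v \<in> cycle_verts G c"
  shows "support G (ann_kernel G (N_cycle_module G c v) :: ('a, 'b, 'k::field) free_elem set) = root_set G {v}"
    and "defects G (ann_kernel G (N_cycle_module G c v) :: ('a, 'b, 'k) free_elem set) = {}"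
    and "leavitt_kernel.graded_kernel G (ann_kernel G (N_cycle_module G c v) :: ('a, 'b, 'k) free_elem set)"
proof -
  let ?X = "cycle_branching G c v" and ?T = "root_set G {v}" and ?C = "cycle_verts G c"
  interpret B: branching_system G ?X
    by (rule cycle_branching_system[OF wf_digraph_axioms c v])
  have cyc: "cycle c" using c by (simp add: exclusive_cycle_def)
  have vV: "v \<in> verts G" using cycle_verts_verts[OF cyc] v by blast
  have words: "((x, p), (y, q)) \<in> cycle_words G c v \<longleftrightarrow> y = v \<and> (\<exists>w\<in>?C. awalk x p w \<and> awalk v q w)" for x p y q
    by (auto simp: cycle_words_def is_path_def path_range_def)
  have vset: "vertex_set ?X w = {((w, p), s) | p s. ((w, p), s) \<in> cycle_words G c v \<and> reduced ((w, p), s)}" for w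
    by (auto simp: cycle_branching_def Let_def)
  have T: "{w \<in> verts G. vertex_set ?X w \<noteq> {}} = ?T"
  proof (intro subset_antisym subsetI)
    fix w assume "w \<in> {w \<in> verts G. vertex_set ?X w \<noteq> {}}"
    then obtain p s where "((w, p), s) \<in> cycle_words G c v" unfolding vset by blast
    then obtain y q where "((w, p), (y, q)) \<in> cycle_words G c v" by (cases s) blast
    then obtain u where "u \<in> ?C" "awalk w p u" unfolding words by blast
    then have "w \<rightarrow>\<^sup>* v" using cycle_walk[OF cyc _ v] reachable_trans reachable_awalkI by blast
    then show "w \<in> ?T" by (simp add: root_set_iff)
  next
    fix w assume w: "w \<in> ?T"
    then obtain p where "awalk w p v" by (auto simp: root_set_iff reachable_awalk)
    then have "((w, p), (v, [])) \<in> cycle_words G c v" using v vV by (auto simp: words awalk_Nil_iff)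
    then have "((w, p), (v, [])) \<in> vertex_set ?X w" unfolding vset by (auto simp: reduced_def)
    then show "w \<in> {w \<in> verts G. vertex_set ?X w \<noteq> {}}" using w by (auto simp: root_set_def)
  qed
  show "support G (ann_kernel G (N_cycle_module G c v) :: ('a, 'b, 'k) free_elem set) = ?T"
    unfolding N_cycle_module_def B.support_branching T ..
  have CT: "u \<in> ?T" if "u \<in> ?C" for u using cycle_walk[OF cyc that v] by (simp add: root_set_iff)
  have "vertex_set ?X w \<subseteq> (\<Union>e\<in>{e \<in> out_arcs G w. head G e \<in> ?T}. edge_set ?X e)" for w
  proof
    fix x assume "x \<in> vertex_set ?X w"
    then obtain p s where "x = ((w, p), s)" "((w, p), s) \<in> cycle_words G c v" "reduced x"
      unfolding vset by blast
    moreover from this obtain q where "s = (v, q)" using words by (cases s) blast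
    ultimately have x: "x = ((w, p), (v, q))" "((w, p), (v, q)) \<in> cycle_words G c v" "reduced x" by blast+
    obtain u where u: "u \<in> ?C" "awalk w p u" "awalk v q u" using x words by blast
    have mem: "z \<in> edge_set ?X e" if "z = red ((tail G e, e # r), s)" "((tail G e, e # r), s) \<in> cycle_words G c v" for z e r s
      using that by (cases s) (auto simp: cycle_branching_def Let_def)
    show "x \<in> (\<Union>e\<in>{e \<in> out_arcs G w. head G e \<in> ?T}. edge_set ?X e)"
    proof (cases p)
      case (Cons e r)
      then have e: "e \<in> arcs G" "tail G e = w" "awalk (head G e) r u" using u by (auto simp: awalk_Cons_iff)
      have "x \<in> edge_set ?X e" using x Cons e by (intro mem[of x e r "(v, q)"]) (auto simp: red_reduced)
      moreover have "head G e \<in> ?T" using e u CT root_set_upward reachable_awalkI by blast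
      ultimately show ?thesis using e by auto
    next
      case Nil
      then have w: "w = u" using u by (auto simp: awalk_Nil_iff)
      then obtain e where e: "e \<in> set c" "tail G e = w" using u(1) by (auto simp: cycle_verts_def)
      then have ea: "e \<in> arcs G" using cyc by (auto simp: cycle_def)
      have h: "head G e \<in> ?C" using cycle_head[OF cyc e(1)] .
      have "awalk v (q @ [e]) (head G e)" "awalk w [e] (head G e)"
        using w e ea u by (auto simp: awalk_Cons_iff awalk_Nil_iff)
      then have "((tail G e, e # []), (v, q @ [e])) \<in> cycle_words G c v" using h e by (auto simp: words)
      moreover have "x = red ((tail G e, e # []), (v, q @ [e]))"
        using red_append[of w "[]" "[e]" v q] x(3) x(1) Nil e by (simp add: red_reduced)
      ultimately have "x \<in> edge_set ?X e" by (intro mem)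
      then show ?thesis using e ea CT[OF h] by auto
    qed
  qed
  then show "defects G (ann_kernel G (N_cycle_module G c v) :: ('a, 'b, 'k) free_elem set) = {}"
    unfolding N_cycle_module_def B.defects_branching T by blast
  \<comment> \<open>Reduction removes a common suffix, so the difference of the lengths survives it
    and can serve as degree.\<close>
  let ?deg = "\<lambda>x::('a, 'b) path \<times> ('a, 'b) path. int (length (snd (fst x))) - int (length (snd (snd x)))"
  have red: "?deg (red x) = ?deg x" for x
  proof -
    obtain a p b q where x: "x = ((a, p), (b, q))" by (metis surj_pair)
    obtain p' q' s where "p = p' @ s" "q = q' @ s" "red ((a, p), (b, q)) = ((a, p'), (b, q'))"
      using red_decomp[of p q a b] by blast
    then show ?thesis by (simp add: x)
  qed
  show "leavitt_kernel.graded_kernel G (ann_kernel G (N_cycle_module G c v) :: ('a, 'b, 'k) free_elem set)"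
    unfolding N_cycle_module_def
  proof (rule B.graded_kernel_branching[where deg = ?deg])
    fix e and x :: "('a, 'b) path \<times> ('a, 'b) path"
    obtain a p t where x: "x = ((a, p), t)" by (metis surj_pair)
    have "edge_map ?X e x = red ((tail G e, e # p), t)"
      by (simp add: cycle_branching_def Let_def x)
    then show "?deg (edge_map ?X e x) = ?deg x + 1" unfolding red by (simp only: red) (simp add: x)
  qed
qed

end

section \<open>Graded simple modules\<close>

context wf_digraph begin

text \<open>Links the words of \<open>leavitt_component\<close>, which have no vertex between two
  nontrivial paths, with the normal forms, which always have one.\<close>

lemma nf_path_word_cong:
  assumes "awalk u p w" "awalk u' q w"
  shows "lcong G (single (path_word (u, p) @ ghost_word (u', q)) (c :: 'k::field)) (single (nf p w q) c)"
proof (cases "p = []")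
  case True
  then have u: "u = w" "w \<in> verts G" using assms by (auto simp: awalk_Nil_iff)
  show ?thesis
  proof (cases "q = []")
    case True
    then have "u' = w" using assms by (auto simp: awalk_Nil_iff)
    then show ?thesis using lcong_scale[OF vertex_vertex_cong[OF u(2)], of c] True \<open>p = []\<close> u
      by (simp add: path_word_def ghost_word_def nf_def)
  next
    case False
    then show ?thesis using \<open>p = []\<close> u by (simp add: path_word_def ghost_word_def nf_def rev_map)
  qed
next
  case p: False
  show ?thesis
  proof (cases "q = []")
    case True
    then have "u' = w" using assms by (auto simp: awalk_Nil_iff)
    then show ?thesis using True p by (simp add: path_word_def ghost_word_def nf_def)
  next
    case False
    obtain r e where re: "p = r @ [e]" using p by (metis rev_exhaust)
    then have e: "e \<in> arcs G" "head G e = w" "awalk u r (tail G e)"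
      using assms(1) by (auto simp: awalk_Cons_iff awalk_Nil_iff)
    have "map Edge r \<in> lists (generators G)" using awalk_arcs[OF e(3)] by (auto simp: subset_iff)
    moreover have "rev (map Ghost q) \<in> lists (generators G)" using awalk_arcs[OF assms(2)] by (auto simp: subset_iff)
    ultimately have "lcong G (single (map Edge r @ [Edge e] @ rev (map Ghost q)) c)
        (single (map Edge r @ [Edge e, Vertex (head G e)] @ rev (map Ghost q)) c)"
      by (intro lcong_context lcong_sym[OF edge_range_cong] e)
    then show ?thesis using False p re e by (simp add: path_word_def ghost_word_def nf_def)
  qed
qed

lemma homogeneous_component:
  assumes "homogeneous n (a :: ('a, 'b, 'k::field) free_elem)"
  shows "leavitt_class G a \<in> leavitt_component G n"
proof -
  let ?W = "{path_word p @ ghost_word q | p q. is_path G p \<and> is_path G q \<and>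
        int (length (snd p)) - int (length (snd q)) = n} :: ('a, 'b) generator list set"
  have "Poly_Mapping.keys a \<subseteq> nf_words n" using assms by (simp add: homogeneous_def)
  then have "\<exists>b. Poly_Mapping.keys b \<subseteq> ?W \<and> lcong G b a"
  proof (induction a rule: poly_mapping_single_induct_keys)
    case zero
    show ?case by (intro exI[of _ 0]) simp
  next
    case (single x c)
    then obtain p w q u u' where x: "x = nf p w q" "awalk u p w" "awalk u' q w" "int (length p) - int (length q) = n"
      unfolding nf_words_def by blast
    then have "path_word (u, p) @ ghost_word (u', q) \<in> ?W"
      by (intro CollectI exI[of _ "(u, p)"] exI[of _ "(u', q)"]) (auto simp: is_path_def)
    then show ?case using nf_path_word_cong[OF x(2,3), of c] x(1)
      by (intro exI[of _ "single (path_word (u, p) @ ghost_word (u', q)) c"]) simp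
  next
    case (add a b)
    then obtain a' b' where "Poly_Mapping.keys a' \<subseteq> ?W" "lcong G a' a" "Poly_Mapping.keys b' \<subseteq> ?W" "lcong G b' b" by blast
    then show ?case using Poly_Mapping.keys_add[of a' b'] lcong_add by (intro exI[of _ "a' + b'"]) blast
  qed
  then obtain b where "Poly_Mapping.keys b \<subseteq> ?W" "lcong G b a" by blast
  then have "leavitt_class G a = leavitt_class G b" "b \<in> {a. Poly_Mapping.keys a \<subseteq> ?W}"
    using leavitt_class_cong[of b a] by blast+
  then show ?thesis unfolding leavitt_component_def by (rule image_eqI)
qed

end

context leavitt_module begin

lemma act_sum:
  assumes "\<And>i. i \<in> S \<Longrightarrow> f i \<in> free_plus G" "finite S" "x \<in> carrier M"
  shows "act (sum f S) x = finsum M (\<lambda>i. act (f i) x) S"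
  using assms(2,1)
proof (induction S rule: finite_induct)
  case empty
  then show ?case using assms(3) by simp
next
  case (insert i S)
  have "act (sum f (insert i S)) x = act (f i) x \<oplus> act (sum f S) x"
    using insert assms(3) by (simp add: act_add free_plus_sum)
  also have "\<dots> = finsum M (\<lambda>i. act (f i) x) (insert i S)"
    using insert assms(3) by (subst finsum_insert) auto
  finally show ?case .
qed

lemma act_finsum:
  assumes "a \<in> free_plus G" "finite S" "\<And>i. i \<in> S \<Longrightarrow> f i \<in> carrier M"
  shows "act a (finsum M f S) = finsum M (\<lambda>i. act a (f i)) S"
  using assms(2,3)
proof (induction S rule: finite_induct)
  case empty
  then show ?case using assms(1) by simp
next
  case (insert i S)
  have "act a (finsum M f (insert i S)) = act a (f i) \<oplus> act a (finsum M f S)"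
    using insert assms(1) by (subst finsum_insert) (auto simp: act_add_right)
  also have "\<dots> = finsum M (\<lambda>i. act a (f i)) (insert i S)"
    using insert assms(1) by (subst finsum_insert) auto
  finally show ?case .
qed

lemma act_uminus:
  assumes "a \<in> free_plus G" "x \<in> carrier M"
  shows "act (- a) x = \<ominus> act a x"
proof -
  have "- a \<in> free_plus G" using free_plus_diff[OF free_plus_zero assms(1)] by simp
  then show ?thesis using act_add[of "- a" a x] assms by (intro minus_equality[symmetric]) auto
qed

end

section \<open>Consequences of graded simplicity\<close>

locale graded_simple_module = leavitt_module G M
  for G :: "('v, 'e) pre_digraph" and M :: "(('v, 'e, 'k::field) free_elem set, 'm, 't) module_scheme" (structure) +
  fixes Mg :: "int \<Rightarrow> 'm set"
  assumes graded_simple: "graded_simple (leavitt_algebra G) (leavitt_component G) M Mg"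
begin

lemma graded_left_module: "graded_left_module (leavitt_algebra G) (leavitt_component G) M Mg"
  using graded_simple by (simp add: graded_simple_def)

lemma component_carrier: "Mg n \<subseteq> carrier M"
  using additive_subgroup.a_subset[OF graded_left_module.component_subgroup[OF graded_left_module]] .

lemma component_carrierD: "x \<in> Mg n \<Longrightarrow> x \<in> carrier M"
  using component_carrier by blast

lemma component_zero: "\<zero> \<in> Mg n"
  using additive_subgroup.zero_closed[OF graded_left_module.component_subgroup[OF graded_left_module]] .

lemma act_component:
  assumes "homogeneous n a" "x \<in> Mg j"
  shows "act a x \<in> Mg (n + j)"
  unfolding act_def
  by (rule graded_left_module.smult_component[OF graded_left_module homogeneous_component[OF assms(1)] assms(2)])

text \<open>\<open>homogeneous_decomposition\<close> sums over the nonzero components only; this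
  allows sums over an arbitrary finite set of degrees.\<close>

lemma component_sum_support:
  assumes "finite N" "\<And>n. n \<in> N \<Longrightarrow> f n \<in> Mg n"
  shows "finsum M (\<lambda>n. if n \<in> N then f n else \<zero>) {n. (if n \<in> N then f n else \<zero>) \<noteq> \<zero>} = finsum M f N"
proof (rule add.finprod_mono_neutral_cong_left)
  show "f \<in> N \<rightarrow> carrier M" using assms component_carrierD by blast
qed (use assms(1) in \<open>auto split: if_splits\<close>)

lemma component_independent:
  assumes "finite N" "\<And>n. n \<in> N \<Longrightarrow> f n \<in> Mg n" "finsum M f N = \<zero>" "n \<in> N"
  shows "f n = \<zero>"
proof -
  let ?f = "\<lambda>n. if n \<in> N then f n else \<zero>"
  have "finite {n. ?f n \<noteq> \<zero>}" by (rule finite_subset[OF _ assms(1)]) (auto split: if_splits)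
  then have "homogeneous_decomposition M Mg \<zero> ?f"
    using component_sum_support[OF assms(1,2)] assms component_zero by (simp add: homogeneous_decomposition_def)
  moreover have "homogeneous_decomposition M Mg \<zero> (\<lambda>_. \<zero>)"
    using component_zero by (simp add: homogeneous_decomposition_def)
  ultimately have "?f = (\<lambda>_. \<zero>)"
    using graded_left_module.direct_sum[OF graded_left_module zero_closed] by blast
  then show ?thesis using assms(4) by meson
qed

lemma component_decomposition:
  assumes "x \<in> carrier M"
  shows "\<exists>N f. finite N \<and> (\<forall>n. f n \<in> Mg n) \<and> x = finsum M f N"
  using graded_left_module.direct_sum[OF graded_left_module assms] unfolding homogeneous_decomposition_def by blast

lemma graded_submodule_trivial:
  assumes "N \<subseteq> carrier M" "\<zero> \<in> N" "\<And>x y. \<lbrakk>x \<in> N; y \<in> N\<rbrakk> \<Longrightarrow> x \<oplus> y \<in> N"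
    "\<And>x. x \<in> N \<Longrightarrow> \<ominus> x \<in> N" "\<And>a x. \<lbrakk>a \<in> free_plus G; x \<in> N\<rbrakk> \<Longrightarrow> act a x \<in> N"
    "\<And>x. x \<in> N \<Longrightarrow> \<exists>S f. finite S \<and> (\<forall>n\<in>S. f n \<in> N \<inter> Mg n) \<and> x = finsum M f S"
  shows "N = {\<zero>} \<or> N = carrier M"
proof -
  have "submodule N (leavitt_algebra G) M"
  proof (intro submodule.intro submodule_axioms.intro)
    show "subgroup N (add_monoid M)"
      by (rule add.subgroupI) (use assms(1-4) in \<open>auto simp: a_inv_def\<close>)
    show "r \<odot>\<^bsub>M\<^esub> x \<in> N" if "r \<in> carrier (leavitt_algebra G)" "x \<in> N" for r x
      using that assms(5) unfolding act_def leavitt_algebra_carrier by blast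
  qed
  moreover have "\<exists>f. homogeneous_decomposition M (\<lambda>n. N \<inter> Mg n) x f" if x: "x \<in> N" for x
  proof -
    obtain S f where f: "finite S" "\<forall>n\<in>S. f n \<in> N \<inter> Mg n" "x = finsum M f S" using assms(6)[OF x] by blast
    let ?f = "\<lambda>n. if n \<in> S then f n else \<zero>"
    have "finite {n. ?f n \<noteq> \<zero>}" by (rule finite_subset[OF _ f(1)]) (auto split: if_splits)
    then have "homogeneous_decomposition M (\<lambda>n. N \<inter> Mg n) x ?f"
      using component_sum_support[of S f] f assms(2) component_zero by (simp add: homogeneous_decomposition_def)
    then show ?thesis by blast
  qed
  ultimately have "graded_submodule (leavitt_algebra G) M Mg N" by (simp add: graded_submodule_def)
  then show ?thesis using graded_simple by (simp add: graded_simple_def)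
qed

lemma act_homogeneous_parts:
  assumes "a \<in> free_plus G" "finite S" "\<And>n. n \<in> S \<Longrightarrow> f n \<in> Mg n" "homogeneous m a"
    "act a (finsum M f S) = \<zero>" "n \<in> S"
  shows "act a (f n) = \<zero>"
proof -
  have fc: "f n \<in> carrier M" if "n \<in> S" for n using assms(3) that component_carrierD by blast
  let ?g = "\<lambda>k. act a (f (k - m))"
  have "finsum M ?g ((\<lambda>n. m + n) ` S) = finsum M (\<lambda>n. ?g (m + n)) S"
    by (rule finsum_reindex) (use fc assms(1) in \<open>auto simp: inj_on_def\<close>)
  also have "\<dots> = \<zero>" using act_finsum[OF assms(1,2) fc] assms(5) by simp
  finally have 0: "finsum M ?g ((\<lambda>n. m + n) ` S) = \<zero>" .
  have "?g (m + n) = \<zero>"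
  proof (rule component_independent[OF _ _ 0])
    fix k assume "k \<in> (\<lambda>n. m + n) ` S"
    then show "?g k \<in> Mg k" using act_component[OF assms(4) assms(3)] by auto
  qed (use assms in auto)
  then show ?thesis by simp
qed

text \<open>The elements killed by the whole algebra form a graded submodule, and it is proper
  because the algebra acts nontrivially.\<close>

lemma unital:
  assumes "x \<in> carrier M" "\<And>a. a \<in> free_plus G \<Longrightarrow> act a x = \<zero>"
  shows "x = \<zero>"
proof -
  let ?Z = "{x \<in> carrier M. \<forall>a\<in>free_plus G. act a x = \<zero>}"
  have "?Z = {\<zero>} \<or> ?Z = carrier M"
  proof (rule graded_submodule_trivial)
    fix x assume x: "x \<in> ?Z"
    have "act a (\<ominus> x) = \<zero>" if a: "a \<in> free_plus G" for a
      using act_add_right[OF a, of x "\<ominus> x"] x a by (simp add: r_neg)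
    then show "\<ominus> x \<in> ?Z" using x by simp
    obtain N f where f: "finite N" "\<forall>n. f n \<in> Mg n" "x = finsum M f N" using component_decomposition x by blast
    have "f n \<in> ?Z" if n: "n \<in> N" for n
    proof -
      have fn: "f n \<in> carrier M" using f component_carrierD by blast
      have "act a (f n) = \<zero>" if a: "a \<in> free_plus G" for a
      proof -
        obtain S h where h: "finite S" "\<forall>n. homogeneous n (h n)" "lcong G a (\<Sum>n\<in>S. h n)"
          using homogeneous_decomposition_ex[OF a] by blast
        have hf: "h m \<in> free_plus G" for m using h homogeneous_free_plus by blast
        have "act (h m) (f n) = \<zero>" for m
          by (rule act_homogeneous_parts[OF hf f(1) _ _ _ n]) (use f h x hf in auto)
        then show ?thesis using act_cong[OF h(3)] act_sum[of S h "f n"] hf h(1) fn by simp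
      qed
      then show ?thesis using fn by simp
    qed
    then show "\<exists>S f. finite S \<and> (\<forall>n\<in>S. f n \<in> ?Z \<inter> Mg n) \<and> x = finsum M f S" using f by blast
  qed (auto simp: act_add_right simp flip: act_mult intro: free_plus_mult)
  moreover have "?Z \<noteq> carrier M"
    using graded_simple unfolding graded_simple_def leavitt_algebra_carrier act_def by blast
  ultimately show ?thesis using assms by blast
qed

text \<open>The multiples of \<open>x\<close> form a submodule, graded since \<open>x\<close> is
  homogeneous and nonzero by \<open>unital\<close>.\<close>

lemma cyclic:
  assumes x: "x \<in> Mg j" "x \<noteq> \<zero>" and y: "y \<in> carrier M"
  shows "\<exists>a\<in>free_plus G. y = act a x"
proof -
  have xc: "x \<in> carrier M" using x component_carrierD by blast
  let ?N = "(\<lambda>a. act a x) ` free_plus G"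
  have "?N = {\<zero>} \<or> ?N = carrier M"
  proof (rule graded_submodule_trivial)
    show "?N \<subseteq> carrier M" using xc by auto
    show "\<zero> \<in> ?N" using xc by (intro image_eqI[of _ _ 0]) auto
    show "y \<oplus> z \<in> ?N" if yz: "y \<in> ?N" "z \<in> ?N" for y z
    proof -
      obtain a b where "a \<in> free_plus G" "b \<in> free_plus G" "y = act a x" "z = act b x" using yz by blast
      then show ?thesis using xc by (intro image_eqI[of _ _ "a + b"]) (auto simp: act_add intro: free_plus_add)
    qed
    show "\<ominus> y \<in> ?N" if y: "y \<in> ?N" for y
    proof -
      obtain a where "a \<in> free_plus G" "y = act a x" using y by blast
      then show ?thesis using xc free_plus_diff[OF free_plus_zero, of a]
        by (intro image_eqI[of _ _ "- a"]) (auto simp: act_uminus)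
    qed
    show "act b y \<in> ?N" if b: "b \<in> free_plus G" and y: "y \<in> ?N" for b y
    proof -
      obtain a where "a \<in> free_plus G" "y = act a x" using y by blast
      then show ?thesis using xc b by (intro image_eqI[of _ _ "b * a"]) (auto simp: act_mult intro: free_plus_mult)
    qed
    show "\<exists>S f. finite S \<and> (\<forall>n\<in>S. f n \<in> ?N \<inter> Mg n) \<and> y = finsum M f S" if y: "y \<in> ?N" for y
    proof -
      obtain a where a: "a \<in> free_plus G" "y = act a x" using y by blast
      obtain S h where h: "finite S" "\<forall>n. homogeneous n (h n)" "lcong G a (\<Sum>n\<in>S. h n)"
        using homogeneous_decomposition_ex[OF a(1)] by blast
      have hf: "h m \<in> free_plus G" for m using h homogeneous_free_plus by blast
      let ?f = "\<lambda>k. act (h (k - j)) x"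
      have "finsum M ?f ((\<lambda>n. n + j) ` S) = finsum M (\<lambda>n. ?f (n + j)) S"
        by (rule finsum_reindex) (use xc hf in \<open>auto simp: inj_on_def\<close>)
      also have "\<dots> = y" using act_cong[OF h(3)] act_sum[of S h x] hf h(1) xc a by simp
      finally have "y = finsum M ?f ((\<lambda>n. n + j) ` S)" by simp
      moreover have "?f k \<in> ?N \<inter> Mg k" for k
        using act_component[of "k - j" "h (k - j)" x j] h x hf by auto
      ultimately show ?thesis using h(1)
        by (intro exI[of _ "(\<lambda>n. n + j) ` S"] exI[of _ ?f]) (intro conjI ballI finite_imageI)
    qed
  qed
  moreover have "?N \<noteq> {\<zero>}" using unital[OF xc] x(2) by blast
  ultimately show ?thesis using y by blast
qed

abbreviation kernel :: "('v, 'e, 'k) free_elem set" where "kernel \<equiv> ann_kernel G M"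

sublocale K: leavitt_kernel G kernel
  by (rule leavitt_kernel_ann_kernel)

text \<open>On a homogeneous element of \<open>M\<close> the summands \<open>h n\<close> produce
  components of different degrees, which vanish separately.\<close>

lemma graded_kernel: "K.graded_kernel"
  unfolding K.graded_kernel_def
proof (intro allI impI ballI)
  fix N n and h :: "int \<Rightarrow> ('v, 'e, 'k) free_elem"
  assume h: "finite N \<and> (\<forall>n. homogeneous n (h n)) \<and> (\<Sum>n\<in>N. h n) \<in> kernel" and n: "n \<in> N"
  have hf: "h m \<in> free_plus G" for m using h homogeneous_free_plus by blast
  have comp: "act (h n) x = \<zero>" if x: "x \<in> Mg j" for x j
  proof -
    have xc: "x \<in> carrier M" using x component_carrierD by blast
    let ?f = "\<lambda>k. act (h (k - j)) x"
    have "finsum M ?f ((\<lambda>n. n + j) ` N) = finsum M (\<lambda>n. ?f (n + j)) N"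
      by (rule finsum_reindex) (use xc hf in \<open>auto simp: inj_on_def\<close>)
    also have "\<dots> = \<zero>" using act_sum[of N h x] hf h xc by (simp add: ann_kernel_iff)
    finally have 0: "finsum M ?f ((\<lambda>n. n + j) ` N) = \<zero>" .
    have "?f (n + j) = \<zero>"
    proof (rule component_independent[OF _ _ 0])
      show "?f k \<in> Mg k" for k using act_component[of "k - j" "h (k - j)" x j] h x by auto
    qed (use h n in auto)
    then show ?thesis by simp
  qed
  have "act (h n) x = \<zero>" if x: "x \<in> carrier M" for x
  proof -
    obtain N f where f: "finite N" "\<forall>n. f n \<in> Mg n" "x = finsum M f N" using component_decomposition x by blast
    have "f i \<in> carrier M" for i using f component_carrierD by blast
    moreover have "finsum M (\<lambda>i. act (h n) (f i)) N = \<zero>" using f(2) comp by (intro add.finprod_one_eqI) blast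
    ultimately show ?thesis using act_finsum[OF hf f(1), of f n] f(3) by simp
  qed
  then show "h n \<in> kernel" using hf by (simp add: ann_kernel_iff)
qed

lemma homogeneous_witness:
  assumes "homogeneous n a" "a \<notin> kernel"
  shows "\<exists>j x. x \<in> Mg j \<and> act a x \<noteq> \<zero>"
proof (rule ccontr)
  assume no: "\<nexists>j x. x \<in> Mg j \<and> act a x \<noteq> \<zero>"
  have af: "a \<in> free_plus G" using homogeneous_free_plus[OF assms(1)] .
  have "act a x = \<zero>" if x: "x \<in> carrier M" for x
  proof -
    obtain N f where f: "finite N" "\<forall>n. f n \<in> Mg n" "x = finsum M f N" using component_decomposition x by blast
    have "f i \<in> carrier M" for i using f component_carrierD by blast
    moreover have "finsum M (\<lambda>i. act a (f i)) N = \<zero>" using f(2) no by (intro add.finprod_one_eqI) blast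
    ultimately show ?thesis using act_finsum[OF af f(1), of f] f(3) by simp
  qed
  then show False using assms(2) af by (simp add: ann_kernel_iff)
qed

end

section \<open>Closure properties of the support\<close>

context leavitt_kernel begin

lemma support_edge:
  assumes "e \<in> arcs G" "head G e \<in> support G A"
  shows "tail G e \<in> support G A"
proof -
  have "word [Vertex (tail G e)] \<notin> A"
  proof
    assume "word [Vertex (tail G e)] \<in> A"
    then have "word [Vertex (tail G e)] * word [Edge e] \<in> A"
      by (rule kernel_mult_right) (use assms in \<open>auto intro: edge_ghost_free_plus\<close>)
    then have "word [Edge e] \<in> A" using kernel_cong[OF source_edge_cong[OF assms(1)]] by (simp add: mult_single)
    then show False using kernel_edge[OF assms(1)] assms(2) by (simp add: support_def)
  qed
  then show ?thesis using assms(1) by (simp add: support_def)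
qed

lemma support_upward:
  assumes "u \<rightarrow>\<^sup>*\<^bsub>G\<^esub> w" "w \<in> support G A"
  shows "u \<in> support G A"
  using assms
proof (induction rule: converse_reachable_induct)
  case (step x y)
  then obtain e where "e \<in> arcs G" "tail G e = x" "head G e = y" by auto
  then show ?case using support_edge[of e] step by blast
qed

text \<open>Otherwise the ideal would contain every \<open>e^*\<close> with source \<open>v\<close>,
  and then \<open>v\<close> as the sum of the \<open>e e^*\<close>.\<close>

lemma support_regular:
  assumes "v \<in> support G A" "regular_vertex G v"
  shows "kept_edges G A v \<noteq> {}"
proof
  assume empty: "kept_edges G A v = {}"
  have "word [Edge e, Ghost e] \<in> A" if e: "e \<in> out_arcs G v" for e
  proof -
    have ea: "e \<in> arcs G" using e by auto
    have "word [Vertex (head G e)] \<in> A" using empty e by (auto simp: kept_edges_def)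
    then have "word [Ghost e] \<in> A" using kernel_ghost ea by blast
    then have "word [Edge e] * word [Ghost e] \<in> A"
      using kernel_mult_left edge_ghost_free_plus(1)[OF ea] by blast
    then show ?thesis by (simp add: mult_single)
  qed
  then have "(\<Sum>e\<in>out_arcs G v. word [Edge e, Ghost e]) \<in> A" by (rule kernel_sum)
  then show False using kernel_cong[OF regular_cong[OF assms(2)]] assms(1) by (simp add: support_def)
qed

end

context wf_digraph begin

text \<open>The mirror image of \<open>ghost_gap_cong\<close>.\<close>

lemma gap_edge_cong:
  assumes "v \<in> verts G" "F \<subseteq> out_arcs G v" "finite F" "e \<in> F"
  shows "lcong G (gap G F v * word [Edge e]) (0 :: ('a, 'b, 'k::field) free_elem)"
proof -
  have e: "e \<in> arcs G" "tail G e = v" using assms by auto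
  have "lcong G (word [Edge f, Ghost f, Edge e]) (if f = e then word [Edge e] else 0 :: ('a, 'b, 'k) free_elem)" if f: "f \<in> F" for f
  proof (cases "f = e")
    case True
    have "lcong G (word ([Edge e] @ [Ghost e, Edge e] @ [])) (word ([Edge e] @ [Vertex (head G e)] @ []) :: ('a, 'b, 'k) free_elem)"
      by (intro lcong_context ghost_edge_cong) (use e in auto)
    then show ?thesis using lcong_trans[OF _ edge_range_cong[OF e(1)]] True by simp
  next
    case False
    have "lcong G (word ([Edge f] @ [Ghost f, Edge e] @ [])) (0 :: ('a, 'b, 'k) free_elem)"
      by (intro lcong_context_zero ghost_edge_zero) (use e f assms False in auto)
    then show ?thesis using False by simp
  qed
  then have "lcong G (word [Vertex v, Edge e] - (\<Sum>f\<in>F. word [Edge f, Ghost f, Edge e]))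
     (word [Edge e] - (\<Sum>f\<in>F. if f = e then word [Edge e] else 0 :: ('a, 'b, 'k) free_elem))"
    using source_edge_cong[OF e(1)] e by (intro lcong_diff lcong_sum) auto
  then show ?thesis using assms(3,4) by (simp add: gap_def left_diff_distrib sum_distrib_right mult_single)
qed

lemma homogeneous_uminus: "homogeneous n a \<Longrightarrow> homogeneous n (- a)"
  by (simp add: homogeneous_def)

text \<open>Up to congruence: the words \<open>e e\<^sup>*\<close> of the gap element are not in normal form.\<close>

lemma gap_homogeneous:
  assumes "v \<in> verts G" "F \<subseteq> out_arcs G v"
  shows "\<exists>g. homogeneous 0 g \<and> lcong G (gap G F v) (g :: ('a, 'b, 'k::field) free_elem)"
proof -
  let ?g = "word (nf [] v []) + (- (\<Sum>e\<in>F. word (nf [e] (head G e) [e]))) :: ('a, 'b, 'k) free_elem"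
  have w: "homogeneous 0 (word (nf [e] (head G e) [e]) :: ('a, 'b, 'k) free_elem)" if "e \<in> F" for e
  proof -
    have "e \<in> arcs G" using that assms(2) by auto
    then have "awalk (tail G e) [e] (head G e)" by (simp add: awalk_Cons_iff awalk_Nil_iff)
    then have "nf [e] (head G e) [e] \<in> nf_words 0" unfolding nf_words_def by auto
    then show ?thesis by (simp add: homogeneous_def)
  qed
  have "awalk v [] v" using assms(1) by (simp add: awalk_Nil_iff)
  then have "nf [] v [] \<in> nf_words 0" unfolding nf_words_def by auto
  then have "homogeneous 0 (word (nf [] v []) :: ('a, 'b, 'k) free_elem)" by (simp add: homogeneous_def)
  then have "homogeneous 0 ?g" by (intro homogeneous_add homogeneous_uminus homogeneous_sum w)
  moreover have "lcong G (word [Edge e, Ghost e]) (word (nf [e] (head G e) [e]) :: ('a, 'b, 'k) free_elem)" if "e \<in> F" for e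
  proof -
    have "lcong G (word ([] @ [Edge e] @ [Ghost e])) (word ([] @ [Edge e, Vertex (head G e)] @ [Ghost e]) :: ('a, 'b, 'k) free_elem)"
      by (intro lcong_context lcong_sym[OF edge_range_cong]) (use that assms(2) in auto)
    then show ?thesis by (simp add: nf_def)
  qed
  then have "lcong G (gap G F v) (word (nf [] v []) - (\<Sum>e\<in>F. word (nf [e] (head G e) [e])) :: ('a, 'b, 'k) free_elem)"
    unfolding gap_def by (intro lcong_diff lcong_sum) (auto simp: nf_def)
  then have "lcong G (gap G F v) ?g" by simp
  ultimately show ?thesis by blast
qed

end

section \<open>Reduction to single monomials\<close>

context leavitt_module begin

text \<open>If the total action is nonzero, a single term is responsible. Its coefficient stays
  inside the monomial, since \<open>M\<close> has no scalars to pull it out.\<close>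

lemma act_nonzero_normal_form:
  assumes "b \<in> free_plus G" "a \<in> free_plus G" "x \<in> carrier M" "act b (act a x) \<noteq> \<zero>"
  shows "\<exists>p w q c u u'. awalk u p w \<and> awalk u' q w \<and> act b (act (single (nf p w q) c) x) \<noteq> \<zero>"
proof (rule ccontr)
  assume "\<not> ?thesis"
  then have no: "act b (act (single y c) x) = \<zero>" if "y \<in> nf_words n" for y c n
    using that unfolding nf_words_def by blast
  have hom: "act b (act h x) = \<zero>" if "homogeneous n h" for n h
  proof -
    have "Poly_Mapping.keys h \<subseteq> nf_words n" using that by (simp add: homogeneous_def)
    then have "h \<in> free_plus G \<and> act b (act h x) = \<zero>"
    proof (induction h rule: poly_mapping_single_induct_keys)
      case (single y c)
      then show ?case using no nf_words_generators[OF single] free_plus_single[of y] by blast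
    next
      case (add a c)
      then show ?case using assms(1,3) by (simp add: act_add act_add_right free_plus_add)
    qed (use assms(1,3) in simp)
    then show ?thesis by blast
  qed
  obtain N h where h: "finite N" "\<forall>n. homogeneous n (h n)" "lcong G a (\<Sum>n\<in>N. h n)"
    using homogeneous_decomposition_ex[OF assms(2)] by blast
  have hf: "h n \<in> free_plus G" for n using h homogeneous_free_plus by blast
  have "act a x = finsum M (\<lambda>n. act (h n) x) N"
    using act_cong[OF h(3)] act_sum[of N h x] hf assms(3) h(1) by simp
  then have "act b (act a x) = finsum M (\<lambda>n. act b (act (h n) x)) N"
    using act_finsum[OF assms(1) h(1), of "\<lambda>n. act (h n) x"] hf assms(3) by simp
  also have "\<dots> = \<zero>" using hom h(2) by (intro add.finprod_one_eqI) blast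
  finally show False using assms(4) by blast
qed

lemma single_nf_free_plus: "\<lbrakk>awalk u p w; awalk u' q w\<rbrakk> \<Longrightarrow> single (nf p w q) c \<in> free_plus G"
  by (intro free_plus_single nf_generators) (auto simp: nf_def)

lemma act_nf_source:
  assumes "awalk u' p w" "awalk v q w" "x \<in> carrier M" "act (word [Vertex u]) x = x" "u \<in> verts G"
    "act (single (nf p w q) c) x \<noteq> \<zero>"
  shows "v = u"
proof (rule ccontr)
  assume "v \<noteq> u"
  have "act (single (nf p w q) c) x = act (single (nf p w q) c * word [Vertex u]) x"
    using act_mult[OF single_nf_free_plus[OF assms(1,2)] edge_ghost_free_plus(4)[OF assms(5)] assms(3)] assms(4) by simp
  also have "\<dots> = act 0 x" using act_cong[OF nf_vertex_cong[OF assms(1,2,5), of c]] \<open>v \<noteq> u\<close> by simp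
  finally show False using assms(3,6) by simp
qed

lemma act_nf_target:
  assumes "awalk u p w" "awalk v q w" "x \<in> carrier M" "u' \<in> verts G"
    "act (word [Vertex u']) (act (single (nf p w q) c) x) \<noteq> \<zero>"
  shows "u = u'"
proof (rule ccontr)
  assume "u \<noteq> u'"
  have "act (word [Vertex u']) (act (single (nf p w q) c) x) = act (word [Vertex u'] * single (nf p w q) c) x"
    using act_mult[OF edge_ghost_free_plus(4)[OF assms(4)] single_nf_free_plus[OF assms(1,2)] assms(3)] by simp
  also have "\<dots> = act 0 x" using act_cong[OF vertex_nf_cong[OF assms(1,2,4), of c]] \<open>u \<noteq> u'\<close> by auto
  finally show False using assms(3,5) by simp
qed

text \<open>The ghost part acts first and therefore must not kill \<open>x\<close>.\<close>

lemma act_nf_ghost: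
  assumes "awalk u p w" "awalk v q w" "x \<in> carrier M"
    "act (single (nf p w q) c) x \<noteq> \<zero>"
  shows "act (word (nf [] w q)) x \<noteq> \<zero>"
proof
  assume 0: "act (word (nf [] w q)) x = \<zero>"
  have w: "w \<in> verts G" "awalk w [] w" using assms(1) awalk_last_in_verts by (auto simp: awalk_Nil_iff)
  have "map Edge p \<in> lists (generators G)" "rev (map Ghost q) \<in> lists (generators G)"
    using awalk_arcs[OF assms(1)] awalk_arcs[OF assms(2)] by (auto simp: subset_iff)
  then have "lcong G (single (map Edge p @ [Vertex w, Vertex w] @ rev (map Ghost q)) c)
     (single (map Edge p @ [Vertex w] @ rev (map Ghost q)) c)"
    by (intro lcong_context vertex_vertex_cong w)
  then have "lcong G (single (nf p w []) c * word (nf [] w q)) (single (nf p w q) c)"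
    by (simp add: nf_def mult_single)
  then have "act (single (nf p w q) c) x = act (single (nf p w []) c * word (nf [] w q)) x"
    using act_cong by metis
  also have "\<dots> = \<zero>"
    using act_mult[OF single_nf_free_plus[OF assms(1) w(2)] single_nf_free_plus[OF w(2) assms(2)] assms(3)]
      act_zero_right[OF single_nf_free_plus[OF assms(1) w(2)]] 0 by simp
  finally show False using assms(4) by blast
qed

end

section \<open>The support of a graded simple module\<close>

context graded_simple_module begin

lemma act_word_carrier: "\<lbrakk>w \<in> lists (generators G); w \<noteq> []; x \<in> carrier M\<rbrakk> \<Longrightarrow> act (single w c) x \<in> carrier M"
  by (intro act_closed free_plus_single)

lemma not_in_kernel: "a \<in> free_plus G \<Longrightarrow> a \<notin> kernel \<Longrightarrow> \<exists>y\<in>carrier M. act a y \<noteq> \<zero>"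
  by (auto simp: ann_kernel_iff)

lemma act_ghost_nonzero_support:
  assumes "awalk v q w" "x \<in> carrier M" "act (word (nf [] w q)) x \<noteq> \<zero>"
  shows "w \<in> support G kernel"
proof -
  have w: "w \<in> verts G" using assms(1) by blast
  have q: "rev (map Ghost q) \<in> lists (generators G)" using awalk_arcs[OF assms(1)] by (auto simp: subset_iff)
  have f: "word (nf [] w q) \<in> free_plus G" using single_nf_free_plus[OF _ assms(1), of w "[]"] w by (simp add: awalk_Nil_iff)
  have "word [Vertex w] \<notin> kernel"
  proof
    assume "word [Vertex w] \<in> kernel"
    then have "word [Vertex w] * word (nf [] w q) \<in> kernel" using f by (rule K.kernel_mult_right)
    moreover have "lcong G (word ([] @ [Vertex w, Vertex w] @ rev (map Ghost q)))
        (word ([] @ [Vertex w] @ rev (map Ghost q)) :: ('v, 'e, 'k) free_elem)"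
      by (intro lcong_context vertex_vertex_cong w q) simp
    then have "lcong G (word [Vertex w] * word (nf [] w q)) (word (nf [] w q) :: ('v, 'e, 'k) free_elem)"
      by (simp add: mult_single nf_def)
    ultimately have "word (nf [] w q) \<in> kernel" using K.kernel_cong by blast
    then show False using assms(2,3) by (simp add: ann_kernel_iff)
  qed
  then show ?thesis using w by (simp add: support_def)
qed

text \<open>As \<open>x\<close> generates \<open>M\<close>, some \<open>p q^*\<close> maps it to an
  element that \<open>v\<close> does not kill; this fixes the sources of \<open>p\<close> and
  \<open>q\<close>. The common range \<open>w\<close> again lies in the support, which is where
  directedness comes from.\<close>

lemma support_reach:
  assumes x: "x \<in> Mg j" "x \<noteq> \<zero>" "act (word [Vertex u]) x = x" "u \<in> verts G"
    and v: "v \<in> support G kernel"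
  shows "\<exists>p q w. awalk v p w \<and> awalk u q w \<and> act (word (nf [] w q)) x \<noteq> \<zero>"
proof -
  have xc: "x \<in> carrier M" using x(1) component_carrierD by blast
  have vf: "v \<in> verts G" "word [Vertex v] \<in> free_plus G" "word [Vertex v] \<notin> kernel"
    using v edge_ghost_free_plus(4)[of v] by (auto simp: support_def)
  obtain y where y: "y \<in> carrier M" "act (word [Vertex v]) y \<noteq> \<zero>" using not_in_kernel[OF vf(2,3)] by blast
  obtain a where a: "a \<in> free_plus G" "y = act a x" using cyclic[OF x(1,2) y(1)] by blast
  obtain p w q c u1 u2 where n: "awalk u1 p w" "awalk u2 q w"
    "act (word [Vertex v]) (act (single (nf p w q) c) x) \<noteq> \<zero>"
    using act_nonzero_normal_form[OF vf(2) a(1) xc] y(2) a(2) by blast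
  have nz: "act (single (nf p w q) c) x \<noteq> \<zero>" using n(3) act_zero_right[OF vf(2)] by auto
  have "u1 = v" by (rule act_nf_target[OF n(1,2) xc vf(1) n(3)])
  moreover have "u2 = u" by (rule act_nf_source[OF n(1,2) xc x(3,4) nz])
  ultimately show ?thesis using n act_nf_ghost[OF n(1,2) xc nz] by blast
qed

lemma vertex_witness:
  assumes "v \<in> support G kernel"
  shows "\<exists>j x. x \<in> Mg j \<and> x \<noteq> \<zero> \<and> act (word [Vertex v]) x = x"
proof -
  have v: "v \<in> verts G" "word [Vertex v] \<notin> kernel" using assms by (auto simp: support_def)
  have "awalk v [] v" using v by (simp add: awalk_Nil_iff)
  then have "[Vertex v] \<in> nf_words 0" unfolding nf_words_def by (auto intro!: exI[of _ "[]"] exI[of _ v] simp: nf_def)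
  then have hom: "homogeneous 0 (word [Vertex v] :: ('v, 'e, 'k) free_elem)" by (simp add: homogeneous_def)
  obtain j x where x: "x \<in> Mg j" "act (word [Vertex v]) x \<noteq> \<zero>" using homogeneous_witness[OF hom v(2)] by blast
  have xc: "x \<in> carrier M" using x component_carrierD by blast
  have "act (word [Vertex v]) (act (word [Vertex v]) x) = act (word [Vertex v] * word [Vertex v]) x"
    using act_mult[OF edge_ghost_free_plus(4)[OF v(1)] edge_ghost_free_plus(4)[OF v(1)] xc] by simp
  also have "\<dots> = act (word [Vertex v]) x" using act_cong[OF vertex_vertex_cong[OF v(1)]] by (simp add: mult_single)
  finally show ?thesis using x act_component[OF hom x(1)] by blast
qed

lemma support_directed:
  assumes "u \<in> support G kernel" "v \<in> support G kernel"
  shows "\<exists>w\<in>support G kernel. u \<rightarrow>\<^sup>*\<^bsub>G\<^esub> w \<and> v \<rightarrow>\<^sup>*\<^bsub>G\<^esub> w"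
proof -
  obtain j x where x: "x \<in> Mg j" "x \<noteq> \<zero>" "act (word [Vertex u]) x = x" using vertex_witness[OF assms(1)] by blast
  have "u \<in> verts G" using assms(1) by (simp add: support_def)
  then obtain p q w where "awalk v p w" "awalk u q w" "act (word (nf [] w q)) x \<noteq> \<zero>"
    using support_reach[OF x _ assms(2)] by blast
  then show ?thesis using act_ghost_nonzero_support component_carrierD[OF x(1)] reachable_awalkI by blast
qed

lemma support_nonempty: "support G kernel \<noteq> {}"
proof -
  obtain r y where "r \<in> carrier (leavitt_algebra G)" and y: "y \<in> carrier M" and "r \<odot>\<^bsub>M\<^esub> y \<noteq> \<zero>"
    using graded_simple unfolding graded_simple_def by blast
  then obtain a where a: "a \<in> free_plus G" "act a y \<noteq> \<zero>" unfolding leavitt_algebra_carrier act_def by blast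
  obtain b where b: "b \<in> free_plus G" "act b (act a y) \<noteq> \<zero>" using unital[OF act_closed[OF a(1) y]] a(2) by blast
  from act_nonzero_normal_form[OF b(1) a(1) y b(2)] obtain p w q c u u' where
    n: "awalk u p w" "awalk u' q w" "act b (act (single (nf p w q) c) y) \<noteq> \<zero>" by blast
  have n: "awalk u p w" "awalk u' q w" "act (single (nf p w q) c) y \<noteq> \<zero>"
    using n act_zero_right[OF b(1)] by auto
  then show ?thesis using act_ghost_nonzero_support[OF n(2) y act_nf_ghost[OF n(1,2) y n(3)]] by blast
qed

lemma ghost_zero:
  assumes "x \<in> carrier M" "\<And>e. e \<in> out_arcs G v \<Longrightarrow> act (word [Ghost e]) x = \<zero>" "awalk v q w"
    "act (word (nf [] w q)) x \<noteq> \<zero>"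
  shows "q = []"
proof (rule ccontr)
  assume "q \<noteq> []"
  then obtain e r where q: "q = e # r" by (cases q) auto
  then have e: "e \<in> arcs G" "tail G e = v" "awalk (head G e) r w" using assms(3) by (auto simp: awalk_Cons_iff)
  have "awalk w [] w" using assms(3) by (auto simp: awalk_Nil_iff)
  then have f: "word (nf [] w r) \<in> free_plus G" by (rule single_nf_free_plus[OF _ e(3)])
  have "act (word (nf [] w q)) x = act (word (nf [] w r) * word [Ghost e]) x"
    by (simp add: q nf_def mult_single)
  also have "\<dots> = act (word (nf [] w r)) (act (word [Ghost e]) x)"
    by (rule act_mult[OF f edge_ghost_free_plus(2)[OF e(1)] assms(1)])
  also have "\<dots> = \<zero>" using assms(2)[of e] e act_zero_right[OF f] by simp
  finally show False using assms(4) by blast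
qed

text \<open>An element \<open>x \<noteq> 0\<close> of \<open>v\<^sup>H M\<close> is killed by all ghost edges, so that \<open>M\<close> is spanned by the \<open>p x\<close>.\<close>

lemma defect_vertex:
  assumes "v \<in> defects G kernel"
  shows "support G kernel = root_set G {v}" "defects G kernel = {v}"
proof -
  let ?F = "kept_edges G kernel v"
  have v: "v \<in> verts G" "v \<in> support G kernel" "finite ?F" "gap G ?F v \<notin> kernel"
    using assms by (auto simp: defects_def support_def)
  have F: "?F \<subseteq> out_arcs G v" by (auto simp: kept_edges_def)
  let ?g = "gap G ?F v :: ('v, 'e, 'k) free_elem"
  have gf: "?g \<in> free_plus G" by (rule gap_free_plus[OF v(1) F])
  obtain g where g: "homogeneous 0 g" "lcong G ?g g" using gap_homogeneous[OF v(1) F] by blast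
  then have "g \<notin> kernel" using K.kernel_cong v(4) by blast
  then obtain j y where y: "y \<in> Mg j" "act g y \<noteq> \<zero>" using homogeneous_witness[OF g(1)] by blast
  have yc: "y \<in> carrier M" using y component_carrierD by blast
  define x where "x = act ?g y"
  have xg: "x = act g y" using act_cong[OF g(2)] by (simp add: x_def)
  have x: "x \<in> Mg (0 + j)" "x \<noteq> \<zero>" unfolding xg using act_component[OF g(1) y(1)] y(2) by auto
  have xc: "x \<in> carrier M" using x component_carrierD by blast
  have "act (word [Vertex v]) x = act (word [Vertex v] * ?g) y"
    unfolding x_def by (rule act_mult[OF edge_ghost_free_plus(4)[OF v(1)] gf yc, symmetric])
  then have xv: "act (word [Vertex v]) x = x" using act_cong[OF vertex_gap_cong[OF v(1) F]] by (simp add: x_def)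
  have ghost: "act (word [Ghost e]) x = \<zero>" if e: "e \<in> out_arcs G v" for e
  proof (cases "e \<in> ?F")
    case True
    have "act (word [Ghost e]) x = act (word [Ghost e] * ?g) y"
      unfolding x_def by (rule act_mult[OF _ gf yc, symmetric]) (use e edge_ghost_free_plus(2) in auto)
    also have "\<dots> = act 0 y" using act_cong[OF ghost_gap_cong[OF v(1) F v(3) e]] True by simp
    finally show ?thesis using yc by simp
  next
    case False
    then have "word [Ghost e] \<in> kernel" using K.kernel_ghost[of e] e by (auto simp: kept_edges_def)
    then show ?thesis using xc by (simp add: ann_kernel_iff)
  qed
  note gz = ghost_zero[OF xc ghost]
  show T: "support G kernel = root_set G {v}"
  proof (intro subset_antisym subsetI)
    fix z assume "z \<in> support G kernel"
    then obtain p q w where pq: "awalk z p w" "awalk v q w" "act (word (nf [] w q)) x \<noteq> \<zero>"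
      using support_reach[OF x xv v(1)] by blast
    then have "q = []" using gz by blast
    then show "z \<in> root_set G {v}" using pq by (auto simp: root_set_iff awalk_Nil_iff intro: reachable_awalkI)
  next
    fix z assume "z \<in> root_set G {v}"
    then show "z \<in> support G kernel" using K.support_upward v(2) by (auto simp: root_set_iff)
  qed
  \<comment> \<open>The gap element of another vertex \<open>w\<close> would kill every
    \<open>p x\<close>: it kills paths whose source is not \<open>w\<close>, and a path from
    \<open>w\<close> to \<open>v\<close> begins with an edge kept at \<open>w\<close>.\<close>
  have "w = v" if w: "w \<in> defects G kernel" for w
  proof (rule ccontr)
    assume "w \<noteq> v"
    let ?H = "kept_edges G kernel w"
    have wv: "w \<in> verts G" "finite ?H" "gap G ?H w \<notin> kernel" and H: "?H \<subseteq> out_arcs G w"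
      using w by (auto simp: defects_def support_def kept_edges_def)
    let ?h = "gap G ?H w :: ('v, 'e, 'k) free_elem"
    have hf: "?h \<in> free_plus G" by (rule gap_free_plus[OF wv(1) H])
    obtain z where z: "z \<in> carrier M" "act ?h z \<noteq> \<zero>" using not_in_kernel[OF hf wv(3)] by blast
    obtain a where a: "a \<in> free_plus G" "z = act a x" using cyclic[OF x z(1)] by blast
    obtain p w1 q c u1 u2 where n: "awalk u1 p w1" "awalk u2 q w1"
      "act ?h (act (single (nf p w1 q) c) x) \<noteq> \<zero>"
      using act_nonzero_normal_form[OF hf a(1) xc] z(2) a(2) by blast
    have nz: "act (single (nf p w1 q) c) x \<noteq> \<zero>" using n(3) act_zero_right[OF hf] by auto
    have u2: "u2 = v" by (rule act_nf_source[OF n(1,2) xc xv v(1) nz])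
    have "q = []" using gz act_nf_ghost[OF n(1,2) xc nz] n(2) u2 by blast
    then have w1: "w1 = v" using n(2) u2 by (auto simp: awalk_Nil_iff)
    show False
    proof (cases p)
      case Nil
      then have u1: "u1 \<noteq> w" using n(1) w1 \<open>w \<noteq> v\<close> by (auto simp: awalk_Nil_iff)
      have "lcong G (?h * word [Vertex v]) 0"
      proof -
        have "lcong G (word [Edge e, Ghost e, Vertex v]) (0 :: ('v, 'e, 'k) free_elem)" if e: "e \<in> ?H" for e
        proof -
          have "lcong G (word ([Edge e] @ [Ghost e, Vertex v] @ [])) (0 :: ('v, 'e, 'k) free_elem)"
            by (intro lcong_context_zero ghost_vertex_zero) (use e H v \<open>w \<noteq> v\<close> in auto)
          then show ?thesis by simp
        qed
        then have "lcong G (word [Vertex w, Vertex v] - (\<Sum>e\<in>?H. word [Edge e, Ghost e, Vertex v])) (0 - (\<Sum>e\<in>?H. 0 :: ('v, 'e, 'k) free_elem))"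
          by (intro lcong_diff lcong_sum vertex_vertex_zero wv v \<open>w \<noteq> v\<close>)
        then show ?thesis by (simp add: gap_def left_diff_distrib sum_distrib_right mult_single)
      qed
      then have 0: "act ?h (act (word [Vertex v]) z) = \<zero>" if "z \<in> carrier M" for z
        using act_mult[OF hf edge_ghost_free_plus(4)[OF v(1)] that] act_cong[of "?h * word [Vertex v]" 0] that by simp
      have "single (nf p w1 q) c = single [Vertex v] c" using Nil \<open>q = []\<close> w1 by (simp add: nf_def)
      then have "act (single (nf p w1 q) c) x = act (word [Vertex v]) (act (single [Vertex v] c) x)"
        using act_cong[OF lcong_scale[OF vertex_vertex_cong[OF v(1)]], of c]
          act_mult[OF edge_ghost_free_plus(4)[OF v(1)] free_plus_single[of "[Vertex v]" G c] xc] v(1) by (simp add: mult_single)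
      then show False using 0[of "act (single [Vertex v] c) x"] n(3) act_word_carrier[of "[Vertex v]" x c] v(1) xc by simp
    next
      case (Cons e r)
      then have e: "e \<in> arcs G" "u1 = tail G e" "awalk (head G e) r w1" using n(1) by (auto simp: awalk_Cons_iff)
      have rf: "single (nf r w1 q) c \<in> free_plus G" by (rule single_nf_free_plus[OF e(3) n(2)])
      let ?z = "act (single (nf r w1 q) c) x"
      have zc: "?z \<in> carrier M" by (rule act_closed[OF rf xc])
      have "act (single (nf p w1 q) c) x = act (word [Edge e] * single (nf r w1 q) c) x"
        using Cons by (simp add: nf_def mult_single)
      also have "\<dots> = act (word [Edge e]) ?z" by (rule act_mult[OF edge_ghost_free_plus(1)[OF e(1)] rf xc])
      finally have eq: "act ?h (act (single (nf p w1 q) c) x) = act (?h * word [Edge e]) ?z"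
        using act_mult[OF hf edge_ghost_free_plus(1)[OF e(1)] zc] by simp
      have "lcong G (?h * word [Edge e]) 0"
      proof (cases "tail G e = w")
        case True
        have "head G e \<in> support G kernel" using e(3) w1 K.support_upward v(2) reachable_awalkI by blast
        then have "e \<in> ?H" using e(1) True by (auto simp: kept_edges_support)
        then show ?thesis by (rule gap_edge_cong[OF wv(1) H wv(2)])
      next
        case False
        have "lcong G (word [Edge f, Ghost f, Edge e]) (0 :: ('v, 'e, 'k) free_elem)" if f: "f \<in> ?H" for f
        proof -
          have "lcong G (word ([Edge f] @ [Ghost f, Edge e] @ [])) (0 :: ('v, 'e, 'k) free_elem)"
            by (intro lcong_context_zero ghost_edge_zero) (use e f H False in auto)
          then show ?thesis by simp
        qed
        then have "lcong G (word [Vertex w, Edge e] - (\<Sum>f\<in>?H. word [Edge f, Ghost f, Edge e])) (0 - (\<Sum>f\<in>?H. 0 :: ('v, 'e, 'k) free_elem))"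
          by (intro lcong_diff lcong_sum vertex_edge_zero wv e False[symmetric])
        then show ?thesis by (simp add: gap_def left_diff_distrib sum_distrib_right mult_single)
      qed
      then show False using n(3) eq act_cong[of "?h * word [Edge e]" 0] zc by simp
    qed
  qed
  then show "defects G kernel = {v}" using assms by blast
qed

text \<open>One step down the tree of the paths \<open>q\<close> with \<open>q^* x\<close>
  nonzero.\<close>

lemma act_ghost_nf:
  assumes "awalk v q (tail G e)" "e \<in> arcs G" "x \<in> carrier M"
  shows "act (word (nf [] (head G e) (q @ [e]))) x = act (word [Ghost e]) (act (word (nf [] (tail G e) q)) x)"
proof -
  let ?q = "rev (map Ghost q)"
  have q: "?q \<in> lists (generators G)" using awalk_arcs[OF assms(1)] by (auto simp: subset_iff)
  have "lcong G (word ([] @ [Vertex (head G e), Ghost e] @ ?q)) (word ([] @ [Ghost e] @ ?q) :: ('v, 'e, 'k) free_elem)"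
    by (intro lcong_context range_ghost_cong q assms) simp
  moreover have "lcong G (word ([] @ [Ghost e, Vertex (tail G e)] @ ?q)) (word ([] @ [Ghost e] @ ?q) :: ('v, 'e, 'k) free_elem)"
    by (intro lcong_context ghost_source_cong q assms) simp
  ultimately have "lcong G (word (nf [] (head G e) (q @ [e]))) (word [Ghost e] * word (nf [] (tail G e) q) :: ('v, 'e, 'k) free_elem)"
    using lcong_trans[OF _ lcong_sym, of "word ([] @ [Vertex (head G e), Ghost e] @ ?q)" "word ([] @ [Ghost e] @ ?q) :: ('v, 'e, 'k) free_elem"]
    by (simp add: nf_def mult_single)
  then have "act (word (nf [] (head G e) (q @ [e]))) x = act (word [Ghost e] * word (nf [] (tail G e) q)) x"
    by (rule act_cong)
  also have "\<dots> = act (word [Ghost e]) (act (word (nf [] (tail G e) q)) x)"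
    by (rule act_mult[OF edge_ghost_free_plus(2)[OF assms(2)] single_nf_free_plus[where u = "tail G e", OF _ assms(1)] assms(3)])
      (simp add: awalk_Nil_iff assms(2))
  finally show ?thesis .
qed

text \<open>If \<open>w'\<close> does not reach \<open>w\<close>, then \<open>w L y\<close> only involves paths of positive length from \<open>w\<close>.\<close>

lemma finite_ghost_support:
  assumes y: "y \<in> carrier M" "act (word [Vertex w']) y = y" "w' \<in> verts G" and w: "w \<in> verts G"
    and no: "\<not> w' \<rightarrow>\<^sup>*\<^bsub>G\<^esub> w" and a: "a \<in> free_plus G"
  shows "finite {e \<in> out_arcs G w. act (word [Ghost e]) (act a y) \<noteq> \<zero>}"
proof -
  let ?E = "\<lambda>a. {e \<in> out_arcs G w. act (word [Ghost e]) (act a y) \<noteq> \<zero>}"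
  have gf: "word [Ghost e] \<in> free_plus G" if "e \<in> out_arcs G w" for e
    using that edge_ghost_free_plus(2) by auto
  have gz: "act (word [Ghost e]) \<zero> = \<zero>" if "e \<in> out_arcs G w" for e
    by (rule act_zero_right[OF gf[OF that]])
  have add: "?E (a + b) \<subseteq> ?E a \<union> ?E b" if ab: "a \<in> free_plus G" "b \<in> free_plus G" for a b
  proof
    fix e assume e: "e \<in> ?E (a + b)"
    then have "act (word [Ghost e]) (act (a + b) y) = act (word [Ghost e]) (act a y) \<oplus> act (word [Ghost e]) (act b y)"
      using act_add_right[OF gf act_closed[OF ab(1) y(1)] act_closed[OF ab(2) y(1)], of e]
      unfolding act_add[OF ab y(1)] by blast
    then have "act (word [Ghost e]) (act a y) \<noteq> \<zero> \<or> act (word [Ghost e]) (act b y) \<noteq> \<zero>"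
      using e by auto
    then show "e \<in> ?E a \<union> ?E b" using e by blast
  qed
  have single: "finite (?E (single x c))" if xn: "x \<in> nf_words n" for x c n
  proof -
    obtain p w1 q u1 u2 where x: "x = nf p w1 q" "awalk u1 p w1" "awalk u2 q w1"
      using xn unfolding nf_words_def by blast
    have f: "single x c \<in> free_plus G" unfolding x(1) by (rule single_nf_free_plus[OF x(2,3)])
    show ?thesis
    proof (cases "act (single x c) y = \<zero>")
      case True
      then have "?E (single x c) = {}" using gz by simp
      then show ?thesis by (simp only: finite.emptyI)
    next
      case False
      then have u2: "u2 = w'" using act_nf_source[OF x(2,3) y(1,2,3)] x(1) by blast
      show ?thesis
      proof (cases p)
        case Nil
        \<comment> \<open>If \<open>w1\<close> were \<open>w\<close>, then \<open>q\<close> would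
          lead from \<open>w'\<close> to \<open>w\<close>. So ghost edges of \<open>w\<close> meet a
          foreign vertex and give 0.\<close>
        then have "w1 \<noteq> w" using no x(3) u2 reachable_awalkI by blast
        have "act (word [Ghost e]) (act (single x c) y) = \<zero>" if e: "e \<in> out_arcs G w" for e
        proof -
          have q: "rev (map Ghost q) \<in> lists (generators G)" using awalk_arcs[OF x(3)] by (auto simp: subset_iff)
          have "lcong G (single ([] @ [Ghost e, Vertex w1] @ rev (map Ghost q)) c) 0"
            by (intro lcong_context_zero ghost_vertex_zero q) (use e x(2) \<open>w1 \<noteq> w\<close> in auto)
          then have "lcong G (word [Ghost e] * single x c) 0" by (simp add: x(1) Nil nf_def mult_single)
          then show ?thesis using act_mult[OF gf[OF e] f y(1)] act_cong[of "word [Ghost e] * single x c" 0] y(1) by simp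
        qed
        then have "?E (single x c) = {}" by blast
        then show ?thesis by (simp only: finite.emptyI)
      next
        case (Cons f p')
        then have fp: "f \<in> arcs G" "awalk (head G f) p' w1" using x(2) by (auto simp: awalk_Cons_iff)
        \<comment> \<open>A nontrivial monomial contributes at most its first edge.\<close>
        have "act (word [Ghost e]) (act (single x c) y) = \<zero>" if e: "e \<in> out_arcs G w" "e \<noteq> f" for e
        proof -
          have "lcong G (single ([] @ [Ghost e, Edge f] @ nf p' w1 q) c) 0"
            by (intro lcong_context_zero ghost_edge_zero nf_generators[OF fp(2) x(3)]) (use e fp in auto)
          then have "lcong G (word [Ghost e] * single x c) 0" by (simp add: x(1) Cons nf_def mult_single)
          then show ?thesis using act_mult[OF gf[OF e(1)] f y(1)] act_cong[of "word [Ghost e] * single x c" 0] y(1) by simp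
        qed
        then have "?E (single x c) \<subseteq> {f}" by blast
        then show ?thesis by (rule finite_subset) simp
      qed
    qed
  qed
  have zero: "?E 0 = {}" using act_zero[OF y(1)] gz by simp
  have hom: "finite (?E h)" if "homogeneous n h" for n h
  proof -
    have "Poly_Mapping.keys h \<subseteq> nf_words n" using that by (simp add: homogeneous_def)
    then have "h \<in> free_plus G \<and> finite (?E h)"
    proof (induction h rule: poly_mapping_single_induct_keys)
      case zero
      then show ?case using \<open>?E 0 = {}\<close> by (simp only: finite.emptyI free_plus_zero simp_thms)
    next
      case (single x c)
      then show ?case using \<open>\<And>x n c. x \<in> nf_words n \<Longrightarrow> finite (?E (single x c))\<close>
          nf_words_generators[OF single] free_plus_single[of x] by blast
    next
      case (add a b)
      then have "finite (?E a \<union> ?E b)" by blast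
      then show ?case using \<open>\<And>a b. a \<in> free_plus G \<Longrightarrow> b \<in> free_plus G \<Longrightarrow> ?E (a + b) \<subseteq> ?E a \<union> ?E b\<close>[of a b]
        add free_plus_add[of a G b] finite_subset by blast
    qed
    then show ?thesis by blast
  qed
  obtain N h where h: "finite N" "\<forall>n. homogeneous n (h n)" "lcong G a (\<Sum>n\<in>N. h n)"
    using homogeneous_decomposition_ex[OF a] by blast
  have hf: "h n \<in> free_plus G" for n using h homogeneous_free_plus by blast
  have "finite (?E (\<Sum>n\<in>N. h n))"
    using h(1)
  proof (induction N rule: finite_induct)
    case empty
    then show ?case using zero by (simp only: sum.empty finite.emptyI)
  next
    case (insert n N)
    have "?E (h n + (\<Sum>n\<in>N. h n)) \<subseteq> ?E (h n) \<union> ?E (\<Sum>n\<in>N. h n)" by (rule add[OF hf free_plus_sum[OF hf]])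
    moreover have "finite (?E (h n) \<union> ?E (\<Sum>n\<in>N. h n))" using insert.IH hom h(2) by blast
    ultimately have "finite (?E (h n + (\<Sum>n\<in>N. h n)))" by (rule finite_subset)
    then show ?case unfolding sum.insert[OF insert.hyps] .
  qed
  then show ?thesis unfolding act_cong[OF h(3)] .
qed

text \<open>
  Either the paths \<open>q\<close> with \<open>q\<^sup>* x \<noteq> 0\<close> form a finitely branching, hence countable, tree,
  or infinite branching at some \<open>q\<close> makes the range of \<open>q\<close> cofinal by \<open>finite_ghost_support\<close>.
\<close>

lemma countable_cofinal:
  "\<exists>D. countable D \<and> D \<subseteq> support G kernel \<and> support G kernel = root_set G D"
proof -
  let ?T = "support G kernel"
  obtain v where v: "v \<in> ?T" using support_nonempty by blast
  then have vV: "v \<in> verts G" by (simp add: support_def)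
  obtain j x where x: "x \<in> Mg j" "x \<noteq> \<zero>" "act (word [Vertex v]) x = x" using vertex_witness[OF v] by blast
  have xc: "x \<in> carrier M" using x component_carrierD by blast
  let ?y = "\<lambda>q w. act (word (nf [] w q)) x"
  let ?E = "\<lambda>q w. {e \<in> out_arcs G w. act (word [Ghost e]) (?y q w) \<noteq> \<zero>}"
  let ?D = "{w. \<exists>q. awalk v q w \<and> ?y q w \<noteq> \<zero>}"
  have DT: "?D \<subseteq> ?T" using act_ghost_nonzero_support[OF _ xc] by blast
  have up: "root_set G D \<subseteq> ?T" if "D \<subseteq> ?T" for D
    using that K.support_upward unfolding root_set_iff subset_iff by blast
  have triv: "awalk w [] w" if "awalk v q w" for v q w
    using that by (auto simp: awalk_Nil_iff)
  have yf: "word (nf [] w q) \<in> free_plus G" if "awalk v q w" for q w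
    by (rule single_nf_free_plus[OF triv[OF that] that])
  have nfw: "nf [] w q \<in> nf_words (- int (length q))" if "awalk v q w" for v q w
  proof -
    have "int (length ([] :: 'e list)) - int (length q) = - int (length q)" by simp
    then show ?thesis using triv[OF that] that unfolding nf_words_def by blast
  qed
  have yhom: "\<exists>i. ?y q w \<in> Mg i" if "awalk v q w" for q w
  proof -
    from nfw[OF that] have "homogeneous (- int (length q)) (word (nf [] w q) :: ('v, 'e, 'k) free_elem)" by (simp add: homogeneous_def)
    then show ?thesis using act_component[OF _ x(1)] by blast
  qed
  have yv: "act (word [Vertex w]) (?y q w) = ?y q w" if q: "awalk v q w" for q w
  proof -
    have w: "w \<in> verts G" "awalk w [] w" using q by (auto simp: awalk_Nil_iff)
    have "act (word [Vertex w]) (?y q w) = act (word [Vertex w] * word (nf [] w q)) x"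
      by (rule act_mult[OF edge_ghost_free_plus(4)[OF w(1)] yf[OF q] xc, symmetric])
    then show ?thesis using act_cong[OF vertex_nf_cong[OF w(2) q w(1), of 1]] by simp
  qed
  show ?thesis
  proof (cases "\<exists>q w. awalk v q w \<and> infinite (?E q w)")
    case True
    then obtain q w where q: "awalk v q w" and inf: "infinite (?E q w)" by blast
    have w: "w \<in> verts G" using q by blast
    let ?z = "?y q w"
    obtain i where zi: "?z \<in> Mg i" using yhom[OF q] by blast
    have zc: "?z \<in> carrier M" using zi component_carrierD by blast
    have "?z \<noteq> \<zero>"
    proof
      assume "?z = \<zero>"
      moreover have "act (word [Ghost e]) \<zero> = \<zero>" if "e \<in> out_arcs G w" for e
        by (rule act_zero_right[OF edge_ghost_free_plus(2)]) (use that in simp)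
      ultimately have "?E q w = {}" by simp
      then show False using inf by (metis finite.emptyI)
    qed
    have wT: "w \<in> ?T" using act_ghost_nonzero_support[OF q xc \<open>?z \<noteq> _\<close>] .
    have "?T \<subseteq> root_set G {w}"
    proof
      fix u assume "u \<in> ?T"
      then obtain p r w' where r: "awalk u p w'" "awalk w r w'" "act (word (nf [] w' r)) ?z \<noteq> \<zero>"
        using support_reach[OF zi \<open>?z \<noteq> _\<close> yv[OF q] w] by blast
      let ?z' = "act (word (nf [] w' r)) ?z"
      have w': "w' \<in> verts G" "awalk w' [] w'" using r(2) by (auto simp: awalk_Nil_iff)
      have rf: "word (nf [] w' r) \<in> free_plus G" by (rule single_nf_free_plus[OF w'(2) r(2)])
      from nfw[OF r(2)] have "homogeneous (- int (length r)) (word (nf [] w' r) :: ('v, 'e, 'k) free_elem)" by (simp add: homogeneous_def)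
      then have z'i: "?z' \<in> Mg (- int (length r) + i)" by (rule act_component[OF _ zi])
      have z'c: "?z' \<in> carrier M" using z'i component_carrierD by blast
      have "act (word [Vertex w']) ?z' = act (word [Vertex w'] * word (nf [] w' r)) ?z"
        by (rule act_mult[OF edge_ghost_free_plus(4)[OF w'(1)] rf zc, symmetric])
      then have z'v: "act (word [Vertex w']) ?z' = ?z'" using act_cong[OF vertex_nf_cong[OF w'(2) r(2) w'(1), of 1]] by simp
      obtain a where a: "a \<in> free_plus G" "?z = act a ?z'" using cyclic[OF z'i r(3) zc] by blast
      \<comment> \<open>By \<open>cyclic\<close> the element \<open>?z\<close> is a multiple of its
        own image \<open>?z'\<close>, so unreachability of \<open>w\<close> would make the branching
        of \<open>?z\<close> at \<open>w\<close> finite.\<close>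
      have "w' \<rightarrow>\<^sup>*\<^bsub>G\<^esub> w"
      proof (rule ccontr)
        assume "\<not> w' \<rightarrow>\<^sup>*\<^bsub>G\<^esub> w"
        from finite_ghost_support[OF z'c z'v w'(1) w this a(1)] show False using inf a(2) by simp
      qed
      then show "u \<in> root_set G {w}" using reachable_trans[OF reachable_awalkI[OF r(1)]] by (simp add: root_set_iff)
    qed
    then show ?thesis using up[of "{w}"] wT by (intro exI[of _ "{w}"]) auto
  next
    case False
    let ?Q = "\<lambda>n. {q. length q = n \<and> (\<exists>w. awalk v q w \<and> ?y q w \<noteq> \<zero>)}"
    have "finite (?Q n)" for n
    proof (induction n)
      case 0
      have "?Q 0 \<subseteq> {[]}" by auto
      then show ?case by (rule finite_subset) simp
    next
      case (Suc n)
      \<comment> \<open>Each path of one level extends a path of the previous level by one of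
        finitely many edges.\<close>
      have "?Q (Suc n) \<subseteq> (\<Union>q\<in>?Q n. (\<lambda>e. q @ [e]) ` (?E q (awlast v q)))"
      proof
        fix r assume "r \<in> ?Q (Suc n)"
        then obtain w where r: "length r = Suc n" "awalk v r w" "?y r w \<noteq> \<zero>" by blast
        then obtain q e where re: "r = q @ [e]" by (metis length_0_conv nat.distinct(1) rev_exhaust)
        have e: "e \<in> arcs G" "head G e = w" "awalk v q (tail G e)"
          using r(2) re by (auto simp: awalk_Cons_iff awalk_Nil_iff)
        have last: "awlast v q = tail G e" using e(3) by auto
        have nz: "act (word [Ghost e]) (?y q (tail G e)) \<noteq> \<zero>"
          using act_ghost_nf[OF e(3,1) xc] r(3) re e(2) by simp
        then have "?y q (tail G e) \<noteq> \<zero>" using act_zero_right[OF edge_ghost_free_plus(2)[OF e(1)]] by auto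
        then have "q \<in> ?Q n" using r(1) re e(3) by auto
        moreover have "e \<in> ?E q (awlast v q)" using nz e(1) last by simp
        ultimately show "r \<in> (\<Union>q\<in>?Q n. (\<lambda>e. q @ [e]) ` (?E q (awlast v q)))" using re by blast
      qed
      moreover have "finite (\<Union>q\<in>?Q n. (\<lambda>e. q @ [e]) ` (?E q (awlast v q)))"
      proof (rule finite_UN_I[OF Suc finite_imageI])
        fix q assume "q \<in> ?Q n"
        then obtain w where q: "awalk v q w" by blast
        then have "awlast v q = w" by auto
        then show "finite (?E q (awlast v q))" using False q by blast
      qed
      ultimately show ?case by (rule finite_subset)
    qed
    then have "countable (\<Union>n. ?Q n)" by (intro countable_UN countableI_type countable_finite)
    then have "countable ((\<lambda>q. awlast v q) ` (\<Union>n. ?Q n))" by (rule countable_image)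
    moreover have "?D \<subseteq> (\<lambda>q. awlast v q) ` (\<Union>n. ?Q n)"
    proof
      fix w assume "w \<in> ?D"
      then obtain q where q: "awalk v q w" "?y q w \<noteq> \<zero>" by blast
      then have "w = awlast v q" by auto
      moreover have "q \<in> (\<Union>n. ?Q n)" using q by auto
      ultimately show "w \<in> (\<lambda>q. awlast v q) ` (\<Union>n. ?Q n)" by blast
    qed
    ultimately have "countable ?D" by (rule countable_subset[rotated])
    moreover have "?T \<subseteq> root_set G ?D"
    proof
      fix u assume "u \<in> ?T"
      then obtain p q w where "awalk u p w" "awalk v q w" "?y q w \<noteq> \<zero>"
        using support_reach[OF x vV] by blast
      then show "u \<in> root_set G ?D" unfolding root_set_iff using reachable_awalkI by blast
    qed
    ultimately show ?thesis using up[OF DT] DT by blast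
  qed
qed

end

section \<open>Construction of infinite paths and cycles\<close>

context wf_digraph begin

lemma awalk_nth: "\<lbrakk>awalk u p v; Suc i < length p\<rbrakk> \<Longrightarrow> head G (p ! i) = tail G (p ! Suc i)"
proof (induction p arbitrary: u i)
  case (Cons e p)
  then obtain f q where "p = f # q" by (cases p) auto
  then show ?case using Cons by (cases i) (auto simp: awalk_Cons_iff)
qed simp

lemma concatenated_path:
  assumes walk: "\<And>n. awalk (U n) (P n) (U (Suc n))" and ne: "\<And>n. P n \<noteq> []"
  shows "\<exists>\<alpha> k. infinite_path G \<alpha> \<and> k 0 = (0::nat) \<and> strict_mono k \<and> (\<forall>n. tail G (\<alpha> (k n)) = U n)"
proof -
  define A where "A n = concat (map P [0..<n])" for n
  have A_Suc: "A (Suc n) = A n @ P n" for n by (simp add: A_def)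
  have A_walk: "awalk (U 0) (A n) (U n)" for n
  proof (induction n)
    case 0
    have "U 0 \<in> verts G" using walk[of 0] by blast
    then show ?case by (simp add: A_def awalk_Nil_iff)
  next
    case (Suc n)
    then show ?case unfolding A_Suc using walk[of n] awalk_appendI by blast
  qed
  let ?k = "\<lambda>n. length (A n)"
  have mono: "strict_mono ?k" unfolding strict_mono_Suc_iff using ne by (simp add: A_Suc)
  have ge: "n \<le> ?k n" for n using mono by (rule strict_mono_imp_increasing)
  have prefix: "\<exists>r. A m = A n @ r" if "n \<le> m" for n m
    using that by (induction m rule: dec_induct) (auto simp: A_Suc)
  \<comment> \<open>No factor is empty, so \<open>A (Suc j)\<close> has length at least
    \<open>Suc j\<close> and the index is in range; longer prefixes agree there.\<close>
  define \<alpha> where "\<alpha> j = A (Suc j) ! j" for j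
  have \<alpha>: "\<alpha> j = A n ! j" if "j < ?k n" for j n
  proof -
    have "j < ?k (Suc j)" using ge[of "Suc j"] by simp
    show ?thesis
    proof (cases "Suc j \<le> n")
      case True
      then obtain r where "A n = A (Suc j) @ r" using prefix by blast
      then show ?thesis using \<open>j < ?k (Suc j)\<close> by (simp add: \<alpha>_def nth_append)
    next
      case False
      then obtain r where "A (Suc j) = A n @ r" using prefix[of n "Suc j"] by auto
      then show ?thesis using that by (simp add: \<alpha>_def nth_append)
    qed
  qed
  have "infinite_path G \<alpha>" unfolding infinite_path_def
  proof (intro allI conjI)
    fix n
    have len: "Suc n < ?k (Suc (Suc n))" using ge[of "Suc (Suc n)"] by simp
    then have eq: "\<alpha> n = A (Suc (Suc n)) ! n" "\<alpha> (Suc n) = A (Suc (Suc n)) ! Suc n" using \<alpha> by auto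
    have "A (Suc (Suc n)) ! n \<in> set (A (Suc (Suc n)))" using len by (intro nth_mem) simp
    then show "\<alpha> n \<in> arcs G" unfolding eq using awalk_arcs[OF A_walk[of "Suc (Suc n)"]] by blast
    show "head G (\<alpha> n) = tail G (\<alpha> (Suc n))" unfolding eq by (rule awalk_nth[OF A_walk len])
  qed
  moreover have "tail G (\<alpha> (?k n)) = U n" for n
  proof -
    obtain e r where P: "P n = e # r" using ne[of n] by (cases "P n") auto
    have "\<alpha> (?k n) = A (Suc n) ! ?k n" by (rule \<alpha>) (simp add: A_Suc P)
    then show ?thesis using walk[of n] by (simp add: A_Suc P awalk_Cons_iff)
  qed
  moreover have "?k 0 = 0" by (simp add: A_def)
  ultimately show ?thesis using mono by (intro exI[of _ \<alpha>] exI[of _ ?k] conjI allI)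
qed

lemma root_set_subset:
  assumes D: "D \<subseteq> root_set G V"
  shows "root_set G D \<subseteq> root_set G V"
proof
  fix u assume "u \<in> root_set G D"
  then obtain d where "d \<in> D" "u \<rightarrow>\<^sup>* d" unfolding root_set_iff[of _ D] by blast
  then show "u \<in> root_set G V" using D root_set_upward[of u d V] by blast
qed

text \<open>Each step of the choice meets two demands: pass below the \<open>n\<close>-th member of
  an enumeration of \<open>D\<close>, which makes the path cofinal, and leave the strong component
  of the current vertex.\<close>

lemma strictly_decreasing_path_exists:
  assumes D: "countable D" "D \<subseteq> T" "T = root_set G D" and ne: "T \<noteq> {}"
    and directed: "\<And>u v. \<lbrakk>u \<in> T; v \<in> T\<rbrakk> \<Longrightarrow> \<exists>w\<in>T. u \<rightarrow>\<^sup>* w \<and> v \<rightarrow>\<^sup>* w"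
    and nocof: "\<And>v. v \<in> T \<Longrightarrow> root_set G {v} \<noteq> T"
  shows "\<exists>\<alpha>. strictly_decreasing_path G \<alpha> \<and> root_set G (infinite_path_verts G \<alpha>) = T"
proof -
  have up: "u \<in> T" if "u \<rightarrow>\<^sup>* w" "w \<in> T" for u w using that root_set_upward D(3) by blast
  have "D \<noteq> {}" using ne unfolding D(3) root_set_def by blast
  then have range: "range (from_nat_into D) = D" using D(1) by (rule range_from_nat_into)
  let ?R = "\<lambda>n u u'. u \<rightarrow>\<^sup>* u' \<and> \<not> u' \<rightarrow>\<^sup>* u \<and> from_nat_into D n \<rightarrow>\<^sup>* u'"
  have "\<exists>U. \<forall>n. U n \<in> T \<and> ?R n (U n) (U (Suc n))"
  proof (rule dependent_nat_choice)
    show "\<exists>x. x \<in> T" using ne by blast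
    fix u n assume u: "u \<in> T"
    have dn: "from_nat_into D n \<in> T" using range D(2) by blast
    have "root_set G {u} \<subseteq> T" using up u unfolding root_set_iff subset_iff by blast
    then obtain w where w: "w \<in> T" "w \<notin> root_set G {u}" using nocof[OF u] by blast
    then have w: "w \<in> T" "\<not> w \<rightarrow>\<^sup>* u" by (simp_all add: root_set_iff)
    \<comment> \<open>Since \<open>w\<close> does not reach \<open>u\<close>, nothing below
      \<open>w\<close> does; a common successor \<open>b\<close> of \<open>u\<close> and
      \<open>w\<close> is therefore strictly below \<open>u\<close>.\<close>
    obtain a where a: "a \<in> T" "u \<rightarrow>\<^sup>* a" "w \<rightarrow>\<^sup>* a" using directed[OF u w(1)] by blast
    obtain b where b: "b \<in> T" "a \<rightarrow>\<^sup>* b" "from_nat_into D n \<rightarrow>\<^sup>* b" using directed[OF a(1) dn] by blast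
    have "u \<rightarrow>\<^sup>* b" "w \<rightarrow>\<^sup>* b" using a b reachable_trans by blast+
    then show "\<exists>u'. u' \<in> T \<and> ?R n u u'" using b w(2) reachable_trans by blast
  qed
  then obtain U where "\<forall>n. U n \<in> T \<and> ?R n (U n) (U (Suc n))" by (elim exE)
  then have U: "U n \<in> T" "U n \<rightarrow>\<^sup>* U (Suc n)" "\<not> U (Suc n) \<rightarrow>\<^sup>* U n"
    "from_nat_into D n \<rightarrow>\<^sup>* U (Suc n)" for n by simp_all
  have "\<forall>n. \<exists>p. awalk (U n) p (U (Suc n))" using U(2) unfolding reachable_awalk by blast
  then obtain P where P: "\<And>n. awalk (U n) (P n) (U (Suc n))" by metis
  have "P n \<noteq> []" for n
  proof
    assume "P n = []"
    then have "U n = U (Suc n)" "U n \<in> verts G" using P[of n] by (auto simp: awalk_Nil_iff)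
    then show False using U(2,3)[of n] by simp
  qed
  from concatenated_path[of U P, OF P this] obtain \<alpha> k where
    \<alpha>: "infinite_path G \<alpha>" "k 0 = (0::nat)" "strict_mono k" "\<forall>n. tail G (\<alpha> (k n)) = U n" by (elim exE conjE)
  note \<alpha> = \<alpha>(1-3) \<alpha>(4)[rule_format]
  have "strictly_decreasing_path G \<alpha>"
    unfolding strictly_decreasing_path_def strictly_above_def
    by (intro conjI exI[of _ k] allI; (unfold \<alpha>(4))?) (rule \<alpha>(1,2,3) U(2,3))+
  moreover have "root_set G (infinite_path_verts G \<alpha>) = T"
  proof
    have "tail G (\<alpha> j) \<in> T" for j
    proof (rule up)
      show "tail G (\<alpha> j) \<rightarrow>\<^sup>* U j"
        using infinite_path_reachable[OF \<alpha>(1) strict_mono_imp_increasing[OF \<alpha>(3), of j]] unfolding \<alpha>(4) .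
    qed (rule U(1))
    then show "root_set G (infinite_path_verts G \<alpha>) \<subseteq> T"
      unfolding D(3) infinite_path_verts_def by (intro root_set_subset) blast
    show "T \<subseteq> root_set G (infinite_path_verts G \<alpha>)"
    proof
      fix z assume "z \<in> T"
      then obtain d where "d \<in> D" "z \<rightarrow>\<^sup>* d" unfolding D(3) root_set_iff by blast
      moreover from this obtain n where "d = from_nat_into D n" using range by blast
      ultimately have "z \<rightarrow>\<^sup>* U (Suc n)" using U(4) reachable_trans by blast
      then show "z \<in> root_set G (infinite_path_verts G \<alpha>)"
        unfolding root_set_iff infinite_path_verts_def \<alpha>(4)[symmetric] by blast
    qed
  qed
  ultimately show ?thesis by blast
qed

section \<open>Aperiodicity\<close>

lemma periodic_iterate:
  assumes "\<And>n. n \<ge> N \<Longrightarrow> \<alpha> (n + L) = \<alpha> n" "n \<ge> N"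
  shows "\<alpha> (n + k * L) = \<alpha> (n::nat)"
proof (induction k)
  case (Suc k)
  have "\<alpha> (n + k * L + L) = \<alpha> (n + k * L)" by (rule assms(1)) (use assms(2) in simp)
  then show ?case using Suc by (simp add: algebra_simps)
qed simp

text \<open>An eventually periodic path returns to vertices already passed, which strict decrease
  forbids.\<close>

lemma strictly_decreasing_aperiodic:
  assumes "strictly_decreasing_path G \<alpha>" "(L::nat) > 0"
  shows "\<exists>n\<ge>N. \<alpha> (n + L) \<noteq> \<alpha> n"
proof (rule ccontr)
  assume "\<not> ?thesis"
  then have per: "\<alpha> (n + L) = \<alpha> n" if "n \<ge> N" for n using that by blast
  obtain k where k: "infinite_path G \<alpha>" "strict_mono k"
    "\<And>n. strictly_above G (tail G (\<alpha> (k n))) (tail G (\<alpha> (k (Suc n))))"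
    using assms(1) unfolding strictly_decreasing_path_def by blast
  have "k N \<ge> N" using k(2) by (rule strict_mono_imp_increasing)
  from periodic_iterate[where \<alpha> = \<alpha> and N = N and L = L, OF per this] have eq: "\<alpha> (k N + k (Suc N) * L) = \<alpha> (k N)" by blast
  \<comment> \<open>Going on by \<open>k (Suc N)\<close> periods is certainly enough to pass the
    position \<open>k (Suc N)\<close>.\<close>
  have "k (Suc N) \<le> k N + k (Suc N) * L" using assms(2) by (simp add: trans_le_add2)
  from infinite_path_reachable[OF k(1) this] show False
    using k(3)[of N] unfolding eq strictly_above_def by blast
qed

text \<open>The first term that is at least \<open>a\<close> overshoots it by less than
  \<open>L\<close>.\<close>

lemma arithmetic_progression_hits:
  assumes "(n::nat) \<le> a" "L > 0"
  shows "\<exists>k. a \<le> n + k * L \<and> n + k * L < a + L"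
proof -
  have "a \<le> n + a * L" using assms(2) by (cases L) auto
  then have ex: "\<exists>k. a \<le> n + k * L" by blast
  let ?k = "LEAST k. a \<le> n + k * L"
  have ge: "a \<le> n + ?k * L" using LeastI_ex[OF ex] .
  have "n + ?k * L < a + L"
  proof (cases ?k)
    case 0
    then show ?thesis using ge assms by simp
  next
    case (Suc j)
    then have "\<not> a \<le> n + j * L" using not_less_Least[of j "\<lambda>k. a \<le> n + k * L"] by simp
    then show ?thesis using Suc by simp
  qed
  then show ?thesis using ge by blast
qed

text \<open>The union of the intervals from \<open>4\<^sup>j\<close> to \<open>2 \<cdot> 4\<^sup>j\<close> and its complement contain arbitrarily long intervals.\<close>

lemma splitting_set:
  "\<exists>A::nat set. \<forall>n L. L > 0 \<longrightarrow> (\<exists>k. n + k * L \<in> A) \<and> (\<exists>k. n + k * L \<notin> A)"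
proof -
  let ?A = "{n::nat. \<exists>j::nat. 4 ^ j \<le> n \<and> n < 2 * 4 ^ j}"
  have "(\<exists>k. n + k * L \<in> ?A) \<and> (\<exists>k. n + k * L \<notin> ?A)" if L: "L > 0" for n L
  proof
  \<comment> \<open>The exponent \<open>n + L\<close> is chosen so that the interval from
    \<open>4 ^ (n + L)\<close> to \<open>2 * 4 ^ (n + L)\<close> starts no earlier than
    \<open>n\<close> and is at least \<open>L\<close> long.\<close>
  have big: "n + L \<le> 4 ^ (n + L)" using power_gt_expt[of 4 "n + L"] by simp
  obtain k where k: "4 ^ (n + L) \<le> n + k * L" "n + k * L < 4 ^ (n + L) + L"
    using arithmetic_progression_hits[of n "4 ^ (n + L)" L] big L by auto
  then have "4 ^ (n + L) \<le> n + k * L \<and> n + k * L < 2 * 4 ^ (n + L)" using big by linarith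
  then show "\<exists>k. n + k * L \<in> ?A" by blast
  obtain k where k: "2 * 4 ^ (n + L) \<le> n + k * L" "n + k * L < 2 * 4 ^ (n + L) + L"
    using arithmetic_progression_hits[of n "2 * 4 ^ (n + L)" L] big L by auto
  \<comment> \<open>The term lies below \<open>3 * 4 ^ (n + L)\<close>, in the gap between the
    intervals of the exponents \<open>n + L\<close> and \<open>n + L + 1\<close>.\<close>
  have "n + k * L \<notin> ?A"
  proof
    assume "n + k * L \<in> ?A"
    then obtain j where j: "4 ^ j \<le> n + k * L" "n + k * L < 2 * 4 ^ j" by blast
    show False
    proof (cases "j \<le> n + L")
      case True
      then have "(4::nat) ^ j \<le> 4 ^ (n + L)" by (intro power_increasing) auto
      then show ?thesis using j k by linarith
    next
      case False
      then have "(4::nat) ^ Suc (n + L) \<le> 4 ^ j" by (intro power_increasing) auto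
      then show ?thesis using j k big by simp
    qed
  qed
  then show "\<exists>k. n + k * L \<notin> ?A" by blast
  qed
  then show ?thesis by blast
qed

section \<open>Cycles and returning edges\<close>

lemma cycle_through:
  assumes "e \<in> arcs G" "head G e \<rightarrow>\<^sup>* tail G e"
  shows "\<exists>p. cycle (e # p)"
proof -
  from assms(2) obtain p where p: "apath (head G e) p (tail G e)" by (auto simp: reachable_apath)
  then have "cycle (e # p)"
    using assms(1) by (auto simp: cycle_def awalk_Cons_iff apath_def)
  then show ?thesis by blast
qed

lemma cycle_edge_unique:
  assumes "cycle c" "e \<in> set c" "f \<in> set c" "tail G e = tail G f"
  shows "e = f"
  using assms cycle_iff_distinct_sources[OF wf_digraph_axioms, of c] by (auto simp: distinct_map inj_on_def)

text \<open>All vertices on a path into \<open>T\<close> lie in \<open>T\<close>, so each edge of a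
  path that starts on \<open>c\<close> is forced onto \<open>c\<close>.\<close>

lemma cycle_absorbs:
  assumes c: "cycle c" and edge: "\<And>e. \<lbrakk>e \<in> arcs G; tail G e \<in> cycle_verts G c; head G e \<in> T\<rbrakk> \<Longrightarrow> e \<in> set c"
    and up: "\<And>u w. \<lbrakk>u \<rightarrow>\<^sup>* w; w \<in> T\<rbrakk> \<Longrightarrow> u \<in> T" and x: "x \<in> cycle_verts G c" and y: "x \<rightarrow>\<^sup>* y" "y \<in> T"
  shows "y \<in> cycle_verts G c"
  using y
proof (induction rule: reachable_induct)
  case (step y z)
  then obtain e where e: "e \<in> arcs G" "tail G e = y" "head G e = z" by auto
  then have "y \<in> T" using up[OF edge_reachable[OF e(1)]] step.prems by simp
  then have "e \<in> set c" using step.IH edge[OF e(1)] e step.prems by simp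
  then show ?case using cycle_head[OF c] e by blast
qed (use x in simp)

text \<open>
  The path follows a fixed route back to \<open>v\<close>, where the choice between \<open>e\<close> and \<open>f\<close> at time \<open>n\<close> depends
  on a set of times that splits every arithmetic progression.
\<close>

lemma aperiodic_path_exists:
  assumes T: "T = root_set G {v}" and v: "v \<in> verts G"
    and e: "e \<in> out_arcs G v" "head G e \<in> T" and f: "f \<in> out_arcs G v" "head G f \<in> T" and "e \<noteq> f"
  shows "\<exists>\<alpha>. infinite_path G \<alpha> \<and> tail G (\<alpha> 0) = v \<and> range (\<lambda>n. tail G (\<alpha> n)) \<subseteq> T \<and>
    (\<forall>N L. L > 0 \<longrightarrow> (\<exists>n\<ge>N. \<alpha> (n + L) \<noteq> \<alpha> n))"
proof -
  \<comment> \<open>The distance to \<open>v\<close>. The chosen edge \<open>nxt u\<close> decreases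
    it, so the path comes back to \<open>v\<close> again and again.\<close>
  define dist where "dist u = (LEAST n. \<exists>p. awalk u p v \<and> length p = n)" for u
  have "\<exists>g. g \<in> out_arcs G u \<and> head G g \<in> T \<and> dist (head G g) < dist u" if u: "u \<in> T" "u \<noteq> v" for u
  proof -
    have "\<exists>n p. awalk u p v \<and> length p = n" using u(1) T by (auto simp: root_set_iff reachable_awalk)
    from LeastI_ex[OF this] obtain p where p: "awalk u p v" "length p = dist u" unfolding dist_def by blast
    then obtain g q where q: "p = g # q" using u(2) by (cases p) (auto simp: awalk_Nil_iff)
    then have g: "g \<in> arcs G" "tail G g = u" "awalk (head G g) q v" using p by (auto simp: awalk_Cons_iff)
    then have "dist (head G g) \<le> length q" unfolding dist_def by (intro Least_le) blast
    then show ?thesis using g p q T by (auto simp: root_set_iff intro: reachable_awalkI)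
  qed
  then obtain nxt where nxt: "\<And>u. \<lbrakk>u \<in> T; u \<noteq> v\<rbrakk> \<Longrightarrow> nxt u \<in> out_arcs G u \<and> head G (nxt u) \<in> T \<and> dist (head G (nxt u)) < dist u"
    by metis
  obtain A :: "nat set" where A: "\<And>n L. L > 0 \<Longrightarrow> (\<exists>k. n + k * L \<in> A) \<and> (\<exists>k. n + k * L \<notin> A)"
    using splitting_set by blast
  define ch where "ch n u = (if u = v then (if n \<in> A then e else f) else nxt u)" for n u
  define st where "st = rec_nat v (\<lambda>n u. head G (ch n u))"
  have st: "st 0 = v" "st (Suc n) = head G (ch n (st n))" for n by (simp_all add: st_def)
  define \<alpha> where "\<alpha> n = ch n (st n)" for n
  have ch: "ch n u \<in> out_arcs G u \<and> head G (ch n u) \<in> T" if "u \<in> T" for n u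
    using that e f nxt[of u] by (auto simp: ch_def)
  have stT: "st n \<in> T" for n
    by (induction n) (use ch T v in \<open>auto simp: st root_set_iff\<close>)
  have \<alpha>: "\<alpha> n \<in> arcs G" "tail G (\<alpha> n) = st n" "head G (\<alpha> n) = st (Suc n)" for n
    using ch[OF stT] by (auto simp: \<alpha>_def st)
  have path: "infinite_path G \<alpha>" using \<alpha> by (simp add: infinite_path_def)
  have return: "\<exists>m\<ge>n. st m = v" for n
  proof (induction "dist (st n)" arbitrary: n rule: less_induct)
    case less
    show ?case
    proof (cases "st n = v")
      case False
      then have "dist (st (Suc n)) < dist (st n)" using nxt[OF stT[of n] False] by (simp add: st ch_def)
      then show ?thesis using less Suc_leD by blast
    qed blast
  qed
  have "\<exists>n\<ge>N. \<alpha> (n + L) \<noteq> \<alpha> n" if L: "L > 0" for N L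
  proof (rule ccontr)
    assume "\<not> ?thesis"
    then have per: "\<alpha> (n + L) = \<alpha> n" if "n \<ge> N" for n using that by blast
    obtain n where n: "n \<ge> N" "st n = v" using return by blast
    \<comment> \<open>A period would repeat the visit to \<open>v\<close> at all times
      \<open>n + k * L\<close> with the same outgoing edge, although \<open>A\<close> contains some
      of these times and misses others.\<close>
    have it: "\<alpha> (n + k * L) = \<alpha> n" for k by (rule periodic_iterate[where \<alpha> = \<alpha> and N = N and L = L, OF per n(1)])
    have "st (n + k * L) = v" for k using \<alpha>(2)[of "n + k * L"] \<alpha>(2)[of n] n(2) unfolding it by simp
    then have val: "\<alpha> (n + k * L) = (if n + k * L \<in> A then e else f)" for k by (simp add: \<alpha>_def ch_def)
    obtain k k' where "n + k * L \<in> A" "n + k' * L \<notin> A" using A[OF L] by blast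
    then show False using val[of k] val[of k'] it \<open>e \<noteq> f\<close> by simp
  qed
  then show ?thesis using path stT \<alpha>(2)[of 0] st(1) by (intro exI[of _ \<alpha>]) (auto simp: \<alpha>(2))
qed

lemma aperiodic_irrational:
  assumes "infinite_path G \<alpha>" "\<And>N L. L > (0::nat) \<Longrightarrow> \<exists>n\<ge>N. \<alpha> (n + L) \<noteq> \<alpha> n"
  shows "irrational_path G \<alpha>"
  unfolding irrational_path_def rational_path_def
proof (intro conjI assms(1) notI, elim conjE exE)
  fix c assume c: "cycle c" and "tail_equivalent \<alpha> (\<lambda>n. c ! (n mod length c))"
  then obtain m n where mn: "\<And>k. \<alpha> (m + k) = c ! ((n + k) mod length c)" by (auto simp: tail_equivalent_def)
  have "length c > 0" using c by (auto simp: cycle_def)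
  then obtain j where j: "j \<ge> m" "\<alpha> (j + length c) \<noteq> \<alpha> j" using assms(2) by blast
  have "\<alpha> j = c ! ((n + (j - m)) mod length c)" using mn[of "j - m"] j(1) by simp
  moreover have "\<alpha> (j + length c) = c ! ((n + (j - m) + length c) mod length c)"
    using mn[of "j - m + length c"] j(1) by (simp add: algebra_simps)
  ultimately show False using j(2) by simp
qed

text \<open>Every vertex of \<open>T\<close> reaches \<open>v\<close> and hence \<open>u\<close>, so
  returning paths come for free and only the exit is at stake. Without an exit into \<open>T\<close>
  the cycle would absorb \<open>v\<close> and contain both \<open>e\<close> and \<open>f\<close>,
  two edges with the same source.\<close>

lemma extreme_cycle_exists:
  assumes T: "T = root_set G {v}" and v: "v \<in> verts G"
    and e: "e \<in> out_arcs G v" "head G e \<in> T" and f: "f \<in> out_arcs G v" "head G f \<in> T" and "e \<noteq> f"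
    and g: "g \<in> arcs G" "tail G g = u" "head G g \<in> T" and vu: "v \<rightarrow>\<^sup>* u"
  shows "\<exists>c. u \<in> cycle_verts G c \<and> extreme_cycle G T c"
proof -
  have up: "x \<in> T" if "x \<rightarrow>\<^sup>* w" "w \<in> T" for x w using that root_set_upward T by blast
  have toV: "x \<rightarrow>\<^sup>* v" if "x \<in> T" for x using that T by (simp add: root_set_iff)
  have "head G g \<rightarrow>\<^sup>* tail G g" using reachable_trans[OF toV[OF g(3)] vu] g(2) by simp
  then obtain p where c: "cycle (g # p)" using cycle_through[OF g(1)] by blast
  let ?c = "g # p"
  have u: "u \<in> cycle_verts G ?c" using g(2) by (simp add: cycle_verts_def)
  have uT: "u \<in> T" using up[OF edge_reachable[OF g(1)]] g by simp
  have cT: "cycle_verts G ?c \<subseteq> T" using cycle_walk[OF c _ u] up uT by blast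
  have "\<exists>x. is_exit G ?c x \<and> head G x \<in> T"
  proof (rule ccontr)
    assume no: "\<not> ?thesis"
    have edge: "x \<in> set ?c" if "x \<in> arcs G" "tail G x \<in> cycle_verts G ?c" "head G x \<in> T" for x
      using no that unfolding is_exit_def by blast
    have vT: "v \<in> T" using v T by (simp add: root_set_iff)
    have vc: "v \<in> cycle_verts G ?c" by (rule cycle_absorbs[OF c edge up u toV[OF uT] vT])
    have "e \<in> set ?c" "f \<in> set ?c" using edge[of e] edge[of f] e f vc by auto
    then show False using cycle_edge_unique[OF c] e f \<open>e \<noteq> f\<close> by auto
  qed
  moreover have "\<exists>q. is_path G q \<and> path_verts G q \<subseteq> T \<and> fst q = path_range G p \<and> path_range G q \<in> cycle_verts G ?c"
    if p: "is_path G p" "path_verts G p \<subseteq> T" for p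
  proof -
    have "path_range G p \<in> path_verts G p" by (simp add: path_range_def path_verts_def)
    then have "path_range G p \<in> T" using p(2) by blast
    then have "path_range G p \<rightarrow>\<^sup>* u" using toV vu reachable_trans by blast
    then obtain q where q: "awalk (path_range G p) q u" by (auto simp: reachable_awalk)
    have "is_path G (path_range G p, q)" unfolding is_path_def using q by auto
    moreover have "path_range G (path_range G p, q) = u" using awlast_of_awalk[OF q] by (simp add: path_range_def)
    moreover have "path_verts G (path_range G p, q) \<subseteq> T"
      using awalk_verts_reachable_to[OF q] up uT by (auto simp: path_verts_def)
    ultimately show ?thesis using u by (intro exI[of _ "(path_range G p, q)"]) simp
  qed
  ultimately have "extreme_cycle G T ?c" unfolding extreme_cycle_def using c cT by blast
  then show ?thesis using u by blast
qed

lemma cycle_successor: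
  assumes "cycle c" "i < length c"
  shows "tail G (c ! (Suc i mod length c)) = head G (c ! i)"
proof -
  obtain u where u: "awalk u c u" "c \<noteq> []" using assms(1) by (auto simp: cycle_def)
  show ?thesis
  proof (cases "Suc i < length c")
    case True
    then show ?thesis using awalk_nth[OF u(1) True] by simp
  next
    case False
    then have i: "Suc i = length c" using assms(2) by simp
    have "tail G (c ! 0) = u" using u by (cases c) (auto simp: awalk_Cons_iff)
    moreover have "awalk u (butlast c @ [last c]) u" using u by simp
    then have "head G (last c) = u" unfolding awalk_append_iff by (auto simp: awalk_Cons_iff awalk_Nil_iff)
    moreover have "last c = c ! i" using u(2) i by (metis diff_Suc_1 last_conv_nth)
    ultimately show ?thesis using i by simp
  qed
qed

text \<open>When at most one edge returns at each vertex of the strong component of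
  \<open>x\<close>, a cycle there is determined by any of its vertices: two cycles that meet run
  through the same edges from the common vertex on.\<close>

lemma deterministic_exclusive_cycle:
  assumes c: "cycle c"
    and det: "\<And>e f. \<lbrakk>e \<in> arcs G; f \<in> arcs G; tail G e = tail G f; tail G e \<rightarrow>\<^sup>* x; x \<rightarrow>\<^sup>* tail G e;
      head G e \<rightarrow>\<^sup>* tail G e; head G f \<rightarrow>\<^sup>* tail G e\<rbrakk> \<Longrightarrow> e = f"
    and x: "x \<in> cycle_verts G c"
  shows "exclusive_cycle G c"
  unfolding exclusive_cycle_def
proof (intro conjI c allI impI, elim conjE)
  fix d assume d: "cycle d" and nd: "\<not> same_cycle c d"
  show "cycle_verts G c \<inter> cycle_verts G d = {}"
  proof (rule ccontr)
    assume "cycle_verts G c \<inter> cycle_verts G d \<noteq> {}"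
    then obtain e f where ef: "e \<in> set c" "f \<in> set d" "tail G e = tail G f"
      unfolding cycle_verts_def by blast
    obtain i j where "i < length c" "c ! i = e" "j < length d" "d ! j = f"
      using ef(1,2) unfolding in_set_conv_nth by blast
    with ef(3) have ij: "i < length c" "j < length d" "tail G (c ! i) = tail G (d ! j)" by simp_all
    let ?n = "length c" and ?m = "length d"
    have len: "?n > 0" "?m > 0" using ij by linarith+
    have arcs: "set b \<subseteq> arcs G" if "cycle b" for b using that awalk_arcs by (auto simp: cycle_def)
    have dist: "distinct b" if "cycle b" for b
      using that cycle_iff_distinct_sources[OF wf_digraph_axioms, of b] by (simp add: distinct_map)
    have eq: "c ! ((i + k) mod ?n) = d ! ((j + k) mod ?m)" for k
    proof -
      have tails: "tail G (c ! ((i + k) mod ?n)) = tail G (d ! ((j + k) mod ?m)) \<Longrightarrow> c ! ((i + k) mod ?n) = d ! ((j + k) mod ?m)" for k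
      proof -
        assume t: "tail G (c ! ((i + k) mod ?n)) = tail G (d ! ((j + k) mod ?m))"
        let ?e = "c ! ((i + k) mod ?n)" and ?f = "d ! ((j + k) mod ?m)"
        have e: "?e \<in> set c" "?f \<in> set d" using len by simp_all
        have ec: "tail G ?e \<in> cycle_verts G c" "tail G ?f \<in> cycle_verts G d" using e by (auto simp: cycle_verts_def)
        show "?e = ?f"
        proof (rule det[OF _ _ t])
          show "?e \<in> arcs G" "?f \<in> arcs G" using arcs[OF c] arcs[OF d] e by blast+
          show "tail G ?e \<rightarrow>\<^sup>* x" "x \<rightarrow>\<^sup>* tail G ?e" using cycle_walk[OF c] ec x by blast+
          show "head G ?e \<rightarrow>\<^sup>* tail G ?e" by (rule cycle_walk[OF c cycle_head[OF c e(1)] ec(1)])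
          show "head G ?f \<rightarrow>\<^sup>* tail G ?e" unfolding t by (rule cycle_walk[OF d cycle_head[OF d e(2)] ec(2)])
        qed
      qed
      show ?thesis
      proof (induction k)
        case 0
        show ?case by (rule tails) (use ij in simp)
      next
        case (Suc k)
        have "tail G (c ! (Suc ((i + k) mod ?n) mod ?n)) = tail G (d ! (Suc ((j + k) mod ?m) mod ?m))"
          using cycle_successor[OF c, of "(i + k) mod ?n"] cycle_successor[OF d, of "(j + k) mod ?m"] Suc len by simp
        then show ?case by (intro tails) (simp add: mod_Suc_eq)
      qed
    qed
    have cong: "s mod length b = t mod length b" if "cycle b" "b ! (s mod length b) = b ! (t mod length b)" for b s t
    proof -
      have "length b > 0" using that(1) by (auto simp: cycle_def)
      then show ?thesis using nth_eq_iff_index_eq[OF dist[OF that(1)]] that(2) by simp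
    qed
    \<comment> \<open>After \<open>?n\<close> steps the edge of \<open>c\<close> recurs, hence that
      of \<open>d\<close> does too; as \<open>d\<close> repeats no edge, its length divides
      \<open>?n\<close>.\<close>
    have "(j + ?n) mod ?m = (j + 0) mod ?m" using eq[of ?n] eq[of 0] by (intro cong[OF d]) simp
    then have "?m dvd ?n" by (metis add_diff_cancel_left' add.right_neutral le_add1 mod_eq_dvd_iff_nat)
    moreover have "(i + ?m) mod ?n = (i + 0) mod ?n" using eq[of ?m] eq[of 0] by (intro cong[OF c]) simp
    then have "?n dvd ?m" by (metis add_diff_cancel_left' add.right_neutral le_add1 mod_eq_dvd_iff_nat)
    ultimately have nm: "?n = ?m" by (simp add: dvd_antisym)
    \<comment> \<open>Position \<open>j\<close> of \<open>d\<close> matches position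
      \<open>i\<close> of \<open>c\<close>; the offset \<open>i - j\<close> is raised by
      \<open>?n\<close> to remain a natural number.\<close>
    have "d = rotate (i + (?n - j)) c"
    proof (rule nth_equalityI)
      fix k assume k: "k < length d"
      have "d ! k = d ! ((j + (?n - j + k)) mod ?m)" using k ij nm by simp
      also have "\<dots> = c ! ((i + (?n - j + k)) mod ?n)" using eq[of "?n - j + k"] by simp
      also have "\<dots> = rotate (i + (?n - j)) c ! k" using k nm by (simp add: nth_rotate algebra_simps)
      finally show "d ! k = rotate (i + (?n - j)) c ! k" .
    qed (use nm in simp)
    then show False using nd unfolding same_cycle_def by blast
  qed
qed

end

section \<open>The type of an annihilator\<close>

definition edges_into :: "('v, 'e) pre_digraph \<Rightarrow> 'v set \<Rightarrow> 'v \<Rightarrow> 'e set" where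
  "edges_into E T v = {e \<in> out_arcs E v. head E e \<in> T}"

definition cofinal :: "('v, 'e) pre_digraph \<Rightarrow> 'v set \<Rightarrow> 'v set" where
  "cofinal E T = {v \<in> T. root_set E {v} = T}"

text \<open>Intended for \<open>T = support E I\<close> and \<open>B = defects E I\<close>; \<open>cofinal E T\<close> is then the strong component at the bottom of \<open>T\<close>.\<close>

fun invariants_of_type :: "('v, 'e) pre_digraph \<Rightarrow> module_type \<Rightarrow> 'v set \<Rightarrow> 'v set \<Rightarrow> bool" where
  "invariants_of_type E Decreasing_path_type T B \<longleftrightarrow> cofinal E T = {}"
| "invariants_of_type E Relative_sink_type T B \<longleftrightarrow> (\<exists>v\<in>cofinal E T. edges_into E T v = {})"
| "invariants_of_type E Extreme_cycle_type T B \<longleftrightarrow>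
     (\<exists>v\<in>cofinal E T. (\<exists>e\<in>edges_into E T v. \<exists>f\<in>edges_into E T v. e \<noteq> f) \<and> (B = {} \<or> B = {v}))"
| "invariants_of_type E Exclusive_cycle_type T B \<longleftrightarrow>
     (\<exists>v\<in>cofinal E T. edges_into E T v \<noteq> {} \<and>
       (B = {} \<and> (\<forall>w\<in>cofinal E T. \<forall>e\<in>edges_into E T w. \<forall>f\<in>edges_into E T w. e = f) \<or>
        B = {v} \<and> (\<forall>e\<in>edges_into E T v. \<forall>f\<in>edges_into E T v. e = f)))"

section \<open>Uniqueness of the type\<close>

context wf_digraph begin

lemma returning_edges_into: "returning_edges G v = edges_into G (root_set G {v}) v"
  by (simp add: returning_edges_def edges_into_def)

lemma cofinal_reach: "\<lbrakk>v \<in> cofinal G T; u \<in> T\<rbrakk> \<Longrightarrow> u \<rightarrow>\<^sup>* v"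
  unfolding cofinal_def root_set_def by blast

lemma cofinal_upward: "\<lbrakk>v \<in> cofinal G T; u \<rightarrow>\<^sup>* w; w \<in> T\<rbrakk> \<Longrightarrow> u \<in> T"
  using root_set_upward[of u w "{v}"] unfolding cofinal_def by blast

text \<open>A path from \<open>v\<close> to another cofinal vertex would begin with an edge into
  \<open>T\<close>.\<close>

lemma cofinal_singleton:
  assumes v: "v \<in> cofinal G T" "edges_into G T v = {}" and w: "w \<in> cofinal G T"
  shows "w = v"
proof (rule ccontr)
  assume "w \<noteq> v"
  have "v \<rightarrow>\<^sup>* w" using cofinal_reach[OF w] v(1) by (simp add: cofinal_def)
  then obtain p where p: "awalk v p w" by (auto simp: reachable_awalk)
  then obtain e q where "p = e # q" using \<open>w \<noteq> v\<close> by (cases p) (auto simp: awalk_Nil_iff)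
  then have e: "e \<in> arcs G" "tail G e = v" "awalk (head G e) q w" using p by (auto simp: awalk_Cons_iff)
  then have "head G e \<in> T" using cofinal_upward[OF w reachable_awalkI] w by (simp add: cofinal_def)
  then show False using e v(2) by (auto simp: edges_into_def)
qed

lemma cofinal_self:
  assumes "v \<in> verts G"
  shows "v \<in> cofinal G (root_set G {v})"
  using assms by (simp add: cofinal_def root_set_iff)

lemma cofinalI:
  assumes "v \<in> T" "\<And>u w. \<lbrakk>u \<rightarrow>\<^sup>* w; w \<in> T\<rbrakk> \<Longrightarrow> u \<in> T" "\<And>u. u \<in> T \<Longrightarrow> u \<rightarrow>\<^sup>* v"
  shows "v \<in> cofinal G T"
proof -
  have "root_set G {v} = T"
  proof (intro subset_antisym subsetI)
    fix u assume "u \<in> root_set G {v}"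
    then show "u \<in> T" using assms(2)[OF _ assms(1)] by (simp add: root_set_iff)
  qed (simp add: root_set_iff assms(3))
  then show ?thesis using assms(1) by (simp add: cofinal_def)
qed

text \<open>The decreasing type has no cofinal vertex; the sink type has exactly one, and it emits
  no edge into \<open>T\<close>. Between the cycle types, a nonempty \<open>B\<close> makes both
  conditions speak of the same vertex, and for empty \<open>B\<close> the exclusive type bounds the
  edges at all cofinal vertices, including the one where the extreme type finds two.\<close>

lemma invariants_of_type_unique:
  assumes "invariants_of_type G t T B" "invariants_of_type G t' T B"
  shows "t = t'"
proof -
  have sink: "\<And>w. w \<in> cofinal G T \<Longrightarrow> edges_into G T w = {}" if "invariants_of_type G Relative_sink_type T B"
    using that cofinal_singleton by auto
  have exc: "\<not> invariants_of_type G Exclusive_cycle_type T B" if "invariants_of_type G Extreme_cycle_type T B"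
  proof
    obtain v e f where v: "v \<in> cofinal G T" "e \<in> edges_into G T v" "f \<in> edges_into G T v" "e \<noteq> f" "B = {} \<or> B = {v}"
      using \<open>invariants_of_type G Extreme_cycle_type T B\<close> by auto
    assume "invariants_of_type G Exclusive_cycle_type T B"
    then obtain w where "w \<in> cofinal G T" "B = {} \<and> (\<forall>w\<in>cofinal G T. \<forall>e\<in>edges_into G T w. \<forall>f\<in>edges_into G T w. e = f) \<or>
        B = {w} \<and> (\<forall>e\<in>edges_into G T w. \<forall>f\<in>edges_into G T w. e = f)" by auto
    then show False using v by blast
  qed
  have s1: "\<not> invariants_of_type G Extreme_cycle_type T B" "\<not> invariants_of_type G Exclusive_cycle_type T B"
    if "invariants_of_type G Relative_sink_type T B"
    using sink[OF that] by auto
  have d: "\<not> invariants_of_type G s T B" if "invariants_of_type G Decreasing_path_type T B" "s \<noteq> Decreasing_path_type" for s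
    using that by (cases s) simp_all
  show ?thesis
  proof (cases "t = Decreasing_path_type \<or> t' = Decreasing_path_type")
    case True
    then show ?thesis
    proof
      assume "t = Decreasing_path_type"
      then show ?thesis using d[of t'] assms by metis
    next
      assume "t' = Decreasing_path_type"
      then show ?thesis using d[of t] assms by metis
    qed
  next
    case False
    then show ?thesis using exc s1 assms by (cases t; cases t') blast+
  qed
qed

text \<open>An exit into the support and the cycle edge with the same source are two edges at one
  vertex. Extremality brings every vertex of the path back to the cycle, which makes that vertex
  cofinal.\<close>

lemma V_invariants:
  assumes "irrational_path G \<alpha>"
    and ext: "\<forall>u\<in>infinite_path_verts G \<alpha>. \<exists>c. u \<in> cycle_verts G c \<and>
      extreme_cycle G (root_set G (infinite_path_verts G \<alpha>)) c"
  shows "invariants_of_type G Extreme_cycle_type (root_set G (infinite_path_verts G \<alpha>)) {}"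
proof -
  let ?T = "root_set G (infinite_path_verts G \<alpha>)"
  have path: "infinite_path G \<alpha>" using assms(1) by (simp add: irrational_path_def)
  have vT: "tail G (\<alpha> n) \<in> ?T" for n
  proof -
    have "tail G (\<alpha> n) \<in> verts G" using path by (simp add: infinite_path_def)
    then have "tail G (\<alpha> n) \<rightarrow>\<^sup>* tail G (\<alpha> n)" by (rule reachable_refl)
    then show ?thesis unfolding root_set_iff infinite_path_verts_def by (rule bexI) (rule rangeI)
  qed
  have "tail G (\<alpha> 0) \<in> infinite_path_verts G \<alpha>" unfolding infinite_path_verts_def by (rule rangeI)
  with ext obtain c where c: "tail G (\<alpha> 0) \<in> cycle_verts G c" "extreme_cycle G ?T c" by blast
  have cyc: "cycle c" and cT: "cycle_verts G c \<subseteq> ?T" and exits: "\<exists>e. is_exit G c e \<and> head G e \<in> ?T"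
    and ret: "\<And>p. \<lbrakk>is_path G p; fst p \<in> cycle_verts G c; path_verts G p \<subseteq> ?T\<rbrakk> \<Longrightarrow>
      \<exists>q. is_path G q \<and> path_verts G q \<subseteq> ?T \<and> fst q = path_range G p \<and> path_range G q \<in> cycle_verts G c"
    using c(2) unfolding extreme_cycle_def by blast+
  obtain e where e: "e \<in> arcs G" "e \<notin> set c" "tail G e \<in> cycle_verts G c" "head G e \<in> ?T"
    using exits unfolding is_exit_def by blast
  let ?v = "tail G e"
  obtain f where f: "f \<in> set c" "tail G f = ?v" using e(3) by (auto simp: cycle_verts_def)
  have fa: "f \<in> arcs G" using f(1) cyc awalk_arcs unfolding cycle_def by blast
  have "?v \<in> cofinal G ?T"
  proof (rule cofinalI)
    show "?v \<in> ?T" using e(3) cT by blast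
    show "u \<in> ?T" if "u \<rightarrow>\<^sup>* w" "w \<in> ?T" for u w by (rule root_set_upward[OF that])
    fix u assume "u \<in> ?T"
    then obtain n where n: "u \<rightarrow>\<^sup>* tail G (\<alpha> n)" unfolding root_set_iff infinite_path_verts_def by blast
    obtain p where p: "awalk (tail G (\<alpha> 0)) p (tail G (\<alpha> n))"
      using infinite_path_reachable[OF path, of 0 n] unfolding reachable_awalk by blast
    have "path_verts G (tail G (\<alpha> 0), p) \<subseteq> ?T"
      using awalk_verts_reachable_to[OF p] root_set_upward[OF _ vT] unfolding path_verts_def by auto
    moreover have "is_path G (tail G (\<alpha> 0), p)" unfolding is_path_def using p by auto
    moreover have "path_range G (tail G (\<alpha> 0), p) = tail G (\<alpha> n)" using awlast_of_awalk[OF p] by (simp add: path_range_def)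
    ultimately obtain q where q: "is_path G q" "fst q = tail G (\<alpha> n)" "path_range G q \<in> cycle_verts G c"
      using ret[of "(tail G (\<alpha> 0), p)"] c(1) by auto
    obtain y where y: "awalk (fst q) (snd q) y" using q(1) unfolding is_path_def by blast
    have "path_range G q = y" using awlast_of_awalk[OF y] by (simp add: path_range_def)
    then have "tail G (\<alpha> n) \<rightarrow>\<^sup>* y" "y \<rightarrow>\<^sup>* ?v"
      using y q(2,3) cycle_walk[OF cyc _ e(3)] reachable_awalkI[OF y] by simp_all
    then show "u \<rightarrow>\<^sup>* ?v" using n reachable_trans by blast
  qed
  moreover have "e \<in> edges_into G ?T ?v" using e by (simp add: edges_into_def)
  moreover have "f \<in> edges_into G ?T ?v" using f fa cycle_head[OF cyc f(1)] cT by (auto simp: edges_into_def)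
  moreover have "e \<noteq> f" using e f by blast
  ultimately show ?thesis unfolding invariants_of_type.simps by blast
qed

text \<open>An edge from \<open>c\<close> into the support returns to \<open>c\<close>, so
  exclusiveness puts it on \<open>c\<close>. Hence the cofinal vertices lie on \<open>c\<close> and
  each has a single edge into the support.\<close>

lemma N_cycle_invariants:
  assumes c: "exclusive_cycle G c" and v: "v \<in> cycle_verts G c"
  shows "invariants_of_type G Exclusive_cycle_type (root_set G {v}) {}"
proof -
  let ?T = "root_set G {v}"
  have cyc: "cycle c" using c by (simp add: exclusive_cycle_def)
  have vV: "v \<in> verts G" using cycle_verts_verts[OF cyc] v by blast
  have vC: "v \<in> cofinal G ?T" by (rule cofinal_self[OF vV])
  have toC: "x \<rightarrow>\<^sup>* y" if "x \<in> ?T" "y \<in> cycle_verts G c" for x y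
    using that(1) cycle_walk[OF cyc v that(2)] reachable_trans unfolding root_set_iff by blast
  have edge: "e \<in> set c" if "e \<in> arcs G" "tail G e \<in> cycle_verts G c" "head G e \<in> ?T" for e
    by (rule exclusive_cycle_edge[OF c that(1,2) toC[OF that(3,2)]])
  have ne: "edges_into G ?T v \<noteq> {}"
  proof -
    obtain f where f: "f \<in> set c" "tail G f = v" using v by (auto simp: cycle_verts_def)
    have "f \<in> arcs G" using f(1) cyc awalk_arcs unfolding cycle_def by blast
    moreover have "head G f \<in> ?T" using cycle_walk[OF cyc cycle_head[OF cyc f(1)] v] by (simp add: root_set_iff)
    ultimately show ?thesis using f by (auto simp: edges_into_def)
  qed
  have uniq: "e = f" if w: "w \<in> cofinal G ?T" and ef: "e \<in> edges_into G ?T w" "f \<in> edges_into G ?T w" for w e f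
  proof -
    have "v \<in> ?T" using vC by (simp add: cofinal_def)
    then have vw: "v \<rightarrow>\<^sup>* w" by (rule cofinal_reach[OF w])
    have wT: "w \<in> ?T" using w by (simp add: cofinal_def)
    have "w \<in> cycle_verts G c"
      by (rule cycle_absorbs[where T = ?T, OF cyc edge cofinal_upward[OF vC] v vw wT])
    then have "e \<in> set c" "f \<in> set c" using edge[of e] edge[of f] ef by (auto simp: edges_into_def)
    then show ?thesis using cycle_edge_unique[OF cyc] ef by (auto simp: edges_into_def)
  qed
  show ?thesis unfolding invariants_of_type.simps
  proof (rule bexI[OF _ vC], intro conjI disjI1 ballI)
    fix w e f assume "w \<in> cofinal G ?T" "e \<in> edges_into G ?T w" "f \<in> edges_into G ?T w"
    then show "e = f" by (rule uniq)
  qed (rule ne, rule refl)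
qed

text \<open>\<open>K\<close> is formed from \<open>I\<close> alone, so the invariants do not depend
  on the module that realizes \<open>I\<close>; this makes the types exclude each other.\<close>

lemma annihilator_of_type_invariants:
  fixes I :: "('a, 'b, 'k::field) free_elem set set"
  assumes "annihilator_of_type G t I"
  defines "K \<equiv> {a \<in> free_plus G. leavitt_class G a \<in> I}"
  shows "invariants_of_type G t (support G K) (defects G K)"
proof -
  have K: "K = ann_kernel G N" if "I = annihilator (leavitt_algebra G) N"
    for N :: "(('a, 'b, 'k) free_elem set, 'n, 's) module_scheme"
    unfolding K_def that by (auto simp: ann_kernel_def annihilator_def leavitt_algebra_carrier)
  have emitter: "defects G K = (if finite (returning_edges G v) then {v} else {})" "support G K = root_set G {v}"
      "v \<in> cofinal G (root_set G {v})"
    if "infinite_emitter G v" "I = annihilator (leavitt_algebra G) (N_module G v)" for v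
    using N_support(1,2)[of v, where 'k = 'k] that K[OF that(2)] cofinal_self[of v] by (auto simp: infinite_emitter_def)
  show ?thesis
  proof (cases t)
    case Decreasing_path_type
    then obtain \<alpha> where \<alpha>: "strictly_decreasing_path G \<alpha>"
      "\<forall>v\<in>root_set G (infinite_path_verts G \<alpha>). root_set G {v} \<subset> root_set G (infinite_path_verts G \<alpha>)"
      "I = annihilator (leavitt_algebra G) (V_module G \<alpha>)" using assms(1) by auto
    then have "infinite_path G \<alpha>" by (simp add: strictly_decreasing_path_def)
    then have "support G K = root_set G (infinite_path_verts G \<alpha>)" using V_support K[OF \<alpha>(3)] by simp
    then show ?thesis using \<alpha>(2) Decreasing_path_type by (auto simp: cofinal_def)
  next
    case Relative_sink_type
    then obtain v where v: "sink G v \<or> infinite_emitter G v \<and> returning_edges G v = {}"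
      "I = annihilator (leavitt_algebra G) (N_module G v)" using assms(1) by auto
    then have "sink G v \<or> infinite_emitter G v" by blast
    then have T: "support G K = root_set G {v}" using N_support(1)[of v] K[OF v(2)] by simp
    have "v \<in> verts G" using v(1) by (auto simp: sink_def infinite_emitter_def)
    then have "v \<in> cofinal G (support G K)" unfolding T by (rule cofinal_self)
    moreover have "edges_into G (support G K) v = {}"
      using v(1) unfolding T returning_edges_into by (auto simp: sink_def edges_into_def)
    ultimately show ?thesis using Relative_sink_type by auto
  next
    case Extreme_cycle_type
    then consider (V) \<alpha> where "irrational_path G \<alpha>"
        "\<forall>u\<in>infinite_path_verts G \<alpha>. \<exists>c. u \<in> cycle_verts G c \<and>
           extreme_cycle G (root_set G (infinite_path_verts G \<alpha>)) c"
        "I = annihilator (leavitt_algebra G) (V_module G \<alpha>)"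
      | (N) v where "infinite_emitter G v" "infinite (returning_edges G v) \<or>
         finite (returning_edges G v) \<and> card (returning_edges G v) > 1"
        "I = annihilator (leavitt_algebra G) (N_module G v)" using assms(1) by auto
    then show ?thesis
    proof cases
      case V
      then have "infinite_path G \<alpha>" by (simp add: irrational_path_def)
      then have "support G K = root_set G (infinite_path_verts G \<alpha>)" "defects G K = {}"
        using V_support K[OF V(3)] by simp_all
      then show ?thesis using V_invariants[OF V(1,2)] Extreme_cycle_type by simp
    next
      case N
      note inv = emitter[OF N(1,3)]
      obtain e f where "e \<in> returning_edges G v" "f \<in> returning_edges G v" "e \<noteq> f"
      proof -
        have "\<not> is_singleton (returning_edges G v)" "returning_edges G v \<noteq> {}"
          using N(2) by (auto simp: is_singleton_altdef card_eq_0_iff)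
        then show thesis using that unfolding is_singleton_def by blast
      qed
      then show ?thesis using inv Extreme_cycle_type unfolding returning_edges_into
        by (auto intro!: bexI[of _ v])
    qed
  next
    case Exclusive_cycle_type
    then consider (c) c v where "exclusive_cycle G c" "v \<in> cycle_verts G c"
        "I = annihilator (leavitt_algebra G) (N_cycle_module G c v)"
      | (N) v where "infinite_emitter G v" "card (returning_edges G v) = 1"
        "I = annihilator (leavitt_algebra G) (N_module G v)" using assms(1) by auto
    then show ?thesis
    proof cases
      case c
      then have "support G K = root_set G {v}" "defects G K = {}"
        using N_cycle_support(1,2) K[OF c(3)] by simp_all
      then show ?thesis using N_cycle_invariants[OF c(1,2)] Exclusive_cycle_type by simp
    next
      case N
      note inv = emitter[OF N(1,3)]
      obtain e where e: "returning_edges G v = {e}" using N(2) by (auto simp: card_1_singleton_iff)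
      then have "defects G K = {v}" using inv by simp
      moreover have "edges_into G (support G K) v = {e}" using e inv by (simp add: returning_edges_into)
      ultimately show ?thesis using inv Exclusive_cycle_type by (auto intro!: bexI[of _ v])
    qed
  qed
qed

end

section \<open>Existence of a type\<close>

context graded_simple_module begin

lemma same_annihilatorI:
  assumes "leavitt_module G N" "leavitt_kernel.graded_kernel G (ann_kernel G N)"
    and "support G (ann_kernel G N) = support G kernel" "defects G (ann_kernel G N) = defects G kernel"
  shows "annihilator (leavitt_algebra G) M = annihilator (leavitt_algebra G) N"
proof -
  have "kernel = ann_kernel G N"
    by (rule graded_kernels_eq[OF leavitt_kernel_ann_kernel graded_kernel
          leavitt_module.leavitt_kernel_ann_kernel[OF assms(1)] assms(2) assms(3)[symmetric] assms(4)[symmetric]])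
  then show ?thesis by (simp add: annihilator_eq_iff_ann_kernel_eq[OF wf_digraph_axioms])
qed

lemma same_annihilator_N:
  assumes "sink G v \<or> infinite_emitter G v" "support G kernel = root_set G {v}"
    "defects G kernel = (if infinite_emitter G v \<and> finite (returning_edges G v) then {v} else {})"
  shows "annihilator (leavitt_algebra G) M = annihilator (leavitt_algebra G) (N_module G v)"
proof (rule same_annihilatorI)
  show "leavitt_module G (N_module G v :: (('v, 'e, 'k) free_elem set, _) module)"
    unfolding N_module_def
    by (rule branching_system.branching_leavitt_module[OF path_branching_system[OF wf_digraph_axioms assms(1)]])
qed (use N_support[OF assms(1), where 'k = 'k] assms in simp_all)

lemma same_annihilator_V:
  assumes "infinite_path G \<alpha>" "\<And>N L. L > (0::nat) \<Longrightarrow> \<exists>n\<ge>N. \<alpha> (n + L) \<noteq> \<alpha> n"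
    "support G kernel = root_set G (infinite_path_verts G \<alpha>)" "defects G kernel = {}"
  shows "annihilator (leavitt_algebra G) M = annihilator (leavitt_algebra G) (V_module G \<alpha>)"
proof (rule same_annihilatorI)
  show "leavitt_module G (V_module G \<alpha> :: (('v, 'e, 'k) free_elem set, _) module)"
    unfolding V_module_def
    by (rule branching_system.branching_leavitt_module[OF infinite_path_branching_system[OF wf_digraph_axioms]])
  show "leavitt_kernel.graded_kernel G (ann_kernel G (V_module G \<alpha> :: (('v, 'e, 'k) free_elem set, _) module))"
    by (rule V_graded[OF assms(1,2)])
qed (use V_support[OF assms(1), where 'k = 'k] assms in simp_all)

lemma same_annihilator_N_cycle:
  assumes "exclusive_cycle G c" "v \<in> cycle_verts G c" "support G kernel = root_set G {v}" "defects G kernel = {}"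
  shows "annihilator (leavitt_algebra G) M = annihilator (leavitt_algebra G) (N_cycle_module G c v)"
proof (rule same_annihilatorI)
  show "leavitt_module G (N_cycle_module G c v :: (('v, 'e, 'k) free_elem set, _) module)"
    unfolding N_cycle_module_def
    by (rule branching_system.branching_leavitt_module[OF cycle_branching_system[OF wf_digraph_axioms assms(1,2)]])
qed (use N_cycle_support[OF assms(1,2), where 'k = 'k] assms in simp_all)

lemma annihilator_has_type: "\<exists>t. annihilator_of_type G t (annihilator (leavitt_algebra G) M)"
proof -
  let ?T = "support G kernel" and ?I = "annihilator (leavitt_algebra G) M"
  have TV: "?T \<subseteq> verts G" by (auto simp: support_def)
  have up: "u \<in> ?T" if "u \<rightarrow>\<^sup>*\<^bsub>G\<^esub> w" "w \<in> ?T" for u w by (rule K.support_upward[OF that])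
  have kept: "kept_edges G kernel v = {e \<in> out_arcs G v. head G e \<in> ?T}" for v by (rule kept_edges_support)
  show ?thesis
  proof (cases "defects G kernel = {}")
    case False
    then obtain v where v: "v \<in> defects G kernel" by blast
    have T: "?T = root_set G {v}" and B: "defects G kernel = {v}" using defect_vertex[OF v] by blast+
    have R: "returning_edges G v = kept_edges G kernel v" unfolding kept returning_edges_def T ..
    have inf: "infinite_emitter G v" and fin: "finite (returning_edges G v)"
      using v unfolding R by (simp_all add: defects_def)
    have I: "?I = annihilator (leavitt_algebra G) (N_module G v)"
      by (rule same_annihilator_N) (use inf fin T B in simp_all)
    consider "card (returning_edges G v) = 0" | "card (returning_edges G v) = 1" | "card (returning_edges G v) > 1" by linarith
    then show ?thesis
    proof cases
      case 1
      then have "returning_edges G v = {}" using fin by simp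
      then have "annihilator_of_type G Relative_sink_type ?I" using inf I by auto
      then show ?thesis by blast
    next
      case 2
      then have "annihilator_of_type G Exclusive_cycle_type ?I" using inf I by auto
      then show ?thesis by blast
    next
      case 3
      then have "annihilator_of_type G Extreme_cycle_type ?I" using inf I fin by auto
      then show ?thesis by blast
    qed
  next
    case B: True
    show ?thesis
    proof (cases "\<exists>s\<in>?T. sink G s")
      case True
      then obtain s where s: "s \<in> ?T" "sink G s" by blast
      have stay: "w = s" if sw: "s \<rightarrow>\<^sup>*\<^bsub>G\<^esub> w" for w
      proof -
        obtain p where p: "awalk s p w" using sw by (auto simp: reachable_awalk)
        then have "p = []" using s(2) by (cases p) (auto simp: awalk_Cons_iff sink_def)
        then show ?thesis using p by (auto simp: awalk_Nil_iff)
      qed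
      \<comment> \<open>By directedness every vertex of the support has a common successor with the
        sink, which can only be the sink.\<close>
      have T: "?T = root_set G {s}"
      proof (intro subset_antisym subsetI)
        fix z assume "z \<in> ?T"
        then obtain w where "z \<rightarrow>\<^sup>*\<^bsub>G\<^esub> w" "s \<rightarrow>\<^sup>*\<^bsub>G\<^esub> w" using support_directed s(1) by blast
        then show "z \<in> root_set G {s}" using stay by (auto simp: root_set_iff)
      next
        fix z assume "z \<in> root_set G {s}"
        then show "z \<in> ?T" using up s(1) by (auto simp: root_set_iff)
      qed
      have "\<not> infinite_emitter G s" using s(2) by (auto simp: sink_def infinite_emitter_def)
      then have "?I = annihilator (leavitt_algebra G) (N_module G s)"
        using s(2) T B by (intro same_annihilator_N) simp_all
      then have "annihilator_of_type G Relative_sink_type ?I" using s(2) by auto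
      then show ?thesis by blast
    next
      case no_sink: False
      \<comment> \<open>A vertex without kept edges would be an infinite emitter whose gap element
        is the vertex itself, hence a defect.\<close>
      have kept_ne: "kept_edges G kernel v \<noteq> {}" if v: "v \<in> ?T" for v
      proof
        assume empty: "kept_edges G kernel v = {}"
        have "\<not> regular_vertex G v" using K.support_regular[OF v] empty by blast
        then have inf: "infinite_emitter G v" using no_sink v TV by (auto simp: regular_vertex_def)
        have "gap G {} v \<notin> kernel" using v by (simp add: gap_def support_def)
        then have "v \<in> defects G kernel" using inf v empty by (simp add: defects_def)
        then show False using B by blast
      qed
      show ?thesis
      proof (cases "\<exists>v\<in>?T. ?T = root_set G {v}")
        case False
        obtain D where D: "countable D" "D \<subseteq> ?T" "?T = root_set G D" using countable_cofinal by blast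
        have nocof: "root_set G {v} \<noteq> ?T" if "v \<in> ?T" for v using False that by blast
        obtain \<alpha> where \<alpha>: "strictly_decreasing_path G \<alpha>" "root_set G (infinite_path_verts G \<alpha>) = ?T"
          using strictly_decreasing_path_exists[OF D support_nonempty support_directed nocof] by blast
        have "infinite_path G \<alpha>" using \<alpha>(1) by (simp add: strictly_decreasing_path_def)
        then have "?I = annihilator (leavitt_algebra G) (V_module G \<alpha>)"
          using strictly_decreasing_aperiodic[OF \<alpha>(1)] \<alpha>(2) B by (intro same_annihilator_V) simp_all
        moreover have "root_set G {v} \<subset> ?T" if v: "v \<in> ?T" for v
        proof -
          have "root_set G {v} \<subseteq> ?T" using up v by (auto simp: root_set_iff)
          then show ?thesis using nocof[OF v] by blast
        qed
        ultimately have "annihilator_of_type G Decreasing_path_type ?I"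
          using \<alpha> unfolding annihilator_of_type.simps by blast
        then show ?thesis by blast
      next
        case True
        then obtain v where v: "v \<in> ?T" "?T = root_set G {v}" by blast
        have toV: "x \<rightarrow>\<^sup>*\<^bsub>G\<^esub> v" if "x \<in> ?T" for x using that v(2) by (simp add: root_set_iff)
        have cof: "?T = root_set G {w}" if "w \<in> ?T" "v \<rightarrow>\<^sup>*\<^bsub>G\<^esub> w" for w
        proof (intro subset_antisym subsetI)
          fix z assume "z \<in> ?T"
          then show "z \<in> root_set G {w}" using toV that(2) reachable_trans unfolding root_set_iff by blast
        next
          fix z assume "z \<in> root_set G {w}"
          then show "z \<in> ?T" using up that(1) by (auto simp: root_set_iff)
        qed
        \<comment> \<open>Every vertex that \<open>v\<close> reaches inside the support is cofinal
          too, so branching may be sought at any of them.\<close>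
        consider (inf) w where "w \<in> ?T" "v \<rightarrow>\<^sup>*\<^bsub>G\<^esub> w" "infinite (kept_edges G kernel w)"
          | (two) w e f where "w \<in> ?T" "v \<rightarrow>\<^sup>*\<^bsub>G\<^esub> w" "e \<in> kept_edges G kernel w" "f \<in> kept_edges G kernel w" "e \<noteq> f"
          | (one) "\<forall>w e f. w \<in> ?T \<and> v \<rightarrow>\<^sup>*\<^bsub>G\<^esub> w \<and> e \<in> kept_edges G kernel w \<and> f \<in> kept_edges G kernel w \<longrightarrow> e = f"
          by blast
        then show ?thesis
        proof cases
          case inf
          note T = cof[OF inf(1,2)]
          have "returning_edges G w = kept_edges G kernel w" unfolding returning_edges_def kept T ..
          then have R: "infinite (returning_edges G w)" using inf(3) by simp
          then have "infinite (out_arcs G w)" using finite_subset[of "returning_edges G w" "out_arcs G w"]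
            unfolding returning_edges_def by blast
          then have w: "infinite_emitter G w" using inf(1) TV by (auto simp: infinite_emitter_def)
          have "?I = annihilator (leavitt_algebra G) (N_module G w)"
            by (rule same_annihilator_N) (use w T B R in simp_all)
          then have "annihilator_of_type G Extreme_cycle_type ?I" using w R by auto
          then show ?thesis by blast
        next
          case two
          note T = cof[OF two(1,2)]
          have wV: "w \<in> verts G" using two(1) TV by blast
          have e: "e \<in> out_arcs G w" "head G e \<in> ?T" and f: "f \<in> out_arcs G w" "head G f \<in> ?T"
            using two(3,4) unfolding kept by auto
          obtain \<alpha> where \<alpha>: "infinite_path G \<alpha>" "tail G (\<alpha> 0) = w" "range (\<lambda>n. tail G (\<alpha> n)) \<subseteq> ?T"
            "\<And>N L. L > (0::nat) \<Longrightarrow> \<exists>n\<ge>N. \<alpha> (n + L) \<noteq> \<alpha> n"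
            using aperiodic_path_exists[OF T wV e f two(5)] by blast
          have \<alpha>T: "tail G (\<alpha> n) \<in> ?T" for n using \<alpha>(3) by blast
          have R: "root_set G (infinite_path_verts G \<alpha>) = ?T"
          proof (intro subset_antisym subsetI)
            fix z assume "z \<in> root_set G (infinite_path_verts G \<alpha>)"
            then obtain n where "z \<rightarrow>\<^sup>*\<^bsub>G\<^esub> tail G (\<alpha> n)" unfolding root_set_iff infinite_path_verts_def by blast
            then show "z \<in> ?T" using up \<alpha>T by blast
          next
            fix z assume "z \<in> ?T"
            then have "z \<rightarrow>\<^sup>*\<^bsub>G\<^esub> tail G (\<alpha> 0)" using T \<alpha>(2) by (simp add: root_set_iff)
            then show "z \<in> root_set G (infinite_path_verts G \<alpha>)" unfolding root_set_iff infinite_path_verts_def by blast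
          qed
          have "?I = annihilator (leavitt_algebra G) (V_module G \<alpha>)"
            by (rule same_annihilator_V[OF \<alpha>(1,4)]) (use R B in simp_all)
          moreover have "irrational_path G \<alpha>" by (rule aperiodic_irrational[OF \<alpha>(1,4)])
          moreover have "\<exists>c. u \<in> cycle_verts G c \<and> extreme_cycle G ?T c" if u: "u \<in> infinite_path_verts G \<alpha>" for u
          proof -
            obtain n where n: "u = tail G (\<alpha> n)" using u by (auto simp: infinite_path_verts_def)
            have "\<alpha> n \<in> arcs G" "head G (\<alpha> n) \<in> ?T" using \<alpha>(1) \<alpha>T[of "Suc n"] by (auto simp: infinite_path_def)
            moreover have "w \<rightarrow>\<^sup>*\<^bsub>G\<^esub> u" using infinite_path_reachable[OF \<alpha>(1), of 0 n] \<alpha>(2) n by simp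
            ultimately show ?thesis using extreme_cycle_exists[OF T wV e f two(5) _ n[symmetric]] by blast
          qed
          ultimately have "annihilator_of_type G Extreme_cycle_type ?I"
            unfolding annihilator_of_type.simps R by (intro disjI1 exI[of _ \<alpha>] conjI ballI) (simp_all only: R)
          then show ?thesis by blast
        next
          case one
          obtain e where "e \<in> kept_edges G kernel v" using kept_ne[OF v(1)] by blast
          then have e: "e \<in> arcs G" "tail G e = v" "head G e \<in> ?T" unfolding kept by auto
          obtain p where c: "cycle (e # p)" using cycle_through[OF e(1)] toV[OF e(3)] e(2) by auto
          have vc: "v \<in> cycle_verts G (e # p)" using e(2) by (simp add: cycle_verts_def)
          have exc: "exclusive_cycle G (e # p)"
          proof (rule deterministic_exclusive_cycle[OF c _ vc])
            \<comment> \<open>Returning edges end in the support, so they are kept edges, and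
              \<open>one\<close> leaves a single one at each vertex.\<close>
            fix g h assume gh: "g \<in> arcs G" "h \<in> arcs G" "tail G g = tail G h" "tail G g \<rightarrow>\<^sup>*\<^bsub>G\<^esub> v" "v \<rightarrow>\<^sup>*\<^bsub>G\<^esub> tail G g"
              "head G g \<rightarrow>\<^sup>*\<^bsub>G\<^esub> tail G g" "head G h \<rightarrow>\<^sup>*\<^bsub>G\<^esub> tail G g"
            have t: "tail G g \<in> ?T" using up[OF gh(4) v(1)] .
            have "g \<in> kept_edges G kernel (tail G g)" "h \<in> kept_edges G kernel (tail G g)"
              unfolding kept using gh(1-3) up[OF gh(6) t] up[OF gh(7) t] by auto
            then show "g = h" using one t gh(5) by blast
          qed
          have "?I = annihilator (leavitt_algebra G) (N_cycle_module G (e # p) v)"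
            by (rule same_annihilator_N_cycle[OF exc vc v(2) B])
          then have "annihilator_of_type G Exclusive_cycle_type ?I"
            unfolding annihilator_of_type.simps using exc vc by blast
          then show ?thesis by blast
        qed
      qed
    qed
  qed
qed

end

theorem theorem4p8:
  fixes E :: "('v, 'e) pre_digraph"
    and M :: "(('v, 'e, 'k::field) free_elem set, 'm) module"
    and Mg :: "int \<Rightarrow> 'm set"
  assumes "wf_digraph E"
    and "graded_simple (leavitt_algebra E) (leavitt_component E) M Mg"
  shows "\<exists>!t. annihilator_of_type E t (annihilator (leavitt_algebra E) M)"
proof -
  have "left_module (leavitt_algebra E) M"
    using assms(2) by (simp add: graded_simple_def graded_left_module_def)
  then interpret graded_simple_module E M Mg
    using assms by (simp add: graded_simple_module_def graded_simple_module_axioms_def leavitt_module_def)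
  show ?thesis
    using annihilator_has_type annihilator_of_type_invariants invariants_of_type_unique by (metis (no_types, lifting))
qed

end
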